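(* Let $\alpha\in(0,2)$ and $j\in\{1,2\}$. There exists $C>0$ such that for all $u\in\mathcal{S}(\mathbb{R})$ and all $A>1$, $$\left\|\left[|D|^\alpha,\Phi_{j,A}\right]u\right\|_{L^2}^2\leq\begin{cases}\displaystyle\frac{C}{A^{2\alpha}}\int u^2\,\Phi_{j,A}^2,&\text{if }\alpha\in(0,1],\\[2mm] \displaystyle\frac{C}{A^\alpha}\int\left(u^2+\left(|D|^{\frac\alpha2}u\right)^2\right)\Phi_{j,A}^2,&\text{if }\alpha\in(1,2).\end{cases}$$
   Context: $|D|^s$ is the Fourier multiplier with symbol $|\xi|^s$; $[\cdot,\cdot]$ is the commutator, with a function identified with the multiplication operator by it; $\langle s\rangle=(1+s^2)^{1/2}$. Let $$\phi(y)=\left(\int_{-\infty}^{+\infty}\frac{ds}{\langle s\rangle^{1+\alpha}}\right)^{-1}\int_y^{+\infty}\frac{ds}{\langle s\rangle^{1+\alpha}}.$$ For real numbers $\mu_1,\mu_2>-1$ (in the paper, the values at a fixed time of the modulation parameters, which are small), set $$\phi_1(y)=\frac{1-\phi(y)}{(1+\mu_1)^2}+\frac{\phi(y)}{(1+\mu_2)^2},\qquad \phi_2(y)=\frac{\mu_1}{(1+\mu_1)^2}(1-\phi(y))+\frac{\mu_2}{(1+\mu_2)^2}\phi(y),$$ $\Phi_j(y)=\sqrt{|\phi_j'(y)|}$ and $\Phi_{j,A}(y)=\Phi_j(y/A)$. The constant $C$ depends only on $\alpha$. *)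

theory Defs
  imports "HOL-Analysis.Analysis"
begin

definition schwartz :: "(real \<Rightarrow> real) \<Rightarrow> bool" where
  "schwartz u \<longleftrightarrow>
     (\<forall>k x. (deriv ^^ k) u field_differentiable at x) \<and>
     (\<forall>m k. bounded (range (\<lambda>x. x ^ m * (deriv ^^ k) u x)))"

definition fourier_transform :: "(real \<Rightarrow> complex) \<Rightarrow> real \<Rightarrow> complex" where
  "fourier_transform f \<xi> = (LINT x|lborel. exp (- (\<i> * of_real (x * \<xi>))) * f x)"

definition inverse_fourier_transform :: "(real \<Rightarrow> complex) \<Rightarrow> real \<Rightarrow> complex" where
  "inverse_fourier_transform g x =
     of_real (1 / (2 * pi)) * (LINT \<xi>|lborel. exp (\<i> * of_real (x * \<xi>)) * g \<xi>)"

definition fourier_multiplier ::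
  "(real \<Rightarrow> complex) \<Rightarrow> (real \<Rightarrow> complex) \<Rightarrow> real \<Rightarrow> complex" where
  "fourier_multiplier m f =
     inverse_fourier_transform (\<lambda>\<xi>. m \<xi> * fourier_transform f \<xi>)"

text \<open>The integrals converge absolutely for Schwartz \<open>f\<close> and \<open>s > 0\<close>, which is the only case used;
  for real-valued \<open>f\<close> the values are real.\<close>

definition abs_D :: "real \<Rightarrow> (real \<Rightarrow> complex) \<Rightarrow> real \<Rightarrow> complex" where
  "abs_D s = fourier_multiplier (\<lambda>\<xi>. of_real (\<bar>\<xi>\<bar> powr s))"

definition commutator ::
  "((real \<Rightarrow> complex) \<Rightarrow> real \<Rightarrow> complex) \<Rightarrow> (real \<Rightarrow> real) \<Rightarrow> (real \<Rightarrow> complex) \<Rightarrow> real \<Rightarrow> complex" where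
  "commutator T g f = (\<lambda>x. T (\<lambda>y. of_real (g y) * f y) x - of_real (g x) * T f x)"

text \<open>An extended nonnegative value, so that a function that is not square integrable has
  infinite norm (a Bochner integral would give \<open>0\<close>).\<close>

definition L2_norm_squared :: "(real \<Rightarrow> complex) \<Rightarrow> ennreal" where
  "L2_norm_squared f = (\<integral>\<^sup>+x. ennreal ((cmod (f x))\<^sup>2) \<partial>lborel)"

definition bracket :: "real \<Rightarrow> real" where
  "bracket s = (1 + s\<^sup>2) powr (1 / 2)"

definition phi :: "real \<Rightarrow> real \<Rightarrow> real" where
  "phi \<alpha> y =
     inverse (LINT s|lborel. 1 / bracket s powr (1 + \<alpha>)) *
     (LINT s:{y..}|lborel. 1 / bracket s powr (1 + \<alpha>))"

definition phi1 :: "real \<Rightarrow> real \<Rightarrow> real \<Rightarrow> real \<Rightarrow> real" where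
  "phi1 \<alpha> \<mu>1 \<mu>2 y = (1 - phi \<alpha> y) / (1 + \<mu>1)\<^sup>2 + phi \<alpha> y / (1 + \<mu>2)\<^sup>2"

definition phi2 :: "real \<Rightarrow> real \<Rightarrow> real \<Rightarrow> real \<Rightarrow> real" where
  "phi2 \<alpha> \<mu>1 \<mu>2 y =
     \<mu>1 / (1 + \<mu>1)\<^sup>2 * (1 - phi \<alpha> y) + \<mu>2 / (1 + \<mu>2)\<^sup>2 * phi \<alpha> y"

text \<open>The index \<open>j\<close> is only meant to be \<open>1\<close> or \<open>2\<close>.\<close>

definition Phi :: "nat \<Rightarrow> real \<Rightarrow> real \<Rightarrow> real \<Rightarrow> real \<Rightarrow> real" where
  "Phi j \<alpha> \<mu>1 \<mu>2 y =
     sqrt \<bar>deriv (if j = 1 then phi1 \<alpha> \<mu>1 \<mu>2 else phi2 \<alpha> \<mu>1 \<mu>2) y\<bar>"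

definition Phi_scaled :: "nat \<Rightarrow> real \<Rightarrow> real \<Rightarrow> real \<Rightarrow> real \<Rightarrow> real \<Rightarrow> real" where
  "Phi_scaled j \<alpha> \<mu>1 \<mu>2 A y = Phi j \<alpha> \<mu>1 \<mu>2 (y / A)"

end

theory Submission
  imports Defs "HOL-Probability.Characteristic_Functions" "HOL-Probability.Sinc_Integral"
    "HOL-Real_Asymp.Real_Asymp"
begin

text \<open>
  Write \<open>w(y) = (1 + y\<^sup>2)\<^bsup>-(1 + \<alpha>)/4\<^esup>\<close>. The derivative of \<open>\<phi>\<close> is a constant times \<open>w\<^sup>2\<close>, so each
  \<open>\<Phi>\<^sub>j\<close> is a nonnegative constant times \<open>w\<close> (\<open>Phi_eq_weight\<close>). The constant depends on \<open>\<mu>\<^sub>1, \<mu>\<^sub>2\<close>, but its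
  square is a factor of both sides. The dilation \<open>x = A y\<close> then reduces the claim to \<open>A = 1\<close>: the
  commutator gains \<open>A\<^bsup>-\<alpha>\<^esup>\<close> and \<open>|D|\<^bsup>\<alpha>/2\<^esup>u\<close> gains \<open>A\<^bsup>-\<alpha>/2\<^esup>\<close>, which gives the power \<open>A\<^bsup>-2\<alpha>\<^esup>\<close> directly if
  \<open>\<alpha> \<le> 1\<close>, and \<open>A\<^bsup>-\<alpha>\<^esup>\<close> for the two terms together if \<open>\<alpha> > 1\<close>, because \<open>A > 1\<close>. What remains is
  \<open>weighted_commutator_estimate\<close>, a bound of \<open>[|D|\<^sup>\<alpha>, w]u\<close> by \<open>F = |w u|\<close> in \<open>L\<^sup>2\<close> (and by \<open>w |D|\<^bsup>\<alpha>/2\<^esup>u\<close> if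
  \<open>\<alpha> > 1\<close>).

  By Fourier inversion \<open>|D|\<^sup>\<alpha>f(x)\<close> is, up to a positive constant, the integral over \<open>t > 0\<close> of the second
  difference \<open>2f(x) - f(x + t) - f(x - t)\<close> against \<open>t\<^bsup>-1-\<alpha>\<^esup>\<close>. In the commutator the value \<open>u(x)\<close> cancels and
  what is left is the integral of \<open>(w(x) - w(y)) u(y)\<close>, \<open>y = x \<plusminus> t\<close>, against \<open>t\<^bsup>-1-\<alpha>\<^esup>\<close>
  (\<open>commutator_singular_integral\<close>).

  For \<open>t > 1\<close> the inequality \<open>w(x) \<le> C w(y) (1 + w(x) |x - y|\<^bsup>(1+\<alpha>)/2\<^esup>)\<close> (\<open>weight_far\<close>) bounds this by
  \<open>F\<close> convolved with the integrable \<open>|z|\<^bsup>-1-\<alpha>\<^esup>\<close>, plus \<open>w(x)\<close> times \<open>F\<close> convolved with \<open>|z|\<^bsup>-(1+\<alpha>)/2\<^esup>\<close>.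
  The first term is handled by Young's inequality, the second by Cauchy-Schwarz, since both \<open>w\<close> and
  \<open>|z|\<^bsup>-(1+\<alpha>)/2\<^esup>\<close> on \<open>|z| > 1\<close> are square integrable.

  For \<open>t \<le> 1\<close> the bound \<open>|w(x) - w(y)| \<le> C |x - y| w(y)\<close> leaves the kernel \<open>|z|\<^bsup>-\<alpha>\<^esup>\<close>, which settles
  \<open>\<alpha> < 1\<close>. For \<open>\<alpha> \<ge> 1\<close> a second-order expansion of \<open>w\<close> leaves the integrable \<open>|z|\<^bsup>1-\<alpha>\<^esup>\<close> and the principal
  term \<open>w'(x) T u(x)\<close>, where \<open>T u(x)\<close> is the integral of \<open>(u(x + t) - u(x - t)) t\<^bsup>-\<alpha>\<^esup>\<close> over \<open>0 < t \<le> 1\<close>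
  (\<open>localized_difference\<close>). As \<open>|w'| \<le> C w\<close>, the function \<open>w T u\<close> has to be bounded in \<open>L\<^sup>2\<close>.

  If \<open>\<alpha> = 1\<close>, then \<open>T\<close> is the Fourier multiplier by a bounded sine integral, hence bounded on \<open>L\<^sup>2\<close> by
  Plancherel's theorem, and moving \<open>w\<close> inside \<open>T\<close> costs a bounded kernel supported in \<open>|z| \<le> 1\<close>.

  If \<open>\<alpha> > 1\<close>, then \<open>T\<close> has order \<open>\<alpha> - 1\<close>, less than \<open>s = \<alpha>/2\<close>. The kernel \<open>|z|\<^bsup>-1-s\<^esup>\<close> of \<open>|D|\<^sup>s\<close> decays too
  slowly for \<open>w\<close> to be moved through \<open>|D|\<^sup>s\<close>: compared with the growth of \<open>1/w\<close> it just misses by a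
  logarithm. Instead \<open>u\<close> is recovered from \<open>u\<close> and \<open>|D|\<^sup>su\<close> by convolutions with rapidly
  decaying kernels (\<open>reproducing_formula\<close>): a low-frequency kernel acting on \<open>u\<close>, and for each scale
  \<open>0 < \<rho> \<le> 1\<close> a kernel of width \<open>\<rho>\<close> acting on \<open>|D|\<^sup>su\<close> with density \<open>\<rho>\<^bsup>s-1\<^esup>\<close>. A symmetric difference of step \<open>t\<close> of
  the kernel of width \<open>\<rho>\<close> has weighted mass at most \<open>C min(1, t/\<rho>)\<close> (\<open>difference_kernel_bound\<close>), and
  integrating this against \<open>\<rho>\<^bsup>s-1\<^esup>\<close> and \<open>t\<^bsup>-\<alpha>\<^esup>\<close> converges precisely because \<open>\<alpha> - 1 < s\<close>. By Peetre's inequality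
  \<open>w(x) \<le> C (1 + |z|\<^sup>2)\<^bsup>(1+\<alpha>)/4\<^esup> w(x - z)\<close>, weighted masses of this kind control convolutions on weighted \<open>L\<^sup>2\<close>
  (\<open>weighted_young\<close>).
\<close>

section \<open>Fourier inversion and Plancherel\<close>

text \<open>Nearly all nonnegative integrals below are over the line with Lebesgue measure, which this notation leaves out.\<close>

abbreviation nn_integral_lborel :: "(real \<Rightarrow> ennreal) \<Rightarrow> ennreal" (binder "\<integral>\<^sup>+" 10) where
  "nn_integral_lborel f \<equiv> nn_integral lborel f"

lemma borel_measurable_cis [measurable]: "cis \<in> borel_measurable borel"
  by (intro borel_measurable_continuous_onI continuous_on_cis continuous_on_id)

lemma borel_measurable_cnj [measurable]: "cnj \<in> borel_measurable borel"
  by (intro borel_measurable_continuous_onI continuous_on_cnj continuous_on_id)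

lemma fourier_transform_cis:
  "fourier_transform f \<xi> = (LBINT x. cis (- (x * \<xi>)) * f x)"
  unfolding fourier_transform_def by (simp add: cis_conv_exp)

lemma inverse_fourier_transform_cis:
  "inverse_fourier_transform g x = of_real (1 / (2 * pi)) * (LBINT \<xi>. cis (x * \<xi>) * g \<xi>)"
  unfolding inverse_fourier_transform_def by (simp add: cis_conv_exp)

lemma integrable_cis_mult:
  fixes f :: "real \<Rightarrow> complex"
  assumes "integrable lborel f" and [measurable]: "a \<in> borel_measurable borel"
  shows "integrable lborel (\<lambda>x. cis (a x) * f x)"
proof (rule Bochner_Integration.integrable_bound[OF assms(1)])
  have [measurable]: "f \<in> borel_measurable borel" using assms(1) by auto
  show "(\<lambda>x. cis (a x) * f x) \<in> borel_measurable lborel" by simp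
qed (simp add: norm_mult)

text \<open>All double integrals below have an integrand dominated by a product of two integrable functions of one
variable each. This form of Fubini's theorem reduces each exchange to finding the two factors.\<close>

lemma fubini_product_bound:
  fixes f :: "real \<Rightarrow> real \<Rightarrow> 'b::{banach, second_countable_topology}"
  assumes [measurable]: "case_prod f \<in> borel_measurable (borel \<Otimes>\<^sub>M borel)"
    and g: "integrable lborel g" and h: "integrable lborel h"
    and le: "\<And>x y. norm (f x y) \<le> g x * h y"
  shows "integrable (lborel \<Otimes>\<^sub>M lborel) (case_prod f)"
    and "(LBINT x. LBINT y. f x y) = (LBINT y. LBINT x. f x y)"
    and "integrable lborel (\<lambda>x. LBINT y. f x y)"
    and "integrable lborel (\<lambda>y. LBINT x. f x y)"
proof -
  have [measurable]: "g \<in> borel_measurable borel" "h \<in> borel_measurable borel" using g h by auto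
  have "integrable (lborel \<Otimes>\<^sub>M lborel) (\<lambda>(x, y). g x * h y)"
    by (rule lborel_pair.Fubini_integrable) (use g h in \<open>auto simp: abs_mult\<close>)
  then show i: "integrable (lborel \<Otimes>\<^sub>M lborel) (case_prod f)"
    by (rule Bochner_Integration.integrable_bound)
       (use le order_trans[OF le abs_ge_self] in \<open>auto intro!: AE_I2\<close>)
  show "(LBINT x. LBINT y. f x y) = (LBINT y. LBINT x. f x y)"
    using lborel_pair.Fubini_integral[OF i] by simp
  show "integrable lborel (\<lambda>x. LBINT y. f x y)"
    using lborel_pair.integrable_fst[OF i] .
  show "integrable lborel (\<lambda>y. LBINT x. f x y)"
    using lborel_pair.integrable_snd[OF i] .
qed

lemma integrable_rational: "integrable lborel (\<lambda>x::real. C / (1 + x\<^sup>2))"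
proof -
  have "integrable lborel (\<lambda>x::real. C * inverse (1 + x\<^sup>2))"
    using integrable_inverse_1_plus_square
    by (simp add: set_integrable_def einterval_eq_UNIV)
  then show ?thesis by (simp add: divide_inverse)
qed

lemma gaussian_fourier:
  fixes a e :: real
  assumes "e > 0"
  shows "(LBINT \<xi>. cis (a * \<xi>) * of_real (exp (- (e * \<xi>)\<^sup>2 / 2)))
    = of_real (sqrt (2 * pi) / e * exp (- (a / e)\<^sup>2 / 2))" (is "?L = _")
    and "integrable lborel (\<lambda>\<xi>. exp (- (e * \<xi>)\<^sup>2 / 2))"
proof -
  have *: "(LBINT x. of_real (std_normal_density x) * cis (t * x)) = of_real (exp (- t\<^sup>2 / 2))" for t
  proof -
    have "char std_normal_distribution t = of_real (exp (- t\<^sup>2 / 2))"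
      by (simp add: char_std_normal_distribution)
    moreover have "char std_normal_distribution t = (LBINT x. std_normal_density x *\<^sub>R iexp (t * x))"
      unfolding char_def by (subst integral_density) auto
    ultimately show ?thesis by (simp add: cis_conv_exp scaleR_conv_of_real)
  qed
  \<comment> \<open>Substitute \<open>e x\<close> in the characteristic function of the normal distribution.\<close>
  have "of_real (exp (- (a / e)\<^sup>2 / 2)) = (LBINT x. of_real (std_normal_density x) * cis (a / e * x))"
    using *[of "a / e"] by simp
  also have "\<dots> = \<bar>e\<bar> *\<^sub>R (LBINT x. of_real (std_normal_density (0 + e * x)) * cis (a / e * (0 + e * x)))"
    by (rule lborel_integral_real_affine) (use assms in simp)
  also have "\<dots> = of_real (e / sqrt (2 * pi)) * ?L"
    using assms by (simp add: std_normal_density_def scaleR_conv_of_real mult_ac power_mult_distrib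
      flip: integral_mult_right_zero)
  finally show "?L = of_real (sqrt (2 * pi) / e * exp (- (a / e)\<^sup>2 / 2))"
    using assms by (simp add: field_simps)
  have "integrable lborel (\<lambda>x. sqrt (2 * pi) * std_normal_density (0 + e * x))"
    by (intro integrable_mult_right lborel_integrable_real_affine) (use assms in auto)
  then show "integrable lborel (\<lambda>\<xi>. exp (- (e * \<xi>)\<^sup>2 / 2))"
    by (simp add: std_normal_density_def)
qed

text \<open>Inserting the factor \<open>exp (- (e \<xi>)\<^sup>2 / 2)\<close> makes the double integral absolutely convergent. Exchanging the
integrals turns the inner one into a Gaussian of width \<open>e\<close> around \<open>x\<close>, so the regularized inverse
transform is an average of \<open>f\<close> near \<open>x\<close>. Both sides converge by dominated convergence as \<open>e\<close> tends to 0;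
boundedness of \<open>f\<close> provides the majorant on the side of the average.\<close>

theorem fourier_inversion:
  fixes f :: "real \<Rightarrow> complex"
  assumes f: "integrable lborel f" and cont: "continuous_on UNIV f" and bd: "\<And>x. norm (f x) \<le> B"
    and F: "integrable lborel (fourier_transform f)"
  shows "inverse_fourier_transform (fourier_transform f) x = f x"
proof -
  define e where "e n = 1 / (real n + 1)" for n
  define \<gamma> where "\<gamma> z = exp (- z\<^sup>2 / 2)" for z :: real
  have \<gamma>i: "integrable lborel (\<lambda>x. \<gamma> (r * x))" if "r > 0" for r
    using gaussian_fourier(2)[OF that] by (simp add: \<gamma>_def)
  have e0: "e n > 0" for n by (simp add: e_def)
  have elim: "e \<longlonglongrightarrow> 0" unfolding e_def using LIMSEQ_inverse_real_of_nat by (simp add: inverse_eq_divide add.commute)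
  have [measurable]: "f \<in> borel_measurable borel" "fourier_transform f \<in> borel_measurable borel"
    using f F by auto
  have [measurable]: "\<gamma> \<in> borel_measurable borel" unfolding \<gamma>_def by measurable
  have \<gamma>1: "0 \<le> \<gamma> z" "\<gamma> z \<le> 1" for z by (auto simp: \<gamma>_def)
  define I where "I n = (LBINT \<xi>. cis (x * \<xi>) * of_real (\<gamma> (e n * \<xi>)) * fourier_transform f \<xi>)" for n
  have lim1: "I \<longlonglongrightarrow> (LBINT \<xi>. cis (x * \<xi>) * fourier_transform f \<xi>)"
    unfolding I_def
  proof (rule integral_dominated_convergence[where w = "\<lambda>\<xi>. norm (fourier_transform f \<xi>)"])
    show "AE \<xi> in lborel. (\<lambda>n. cis (x * \<xi>) * of_real (\<gamma> (e n * \<xi>)) * fourier_transform f \<xi>) \<longlonglongrightarrow> cis (x * \<xi>) * fourier_transform f \<xi>"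
    proof (rule AE_I2)
      fix \<xi>
      have "(\<lambda>n. exp (- (e n * \<xi>)\<^sup>2 / 2)) \<longlonglongrightarrow> exp (- (0 * \<xi>)\<^sup>2 / 2)"
        by (intro tendsto_intros elim) auto
      then have "(\<lambda>n. \<gamma> (e n * \<xi>)) \<longlonglongrightarrow> 1" by (simp add: \<gamma>_def)
      then have "(\<lambda>n. cis (x * \<xi>) * of_real (\<gamma> (e n * \<xi>)) * fourier_transform f \<xi>) \<longlonglongrightarrow> cis (x * \<xi>) * of_real 1 * fourier_transform f \<xi>"
        by (intro tendsto_intros)
      then show "(\<lambda>n. cis (x * \<xi>) * of_real (\<gamma> (e n * \<xi>)) * fourier_transform f \<xi>) \<longlonglongrightarrow> cis (x * \<xi>) * fourier_transform f \<xi>"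
        by simp
    qed
    show "AE \<xi> in lborel. norm (cis (x * \<xi>) * of_real (\<gamma> (e n * \<xi>)) * fourier_transform f \<xi>) \<le> norm (fourier_transform f \<xi>)" for n
      using \<gamma>1 by (auto simp: norm_mult intro!: AE_I2 mult_left_le_one_le)
  qed (use F in auto)
  \<comment> \<open>Substituting \<open>y = x + e z\<close> turns the Gaussian of width \<open>e\<close> into the fixed one.\<close>
  have In: "I n = sqrt (2 * pi) *\<^sub>R (LBINT z. \<gamma> z *\<^sub>R f (x + e n * z))" for n
  proof -
    have "I n = (LBINT \<xi>. LBINT y. cis ((x - y) * \<xi>) * of_real (\<gamma> (e n * \<xi>)) * f y)"
    proof -
      have "cis ((x - y) * \<xi>) = cis (x * \<xi>) * cis (- (y * \<xi>))" for y \<xi>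
        by (simp add: cis_mult algebra_simps)
      then have "cis ((x - y) * \<xi>) * of_real (\<gamma> (e n * \<xi>)) * f y
          = cis (x * \<xi>) * of_real (\<gamma> (e n * \<xi>)) * (cis (- (y * \<xi>)) * f y)" for y \<xi>
        by (simp only: mult_ac)
      then show ?thesis unfolding I_def fourier_transform_cis by (simp only: integral_mult_right_zero)
    qed
    also have "\<dots> = (LBINT y. LBINT \<xi>. cis ((x - y) * \<xi>) * of_real (\<gamma> (e n * \<xi>)) * f y)"
      by (rule fubini_product_bound(2)[where g = "\<lambda>\<xi>. \<gamma> (e n * \<xi>)" and h = "\<lambda>y. norm (f y)"])
         (use \<gamma>i[OF e0] f \<gamma>1 in \<open>auto simp: norm_mult\<close>)
    also have "\<dots> = (LBINT y. of_real (sqrt (2 * pi) / e n * \<gamma> ((x - y) / e n)) * f y)"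
      using gaussian_fourier(1)[OF e0] by (simp add: \<gamma>_def)
    also have "\<dots> = \<bar>e n\<bar> *\<^sub>R (LBINT z. of_real (sqrt (2 * pi) / e n * \<gamma> ((x - (x + e n * z)) / e n)) * f (x + e n * z))"
      by (rule lborel_integral_real_affine) (use e0[of n] in simp)
    also have "\<dots> = sqrt (2 * pi) *\<^sub>R (LBINT z. \<gamma> z *\<^sub>R f (x + e n * z))"
      using e0[of n] by (simp add: \<gamma>_def scaleR_conv_of_real mult.assoc)
    finally show ?thesis .
  qed
  have lim2: "(\<lambda>n. LBINT z. \<gamma> z *\<^sub>R f (x + e n * z)) \<longlonglongrightarrow> (LBINT z. \<gamma> z *\<^sub>R f x)"
  proof (rule integral_dominated_convergence[where w = "\<lambda>z. \<gamma> z * B"])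
    show "AE z in lborel. (\<lambda>n. \<gamma> z *\<^sub>R f (x + e n * z)) \<longlonglongrightarrow> \<gamma> z *\<^sub>R f x"
    proof (rule AE_I2)
      fix z
      have "isCont f x" using cont by (simp add: continuous_on_eq_continuous_at)
      moreover have "(\<lambda>n. x + e n * z) \<longlonglongrightarrow> x + 0 * z" by (intro tendsto_intros elim)
      ultimately have "(\<lambda>n. f (x + e n * z)) \<longlonglongrightarrow> f x"
        by (intro isCont_tendsto_compose[of x f]) simp_all
      then show "(\<lambda>n. \<gamma> z *\<^sub>R f (x + e n * z)) \<longlonglongrightarrow> \<gamma> z *\<^sub>R f x" by (intro tendsto_intros)
    qed
    show "integrable lborel (\<lambda>z. \<gamma> z * B)" using \<gamma>i[of 1] by simp
    show "AE z in lborel. norm (\<gamma> z *\<^sub>R f (x + e n * z)) \<le> \<gamma> z * B" for n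
      using \<gamma>1 bd by (auto intro!: AE_I2 mult_left_mono)
  qed auto
  have "(LBINT z. \<gamma> z *\<^sub>R f x) = sqrt (2 * pi) *\<^sub>R f x"
  proof -
    have "of_real (LBINT z. \<gamma> z) = complex_of_real (sqrt (2 * pi))"
      using gaussian_fourier(1)[of 1 0] by (simp add: \<gamma>_def del: of_real_mult)
    then have "(LBINT z. \<gamma> z) = sqrt (2 * pi)" using of_real_eq_iff by blast
    then show ?thesis using \<gamma>i[of 1] by simp
  qed
  with lim2 have "I \<longlonglongrightarrow> sqrt (2 * pi) *\<^sub>R sqrt (2 * pi) *\<^sub>R f x"
    unfolding In by (intro tendsto_intros) simp
  then have "I \<longlonglongrightarrow> of_real (2 * pi) * f x" by (simp add: scaleR_conv_of_real flip: mult.assoc of_real_mult)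
  with lim1 have "(LBINT \<xi>. cis (x * \<xi>) * fourier_transform f \<xi>) = of_real (2 * pi) * f x"
    by (rule LIMSEQ_unique)
  then show ?thesis unfolding inverse_fourier_transform_cis by simp
qed

text \<open>Stated for a pair of integrable functions that are transforms of each other in both directions. This is what is
known of \<open>T f\<close> and its transform below, and it makes both functions bounded, hence square integrable.\<close>

lemma plancherel:
  fixes g h :: "real \<Rightarrow> complex"
  assumes g: "integrable lborel g" and h: "integrable lborel h"
    and gh: "\<And>x. g x = of_real (1 / (2 * pi)) * (LBINT \<xi>. cis (x * \<xi>) * h \<xi>)"
    and hg: "\<And>\<xi>. h \<xi> = (LBINT x. cis (- (x * \<xi>)) * g x)"
  shows "(\<integral>\<^sup>+x. (ennreal (norm (g x)))\<^sup>2) = ennreal (1 / (2 * pi)) * (\<integral>\<^sup>+\<xi>. (ennreal (norm (h \<xi>)))\<^sup>2)"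
proof -
  have [measurable]: "g \<in> borel_measurable borel" "h \<in> borel_measurable borel" using g h by auto
  let ?p = "of_real (1 / (2 * pi)) :: complex"
  have sq: "integrable lborel (\<lambda>x. (norm (f x))\<^sup>2)" if f: "integrable lborel f" and B: "\<And>x. norm (f x) \<le> B" for f :: "real \<Rightarrow> complex" and B
  proof (rule Bochner_Integration.integrable_bound)
    show "integrable lborel (\<lambda>x. B * norm (f x))" using f by simp
    show "(\<lambda>x. (norm (f x))\<^sup>2) \<in> borel_measurable lborel" using f by simp
    show "AE x in lborel. norm ((norm (f x))\<^sup>2) \<le> norm (B * norm (f x))"
    proof (rule AE_I2)
      fix x
      have "norm (f x) * norm (f x) \<le> B * norm (f x)" using B[of x] by (rule mult_right_mono) simp
      then show "norm ((norm (f x))\<^sup>2) \<le> norm (B * norm (f x))" by (simp add: power2_eq_square abs_mult)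
         (metis abs_ge_self abs_mult abs_norm_cancel order_trans)
    qed
  qed
  have "norm (h \<xi>) \<le> (LBINT x. norm (g x))" for \<xi>
    unfolding hg[of \<xi>] by (rule order_trans[OF integral_norm_bound]) (simp add: norm_mult)
  note h2 = sq[OF h this]
  have "norm (g x) \<le> 1 / (2 * pi) * (LBINT \<xi>. norm (h \<xi>))" for x
  proof -
    have "norm (LBINT \<xi>. cis (x * \<xi>) * h \<xi>) \<le> (LBINT \<xi>. norm (h \<xi>))"
      by (rule order_trans[OF integral_norm_bound]) (simp add: norm_mult)
    then show ?thesis unfolding gh[of x] norm_mult norm_of_real by (intro mult_mono) auto
  qed
  note g2 = sq[OF g this]
  have "of_real (LBINT x. (norm (g x))\<^sup>2) = (LBINT x. ?p * (LBINT \<xi>. cis (- (x * \<xi>)) * g x * cnj (h \<xi>)))"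
    unfolding integral_complex_of_real[symmetric]
  proof (rule Bochner_Integration.integral_cong[OF refl])
    fix x
    have "complex_of_real ((norm (g x))\<^sup>2) = g x * cnj (g x)" by (rule complex_norm_square)
    also have "cnj (g x) = ?p * (LBINT \<xi>. cis (- (x * \<xi>)) * cnj (h \<xi>))"
    proof -
      have "cnj (LBINT \<xi>. cis (x * \<xi>) * h \<xi>) = (LBINT \<xi>. cnj (cis (x * \<xi>) * h \<xi>))"
        by (rule Bochner_Integration.integral_cnj[symmetric])
      then show ?thesis unfolding gh[of x] by (simp add: cis_cnj)
    qed
    also have "g x * \<dots> = ?p * (LBINT \<xi>. g x * (cis (- (x * \<xi>)) * cnj (h \<xi>)))" by simp
    finally show "complex_of_real ((norm (g x))\<^sup>2) = ?p * (LBINT \<xi>. cis (- (x * \<xi>)) * g x * cnj (h \<xi>))"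
      by (simp only: mult_ac)
  qed
  also have "\<dots> = ?p * (LBINT x. LBINT \<xi>. cis (- (x * \<xi>)) * g x * cnj (h \<xi>))" by simp
  also have "(LBINT x. LBINT \<xi>. cis (- (x * \<xi>)) * g x * cnj (h \<xi>)) = (LBINT \<xi>. LBINT x. cis (- (x * \<xi>)) * g x * cnj (h \<xi>))"
    by (rule fubini_product_bound(2)[OF _ integrable_norm[OF g] integrable_norm[OF h]]) (auto simp: norm_mult)
  also have "\<dots> = (LBINT \<xi>. complex_of_real ((norm (h \<xi>))\<^sup>2))"
    unfolding complex_norm_square by (subst (2) hg) simp
  finally have "complex_of_real (LBINT x. (norm (g x))\<^sup>2) = of_real (1 / (2 * pi) * (LBINT \<xi>. (norm (h \<xi>))\<^sup>2))"
    by (simp only: integral_complex_of_real of_real_mult)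
  then have "(LBINT x. (norm (g x))\<^sup>2) = 1 / (2 * pi) * (LBINT \<xi>. (norm (h \<xi>))\<^sup>2)"
    using of_real_eq_iff by blast
  then show ?thesis
    using nn_integral_eq_integral[OF g2] nn_integral_eq_integral[OF h2] by (simp add: ennreal_power ennreal_mult flip: ennreal_mult)
qed

section \<open>Functions with quadratically decaying derivatives\<close>

text \<open>Continuity together with this majorant is a convenient substitute for membership in the Schwartz space: it gives
integrability and vanishing at infinity, and multiplication by bounded continuous functions preserves it.\<close>

definition quadratic_decay :: "(real \<Rightarrow> complex) \<Rightarrow> bool" where
  "quadratic_decay f \<longleftrightarrow> continuous_on UNIV f \<and> (\<exists>C. \<forall>x. norm (f x) \<le> C / (1 + x\<^sup>2))"

text \<open>A finite order of smoothness is enough (four derivatives for \<open>u\<close> and \<open>w u\<close>), and it lets the same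
lemmas serve for symbols like \<open>\<xi>\<^sup>6 |\<xi>|\<^bsup>-s\<^esup> exp (- \<xi>\<^sup>2)\<close>, which are not smooth at 0.\<close>

fun decaying :: "nat \<Rightarrow> (real \<Rightarrow> complex) \<Rightarrow> bool" where
  "decaying 0 f \<longleftrightarrow> quadratic_decay f"
| "decaying (Suc n) f \<longleftrightarrow> quadratic_decay f \<and>
     (\<exists>f'. (\<forall>x. (f has_vector_derivative f' x) (at x)) \<and> decaying n f')"

lemma decaying_imp_quadratic_decay: "decaying n f \<Longrightarrow> quadratic_decay f"
  by (cases n) auto

lemma decaying_Suc_D: "decaying (Suc n) f \<Longrightarrow> decaying n f"
proof (induction n arbitrary: f)
  case 0 then show ?case by simp
next
  case (Suc n)
  from Suc.prems obtain f' where f': "\<forall>x. (f has_vector_derivative f' x) (at x)" "decaying (Suc n) f'"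
    and "quadratic_decay f" unfolding decaying.simps(2)[of "Suc n"] by blast
  moreover from Suc.IH[OF f'(2)] have "decaying n f'" .
  ultimately show ?case by (simp only: decaying.simps) blast
qed

lemma decaying_mono:
  assumes "decaying m f" "n \<le> m" shows "decaying n f"
  using assms(2,1) by (induction rule: dec_induct) (auto dest: decaying_Suc_D simp del: decaying.simps)

lemma quadratic_decay_bound:
  assumes "quadratic_decay f"
  shows "\<exists>C>0. (\<forall>x. norm (f x) \<le> C / (1 + x\<^sup>2)) \<and> (\<forall>x. norm (f x) \<le> C)"
proof -
  obtain C where C: "\<And>x. norm (f x) \<le> C / (1 + x\<^sup>2)" using assms by (auto simp: quadratic_decay_def)
  have *: "norm (f x) \<le> max 1 C / (1 + x\<^sup>2)" for x
    by (rule order_trans[OF C]) (auto intro: divide_right_mono)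
  moreover have "max 1 C / (1 + x\<^sup>2) \<le> max 1 C" for x
    using frac_le[of "max 1 C" "max 1 C" 1 "1 + x\<^sup>2"] by simp
  ultimately show ?thesis by (intro exI[of _ "max 1 C"]) (fastforce intro: order_trans)
qed

lemma quadratic_decay_measurable: "quadratic_decay f \<Longrightarrow> f \<in> borel_measurable borel"
  unfolding quadratic_decay_def by (auto intro: borel_measurable_continuous_onI)

lemma quadratic_decay_integrable:
  assumes "quadratic_decay f" shows "integrable lborel f"
proof -
  obtain C where C: "\<And>x. norm (f x) \<le> C / (1 + x\<^sup>2)" using quadratic_decay_bound[OF assms] by blast
  show ?thesis
  proof (rule Bochner_Integration.integrable_bound[OF integrable_rational[of C]])
    show "f \<in> borel_measurable lborel" using quadratic_decay_measurable[OF assms] by simp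
    show "AE x in lborel. norm (f x) \<le> norm (C / (1 + x\<^sup>2))"
      using order_trans[OF C abs_ge_self] by (intro AE_I2) simp
  qed
qed

lemma quadratic_decay_add:
  assumes "quadratic_decay f" "quadratic_decay g" shows "quadratic_decay (\<lambda>x. f x + g x)"
proof -
  obtain C D where "\<And>x. norm (f x) \<le> C / (1 + x\<^sup>2)" "\<And>x. norm (g x) \<le> D / (1 + x\<^sup>2)"
    using quadratic_decay_bound[OF assms(1)] quadratic_decay_bound[OF assms(2)] by blast
  then have "norm (f x + g x) \<le> (C + D) / (1 + x\<^sup>2)" for x
    by (simp add: add_divide_distrib norm_triangle_mono)
  then show ?thesis using assms unfolding quadratic_decay_def
    by (auto intro!: continuous_intros)
qed

lemma quadratic_decay_mult_bounded:
  assumes "quadratic_decay f" "continuous_on UNIV g" "\<And>x. norm (g x) \<le> B"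
  shows "quadratic_decay (\<lambda>x. g x * f x)"
proof -
  obtain C where C: "C > 0" "\<And>x. norm (f x) \<le> C / (1 + x\<^sup>2)"
    using quadratic_decay_bound[OF assms(1)] by blast
  have "norm (g x * f x) \<le> (B * C) / (1 + x\<^sup>2)" for x
    using mult_mono[OF assms(3)[of x] C(2)[of x]] order_trans[OF norm_ge_zero assms(3)[of x]]
    by (simp add: norm_mult)
  then show ?thesis using assms unfolding quadratic_decay_def
    by (auto intro!: continuous_intros)
qed

lemma decaying_add: "decaying n f \<Longrightarrow> decaying n g \<Longrightarrow> decaying n (\<lambda>x. f x + g x)"
proof (induction n arbitrary: f g)
  case 0 then show ?case by (simp add: quadratic_decay_add)
next
  case (Suc n)
  then obtain f' g' where "\<And>x. (f has_vector_derivative f' x) (at x)" "decaying n f'"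
    "\<And>x. (g has_vector_derivative g' x) (at x)" "decaying n g'" by auto
  with Suc show ?case
    by (auto intro!: quadratic_decay_add exI[of _ "\<lambda>x. f' x + g' x"] derivative_intros)
qed

text \<open>The factors by which a \<open>decaying\<close> function may be multiplied; the weight is one of them.\<close>

fun bounded_derivs :: "nat \<Rightarrow> (real \<Rightarrow> real) \<Rightarrow> bool" where
  "bounded_derivs 0 g \<longleftrightarrow> continuous_on UNIV g \<and> (\<exists>B. \<forall>x. \<bar>g x\<bar> \<le> B)"
| "bounded_derivs (Suc n) g \<longleftrightarrow> (continuous_on UNIV g \<and> (\<exists>B. \<forall>x. \<bar>g x\<bar> \<le> B)) \<and>
     (\<exists>g'. (\<forall>x. (g has_real_derivative g' x) (at x)) \<and> bounded_derivs n g')"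

lemma bounded_derivs_Suc_D: "bounded_derivs (Suc n) f \<Longrightarrow> bounded_derivs n f"
proof (induction n arbitrary: f)
  case 0 then show ?case by simp
next
  case (Suc n)
  from Suc.prems obtain f' where f': "\<forall>x. (f has_real_derivative f' x) (at x)" "bounded_derivs (Suc n) f'"
    and "continuous_on UNIV f \<and> (\<exists>B. \<forall>x. \<bar>f x\<bar> \<le> B)" unfolding bounded_derivs.simps(2)[of "Suc n"] by blast
  moreover from Suc.IH[OF f'(2)] have "bounded_derivs n f'" .
  ultimately show ?case by (simp only: bounded_derivs.simps) blast
qed

lemma decaying_mult:
  "bounded_derivs n g \<Longrightarrow> decaying n f \<Longrightarrow> decaying n (\<lambda>x. of_real (g x) * f x)"
proof (induction n arbitrary: f g)
  case 0 then show ?case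
    by (auto intro!: quadratic_decay_mult_bounded continuous_intros)
next
  case (Suc n)
  from Suc.prems obtain f' g' B where d: "\<And>x. (f has_vector_derivative f' x) (at x)" "decaying n f'"
    "\<And>x. (g has_real_derivative g' x) (at x)" "bounded_derivs n g'"
    and B: "\<And>x. \<bar>g x\<bar> \<le> B" "continuous_on UNIV g" "quadratic_decay f" by auto
  have "decaying n (\<lambda>x. of_real (g x) * f' x + of_real (g' x) * f x)"
    using Suc.prems d by (intro decaying_add Suc.IH) (auto dest: bounded_derivs_Suc_D decaying_Suc_D simp del: bounded_derivs.simps decaying.simps)
  moreover have "((\<lambda>x. of_real (g x) * f x) has_vector_derivative of_real (g x) * f' x + of_real (g' x) * f x) (at x)" for x
    using has_vector_derivative_scaleR[OF d(3,1)] by (simp add: scaleR_conv_of_real)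
  moreover have "quadratic_decay (\<lambda>x. of_real (g x) * f x)"
    using B by (intro quadratic_decay_mult_bounded[where B = B]) (auto intro!: continuous_intros)
  ultimately show ?case
    by (auto intro!: exI[of _ "\<lambda>x. of_real (g x) * f' x + of_real (g' x) * f x"])
qed

lemma decaying_cmult: "decaying n f \<Longrightarrow> decaying n (\<lambda>x. c * f x)"
proof (induction n arbitrary: f)
  case 0 then show ?case
    by (auto intro!: quadratic_decay_mult_bounded[where B = "norm c"])
next
  case (Suc n)
  from Suc.prems obtain f' where f': "\<And>x. (f has_vector_derivative f' x) (at x)" "decaying n f'" "quadratic_decay f" by auto
  have "quadratic_decay (\<lambda>x. c * f x)" using f'(3) by (intro quadratic_decay_mult_bounded[where B = "norm c"]) auto
  moreover have "((\<lambda>x. c * f x) has_vector_derivative c * f' x) (at x)" for x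
    using f'(1) by (rule has_vector_derivative_mult_right)
  moreover have "decaying n (\<lambda>x. c * f' x)" by (rule Suc.IH[OF f'(2)])
  ultimately show ?case unfolding decaying.simps by (intro conjI exI[of _ "\<lambda>x. c * f' x"] allI)
qed

lemma bounded_derivs_add:
  "bounded_derivs n f \<Longrightarrow> bounded_derivs n g \<Longrightarrow> bounded_derivs n (\<lambda>x. f x + g x)"
proof (induction n arbitrary: f g)
  case 0 then obtain B C where "\<And>x. \<bar>f x\<bar> \<le> B" "\<And>x. \<bar>g x\<bar> \<le> C" by auto
  then have "\<bar>f x + g x\<bar> \<le> B + C" for x by (meson abs_triangle_ineq add_mono order_trans)
  with 0 show ?case by (auto intro!: continuous_intros)
next
  case (Suc n)
  then obtain f' g' B C where "\<And>x. (f has_real_derivative f' x) (at x)" "bounded_derivs n f'"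
    "\<And>x. (g has_real_derivative g' x) (at x)" "bounded_derivs n g'" "\<And>x. \<bar>f x\<bar> \<le> B" "\<And>x. \<bar>g x\<bar> \<le> C" by auto
  moreover from this(5,6) have "\<bar>f x + g x\<bar> \<le> B + C" for x by (meson abs_triangle_ineq add_mono order_trans)
  ultimately show ?case using Suc
    by (auto intro!: continuous_intros exI[of _ "\<lambda>x. f' x + g' x"] derivative_intros)
qed

lemma bounded_derivs_cmult:
  "bounded_derivs n f \<Longrightarrow> bounded_derivs n (\<lambda>x. c * f x)"
proof (induction n arbitrary: f)
  case 0 then obtain B where "\<And>x. \<bar>f x\<bar> \<le> B" by auto
  then have "\<bar>c * f x\<bar> \<le> \<bar>c\<bar> * B" for x by (simp add: abs_mult mult_left_mono)
  with 0 show ?case by (auto intro!: continuous_intros)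
next
  case (Suc n)
  then obtain f' B where "\<And>x. (f has_real_derivative f' x) (at x)" "bounded_derivs n f'"
     "\<And>x. \<bar>f x\<bar> \<le> B" by auto
  moreover from this(3) have "\<bar>c * f x\<bar> \<le> \<bar>c\<bar> * B" for x by (simp add: abs_mult mult_left_mono)
  ultimately show ?case using Suc
    by (auto intro!: continuous_intros exI[of _ "\<lambda>x. c * f' x"] derivative_eq_intros)
qed

lemma quadratic_decay_dilation:
  assumes "A > 0" and f: "quadratic_decay f"
  shows "quadratic_decay (\<lambda>x. f (A * x))"
proof -
  obtain C where C: "\<And>x. norm (f x) \<le> C / (1 + x\<^sup>2)"
    using quadratic_decay_bound[OF f] by blast
  define K where "K = max 1 (1 / A\<^sup>2)"
  have K: "1 \<le> K" "1 / A\<^sup>2 \<le> K" by (auto simp: K_def)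
  have pos: "0 < 1 + y\<^sup>2" for y :: real by (simp add: add_pos_nonneg)
  have "norm (f (A * x)) \<le> (K * C) / (1 + x\<^sup>2)" for x
  proof -
    have "x\<^sup>2 = 1 / A\<^sup>2 * (A * x)\<^sup>2" using assms(1) by (simp add: power_mult_distrib)
    also have "\<dots> \<le> K * (A * x)\<^sup>2" by (intro mult_right_mono K) simp
    finally have "1 + x\<^sup>2 \<le> K + K * (A * x)\<^sup>2" using K(1) by linarith
    then have a: "1 + x\<^sup>2 \<le> K * (1 + (A * x)\<^sup>2)" by (simp only: distrib_left mult_1_right)
    have b: "norm (f (A * x)) * (1 + (A * x)\<^sup>2) \<le> C"
      using C[of "A * x"] by (simp only: pos_le_divide_eq[OF pos])
    have "norm (f (A * x)) * (1 + x\<^sup>2) \<le> norm (f (A * x)) * (K * (1 + (A * x)\<^sup>2))"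
      by (intro mult_left_mono a norm_ge_zero)
    also have "\<dots> = K * (norm (f (A * x)) * (1 + (A * x)\<^sup>2))" by (simp only: mult.left_commute)
    also have "\<dots> \<le> K * C" using K(1) by (intro mult_left_mono b) linarith
    finally show ?thesis by (simp only: pos_le_divide_eq[OF pos])
  qed
  moreover have "continuous_on UNIV (\<lambda>x. f (A * x))"
    using f continuous_on_compose2[of UNIV f UNIV "\<lambda>x. A * x"]
    by (simp add: quadratic_decay_def continuous_on_mult_left)
  ultimately show ?thesis by (auto simp: quadratic_decay_def)
qed

lemma decaying_dilation:
  assumes A: "A > 0"
  shows "decaying n f \<Longrightarrow> decaying n (\<lambda>x. f (A * x))"
proof (induction n arbitrary: f)
  case 0 then show ?case using quadratic_decay_dilation[OF A] by simp
next
  case (Suc n)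
  from Suc.prems obtain f' where f': "\<And>x. (f has_vector_derivative f' x) (at x)" "decaying n f'" "quadratic_decay f" by auto
  have "((\<lambda>x. f (A * x)) has_vector_derivative of_real A * f' (A * x)) (at x)" for x
  proof -
    have "((f \<circ> (\<lambda>x. A * x)) has_vector_derivative A *\<^sub>R f' (A * x)) (at x)"
    proof (rule vector_diff_chain_at)
      show "((\<lambda>x. A * x) has_vector_derivative A) (at x)"
        using has_vector_derivative_mult_right[OF has_vector_derivative_id, of A] by simp
    qed (rule f')
    then show ?thesis by (simp add: o_def scaleR_conv_of_real)
  qed
  moreover have "decaying n (\<lambda>x. of_real A * f' (A * x))" by (intro decaying_cmult Suc.IH f')
  ultimately show ?case
    unfolding decaying.simps
    by (intro conjI exI[of _ "\<lambda>x. of_real A * f' (A * x)"] allI quadratic_decay_dilation[OF A f'(3)])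
qed

lemma inverse_square_decay_tendsto_0:
  fixes g :: "real \<Rightarrow> complex"
  assumes "\<And>x. norm (g x) \<le> C / (1 + x\<^sup>2)"
  shows "(g \<longlongrightarrow> 0) at_top" "(g \<longlongrightarrow> 0) at_bot"
proof -
  have lim: "((\<lambda>x::real. C / (1 + x\<^sup>2)) \<longlongrightarrow> 0) at_top" "((\<lambda>x::real. C / (1 + x\<^sup>2)) \<longlongrightarrow> 0) at_bot"
    by real_asymp+
  have "\<forall>\<^sub>F x in F. norm (g x) \<le> C / (1 + x\<^sup>2)" for F using assms by (intro always_eventually allI)
  from Lim_null_comparison[OF this lim(1)] Lim_null_comparison[OF this lim(2)]
  show "(g \<longlongrightarrow> 0) at_top" "(g \<longlongrightarrow> 0) at_bot" .
qed

text \<open>Integration by parts, in the form that the derivative of \<open>cis (- (x * \<xi>)) * f x\<close> integrates to 0 over the line.\<close>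

lemma fourier_transform_deriv:
  assumes d: "\<And>x. (f has_vector_derivative f' x) (at x)" and f: "quadratic_decay f" and f': "quadratic_decay f'"
  shows "fourier_transform f' \<xi> = \<i> * of_real \<xi> * fourier_transform f \<xi>"
proof -
  let ?g = "\<lambda>x. cis (- (x * \<xi>)) * f x"
  let ?g' = "\<lambda>x. cis (- (x * \<xi>)) * f' x + - \<i> * of_real \<xi> * (cis (- (x * \<xi>)) * f x)"
  have cis_d: "((\<lambda>x. cis (- (x * \<xi>))) has_vector_derivative (- \<i> * of_real \<xi>) * cis (- (x * \<xi>))) (at x)" for x
  proof -
    have "((\<lambda>z. exp (\<i> * - (z * of_real \<xi>))) has_field_derivative (- \<i> * of_real \<xi>) * exp (\<i> * - (of_real x * of_real \<xi>))) (at (of_real x))"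
      by (rule derivative_eq_intros refl | simp)+
    from has_vector_derivative_real_field[OF this] show ?thesis by (simp add: cis_conv_exp)
  qed
  have g_d: "(?g has_vector_derivative ?g' x) (at x)" for x
    by (rule has_vector_derivative_eq_rhs[OF has_vector_derivative_mult[OF cis_d d]]) (simp add: algebra_simps)
  have i: "integrable lborel (\<lambda>x. cis (- (x * \<xi>)) * f' x)" "integrable lborel (\<lambda>x. cis (- (x * \<xi>)) * f x)"
    using f f' by (intro integrable_cis_mult quadratic_decay_integrable; simp)+
  obtain C where C: "\<And>x. norm (f x) \<le> C / (1 + x\<^sup>2)" using quadratic_decay_bound[OF f] by blast
  have "norm (?g x) \<le> C / (1 + x\<^sup>2)" for x using C by (simp add: norm_mult)
  note lim = inverse_square_decay_tendsto_0[OF this]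
  have "(LBINT x=-\<infinity>..\<infinity>. ?g' x) = 0 - 0"
  proof (rule interval_integral_FTC_integrable)
    show "isCont ?g' x" for x
    proof -
      have "isCont f x" "isCont f' x" using f f' by (auto simp: quadratic_decay_def continuous_on_eq_continuous_at)
      moreover have "isCont (\<lambda>x. cis (- (x * \<xi>))) x"
        using cis_d has_vector_derivative_continuous by blast
      ultimately show ?thesis by (intro continuous_intros)
    qed
    show "set_integrable lborel (einterval (- \<infinity>) \<infinity>) ?g'"
      using i by (auto simp: set_integrable_def intro!: Bochner_Integration.integrable_add integrable_mult_right)
    show "((?g \<circ> real_of_ereal) \<longlongrightarrow> 0) (at_right (- \<infinity>))" "((?g \<circ> real_of_ereal) \<longlongrightarrow> 0) (at_left \<infinity>)"
      using lim by (auto simp: ereal_tendsto_simps)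
  qed (use g_d in auto)
  then have "(LBINT x. ?g' x) = 0"
    by (simp add: interval_lebesgue_integral_def set_lebesgue_integral_def)
  then have "fourier_transform f' \<xi> + - \<i> * of_real \<xi> * fourier_transform f \<xi> = 0"
    unfolding fourier_transform_cis
    by (simp only: Bochner_Integration.integral_add[OF i(1) integrable_mult_right[OF i(2)]] integral_mult_right_zero)
  then show ?thesis by simp
qed

lemma fourier_transform_bound:
  "norm (fourier_transform f \<xi>) \<le> (LBINT x. norm (f x))"
  unfolding fourier_transform_cis
  by (rule order_trans[OF integral_norm_bound]) (simp add: norm_mult)

lemma fourier_transform_decay:
  "decaying n f \<Longrightarrow> \<exists>C. \<forall>\<xi>. \<bar>\<xi>\<bar> ^ n * norm (fourier_transform f \<xi>) \<le> C"
proof (induction n arbitrary: f)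
  case 0 then show ?case using fourier_transform_bound by auto
next
  case (Suc n)
  then obtain f' where f': "\<And>x. (f has_vector_derivative f' x) (at x)" "decaying n f'" "quadratic_decay f" by auto
  from Suc.IH[OF f'(2)] obtain C where "\<And>\<xi>. \<bar>\<xi>\<bar> ^ n * norm (fourier_transform f' \<xi>) \<le> C" by auto
  moreover have "norm (fourier_transform f' \<xi>) = \<bar>\<xi>\<bar> * norm (fourier_transform f \<xi>)" for \<xi>
    using fourier_transform_deriv[OF f'(1,3) decaying_imp_quadratic_decay[OF f'(2)]] by (simp add: norm_mult)
  ultimately show ?case by (auto simp: mult_ac)
qed

text \<open>Four derivatives make the transform integrable even against \<open>1 + \<xi>\<^sup>2\<close>, hence against \<open>|\<xi>|\<^sup>\<alpha>\<close> for \<open>\<alpha> < 2\<close>.\<close>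

lemma fourier_transform_decay4:
  assumes "decaying 4 f"
  obtains C where "C > 0" "\<And>\<xi>. norm (fourier_transform f \<xi>) \<le> C / (1 + \<xi>\<^sup>2)\<^sup>2"
proof -
  obtain C where C: "\<And>\<xi>. \<bar>\<xi>\<bar> ^ 4 * norm (fourier_transform f \<xi>) \<le> C"
    using fourier_transform_decay[OF assms] by auto
  obtain D where D: "\<And>\<xi>. norm (fourier_transform f \<xi>) \<le> D"
    using fourier_transform_bound[of f] by auto
  have "norm (fourier_transform f \<xi>) \<le> (2 * max 1 (C + D)) / (1 + \<xi>\<^sup>2)\<^sup>2" for \<xi>
  proof -
    have "(1 + \<xi>\<^sup>2)\<^sup>2 \<le> 2 * (1 + \<bar>\<xi>\<bar> ^ 4)"
      using sum_squares_bound[of 1 "\<xi>\<^sup>2"] by (simp add: power2_eq_square power4_eq_xxxx algebra_simps)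
    then have "(1 + \<xi>\<^sup>2)\<^sup>2 * norm (fourier_transform f \<xi>) \<le> 2 * (1 + \<bar>\<xi>\<bar> ^ 4) * norm (fourier_transform f \<xi>)"
      by (intro mult_right_mono) auto
    also have "\<dots> \<le> 2 * max 1 (C + D)"
      using C[of \<xi>] D[of \<xi>] by (simp add: distrib_right max_def)
    finally have "norm (fourier_transform f \<xi>) * (1 + \<xi>\<^sup>2)\<^sup>2 \<le> 2 * max 1 (C + D)" by (simp only: mult.commute)
    moreover have "(1 + \<xi>\<^sup>2)\<^sup>2 > 0" by (intro zero_less_power add_pos_nonneg) auto
    ultimately show ?thesis by (simp only: pos_le_divide_eq)
  qed
  then show ?thesis by (intro that[of "2 * max 1 (C + D)"]) auto
qed

lemma fourier_transform_measurable [measurable (raw)]: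
  assumes [measurable]: "f \<in> borel_measurable borel"
  shows "fourier_transform f \<in> borel_measurable borel"
proof -
  have "(\<lambda>\<xi>. LBINT x. cis (- (x * \<xi>)) * f x) \<in> borel_measurable borel" by measurable
  then show ?thesis by (simp add: fourier_transform_cis[abs_def])
qed

lemma decaying_fourier_integrable:
  assumes "decaying 4 f"
  shows "integrable lborel (\<lambda>\<xi>. (1 + \<xi>\<^sup>2) *\<^sub>R fourier_transform f \<xi>)"
proof -
  obtain C where C: "C > 0" "\<And>\<xi>. norm (fourier_transform f \<xi>) \<le> C / (1 + \<xi>\<^sup>2)\<^sup>2"
    using fourier_transform_decay4[OF assms] by blast
  have [measurable]: "f \<in> borel_measurable borel"
    using assms decaying_imp_quadratic_decay quadratic_decay_measurable by blast
  show ?thesis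
  proof (rule Bochner_Integration.integrable_bound[OF integrable_rational[of C]])
    show "AE x in lborel. norm ((1 + x\<^sup>2) *\<^sub>R fourier_transform f x) \<le> norm (C / (1 + x\<^sup>2))"
    proof (rule AE_I2)
      fix x :: real
      have "(1 + x\<^sup>2) * norm (fourier_transform f x) \<le> (1 + x\<^sup>2) * (C / (1 + x\<^sup>2)\<^sup>2)"
        by (intro mult_left_mono C) auto
      also have "\<dots> = C / (1 + x\<^sup>2)" by (simp add: power2_eq_square)
      finally show "norm ((1 + x\<^sup>2) *\<^sub>R fourier_transform f x) \<le> norm (C / (1 + x\<^sup>2))"
        using C(1) by simp
    qed
  qed measurable
qed

section \<open>The fractional derivative as a singular integral\<close>

lemma schwartz_imp_decaying:
  assumes u: "schwartz u"
  shows "decaying n (\<lambda>x. complex_of_real ((deriv ^^ k) u x))"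
proof (induction n arbitrary: k)
  have d: "((deriv ^^ k) u has_real_derivative (deriv ^^ Suc k) u x) (at x)" for k x
    using u by (simp add: schwartz_def field_differentiable_derivI)
  have q: "quadratic_decay (\<lambda>x. complex_of_real ((deriv ^^ k) u x))" for k
  proof -
    obtain B where B: "\<bar>(deriv ^^ k) u x\<bar> \<le> B" for x
    proof -
      have "bounded (range (\<lambda>x. x ^ 0 * (deriv ^^ k) u x))" using u unfolding schwartz_def by blast
      then show ?thesis using that by (auto simp: bounded_iff)
    qed
    obtain D where D: "\<bar>x\<^sup>2 * (deriv ^^ k) u x\<bar> \<le> D" for x
    proof -
      have "bounded (range (\<lambda>x. x ^ 2 * (deriv ^^ k) u x))" using u unfolding schwartz_def by blast
      then show ?thesis using that by (auto simp: bounded_iff)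
    qed
    have "norm (complex_of_real ((deriv ^^ k) u x)) \<le> (B + D) / (1 + x\<^sup>2)" for x
    proof -
      have "\<bar>(deriv ^^ k) u x\<bar> * (1 + x\<^sup>2) = \<bar>(deriv ^^ k) u x\<bar> + \<bar>x\<^sup>2 * (deriv ^^ k) u x\<bar>"
        by (simp add: abs_mult algebra_simps)
      also have "\<dots> \<le> B + D" using B[of x] D[of x] by linarith
      finally show ?thesis by (simp add: pos_le_divide_eq add_pos_nonneg)
    qed
    moreover have "continuous_on UNIV ((deriv ^^ k) u)"
      using d by (meson DERIV_isCont continuous_at_imp_continuous_on)
    ultimately show ?thesis unfolding quadratic_decay_def by (auto intro!: continuous_intros)
  qed
  case 0 show ?case using q by simp
  case (Suc n)
  have "((\<lambda>x. complex_of_real ((deriv ^^ k) u x)) has_vector_derivative complex_of_real ((deriv ^^ Suc k) u x)) (at x)" for x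
    using d[of k x] by (intro has_vector_derivative_of_real) (simp add: has_real_derivative_iff_has_vector_derivative)
  then show ?case using q[of k] Suc.IH[of "Suc k"] unfolding decaying.simps
    by (intro conjI exI[of _ "\<lambda>x. complex_of_real ((deriv ^^ Suc k) u x)"] allI)
qed

lemma powr_set_integrable:
  fixes a :: real
  shows powr_set_integrable_near: "a > -1 \<Longrightarrow> set_integrable lborel {0<..<1} (\<lambda>t. t powr a)"
    and powr_set_integrable_far: "a < -1 \<Longrightarrow> set_integrable lborel {1<..} (\<lambda>t. t powr a)"
proof -
  have d: "((\<lambda>t. t powr (a + 1) / (a + 1)) has_real_derivative t powr a) (at t)" if "t > 0" "a \<noteq> -1" for t
    using that by (auto intro!: derivative_eq_intros)
  { assume a: "a > -1"
    have "set_integrable lborel (einterval 0 1) (\<lambda>t. t powr a)"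
    proof (rule interval_integral_FTC_nonneg(1))
      show "((\<lambda>t. t powr (a + 1) / (a + 1)) has_real_derivative x powr a) (at x)" if "0 < ereal x" "ereal x < 1" for x
        using d a that by auto
      show "isCont (\<lambda>t. t powr a) x" if "0 < ereal x" "ereal x < 1" for x
        using that by (auto intro!: continuous_intros)
      have "((\<lambda>t. t powr (a + 1) / (a + 1)) \<longlongrightarrow> 0) (at_right 0)"
        using a by real_asymp
      then show "(((\<lambda>t. t powr (a + 1) / (a + 1)) \<circ> real_of_ereal) \<longlongrightarrow> 0) (at_right 0)"
        by (simp add: zero_ereal_def ereal_tendsto_simps)
      have "((\<lambda>t. t powr (a + 1) / (a + 1)) \<longlongrightarrow> inverse (a + 1)) (at_left 1)"
        using a by real_asymp
      then show "(((\<lambda>t. t powr (a + 1) / (a + 1)) \<circ> real_of_ereal) \<longlongrightarrow> inverse (a + 1)) (at_left 1)"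
        by (simp add: one_ereal_def ereal_tendsto_simps)
    qed auto
    then show "set_integrable lborel {0<..<1} (\<lambda>t. t powr a)"
      by (simp add: einterval_eq zero_ereal_def one_ereal_def) }
  { assume a: "a < -1"
    have "set_integrable lborel (einterval 1 \<infinity>) (\<lambda>t. t powr a)"
    proof (rule interval_integral_FTC_nonneg(1))
      show "((\<lambda>t. t powr (a + 1) / (a + 1)) has_real_derivative x powr a) (at x)" if "1 < ereal x" "ereal x < \<infinity>" for x
        using d a that by auto
      show "isCont (\<lambda>t. t powr a) x" if "1 < ereal x" "ereal x < \<infinity>" for x
        using that by (auto intro!: continuous_intros)
      have "((\<lambda>t. t powr (a + 1) / (a + 1)) \<longlongrightarrow> inverse (a + 1)) (at_right 1)"
        using a by real_asymp
      then show "(((\<lambda>t. t powr (a + 1) / (a + 1)) \<circ> real_of_ereal) \<longlongrightarrow> inverse (a + 1)) (at_right 1)"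
        by (simp add: one_ereal_def ereal_tendsto_simps)
      have "((\<lambda>t. t powr (a + 1) / (a + 1)) \<longlongrightarrow> 0) at_top"
        using a by real_asymp
      then show "(((\<lambda>t. t powr (a + 1) / (a + 1)) \<circ> real_of_ereal) \<longlongrightarrow> 0) (at_left \<infinity>)"
        by (simp add: ereal_tendsto_simps)
    qed auto
    then show "set_integrable lborel {1<..} (\<lambda>t. t powr a)"
      by (simp add: einterval_eq one_ereal_def) }
qed

text \<open>This function of \<open>t\<close> dominates \<open>(2 - 2 cos (t \<xi>)) t\<^bsup>-1-\<alpha>\<^esup>\<close> up to the factor \<open>4 (1 + \<xi>\<^sup>2)\<close>. It is
integrable at 0 because \<open>\<alpha> < 2\<close> and at infinity because \<open>\<alpha> > 0\<close>.\<close>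

definition truncated_square_powr :: "real \<Rightarrow> real \<Rightarrow> real" where
  "truncated_square_powr \<alpha> t = indicator {0<..} t * (min 1 (t\<^sup>2) * t powr (-1 - \<alpha>))"

lemma truncated_square_powr_integrable:
  assumes "0 < \<alpha>" "\<alpha> < 2"
  shows "integrable lborel (truncated_square_powr \<alpha>)"
proof -
  have "integrable lborel (\<lambda>t. indicator {0<..<1} t * t powr (1 - \<alpha>) + indicator {1<..} t * t powr (-1 - \<alpha>))"
    using powr_set_integrable_near[of "1 - \<alpha>"] powr_set_integrable_far[of "-1 - \<alpha>"] assms
    by (intro Bochner_Integration.integrable_add) (auto simp: set_integrable_def)
  then show ?thesis
  proof (rule integrable_cong_AE_imp)
    show "AE t in lborel. indicator {0<..<1} t * t powr (1 - \<alpha>) + indicator {1<..} t * t powr (-1 - \<alpha>) = truncated_square_powr \<alpha> t"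
    \<comment> \<open>The two pieces agree with the function except at \<open>t = 1\<close>.\<close>
    proof (rule AE_mp[OF AE_lborel_singleton[of 1]], rule AE_I2, rule impI)
      fix t :: real assume "t \<noteq> 1"
      consider "t \<le> 0" | "0 < t" "t < 1" | "t > 1" using \<open>t \<noteq> 1\<close> by linarith
      then show "indicator {0<..<1} t * t powr (1 - \<alpha>) + indicator {1<..} t * t powr (-1 - \<alpha>) = truncated_square_powr \<alpha> t"
      proof cases
        case 2
        then have "t\<^sup>2 \<le> 1" by (simp add: power_le_one)
        moreover have "t\<^sup>2 * t powr (-1 - \<alpha>) = t powr (1 - \<alpha>)"
          using 2 by (simp flip: powr_add powr_numeral)
        ultimately show ?thesis using 2 by (simp add: truncated_square_powr_def min_def)
      next
        case 3
        then have "1 \<le> t\<^sup>2" by (simp add: one_le_power)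
        then show ?thesis using 3 by (simp add: truncated_square_powr_def)
      qed (auto simp: truncated_square_powr_def)
    qed
  qed (auto simp: truncated_square_powr_def[abs_def])
qed

lemma cos_defect_bound:
  fixes t \<xi> :: real
  shows "0 \<le> 2 - 2 * cos (t * \<xi>)" "2 - 2 * cos (t * \<xi>) \<le> 4 * min 1 (t\<^sup>2) * (1 + \<xi>\<^sup>2)"
proof -
  show "0 \<le> 2 - 2 * cos (t * \<xi>)" by simp
  have "2 - 2 * cos (t * \<xi>) \<le> 4" using cos_ge_minus_one[of "t * \<xi>"] by linarith
  moreover have "2 - 2 * cos (t * \<xi>) \<le> t\<^sup>2 * \<xi>\<^sup>2"
  proof -
    have "2 - 2 * cos (t * \<xi>) = 4 * (sin (t * \<xi> / 2))\<^sup>2"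
      using cos_double_sin[of "t * \<xi> / 2"] by simp
    also have "\<dots> \<le> 4 * (t * \<xi> / 2)\<^sup>2"
      using abs_sin_x_le_abs_x[of "t * \<xi> / 2"] unfolding abs_le_square_iff by simp
    finally show ?thesis by (simp add: power_mult_distrib power_divide)
  qed
  moreover have "4 \<le> 4 * (1 + \<xi>\<^sup>2)" "t\<^sup>2 * \<xi>\<^sup>2 \<le> 4 * t\<^sup>2 * (1 + \<xi>\<^sup>2)"
    by (auto simp: algebra_simps)
  ultimately show "2 - 2 * cos (t * \<xi>) \<le> 4 * min 1 (t\<^sup>2) * (1 + \<xi>\<^sup>2)"
    using zero_le_power2[of \<xi>] by (cases "t\<^sup>2 \<le> 1") (simp_all only: min_def if_False if_True mult_1_right split: if_splits, linarith+)
qed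

text \<open>The constant in \<open>|\<xi>|\<^sup>\<alpha> c = \<integral> (2 - 2 cos (t \<xi>)) t\<^bsup>-1-\<alpha>\<^esup> dt\<close>, the integral being over \<open>t > 0\<close>. It is
finite for \<open>0 < \<alpha> < 2\<close>, and its positivity allows division by it.\<close>

definition abs_D_const :: "real \<Rightarrow> real" where
  "abs_D_const \<alpha> = (LBINT t. indicator {0<..} t * (t powr (-1 - \<alpha>) * (2 - 2 * cos t)))"

lemma cos_defect_integrable:
  fixes \<alpha> :: real
  assumes "0 < \<alpha>" "\<alpha> < 2"
  shows "integrable lborel (\<lambda>t. indicator {0<..} t * (t powr (-1 - \<alpha>) * (2 - 2 * cos (t * \<xi>))))"
proof (rule Bochner_Integration.integrable_bound)
  show "integrable lborel (\<lambda>t. (4 * (1 + \<xi>\<^sup>2)) * truncated_square_powr \<alpha> t)"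
    using truncated_square_powr_integrable[OF assms] by simp
  show "AE t in lborel. norm (indicator {0<..} t * (t powr (-1 - \<alpha>) * (2 - 2 * cos (t * \<xi>))))
      \<le> norm ((4 * (1 + \<xi>\<^sup>2)) * truncated_square_powr \<alpha> t)"
  proof (rule AE_I2)
    fix t
    let ?L = "indicator {0<..} t * (t powr (-1 - \<alpha>) * (2 - 2 * cos (t * \<xi>)))"
    have nonneg: "0 \<le> ?L" using cos_defect_bound(1)[of t \<xi>] by (intro mult_nonneg_nonneg) auto
    have "?L \<le> indicator {0<..} t * (t powr (-1 - \<alpha>) * (4 * min 1 (t\<^sup>2) * (1 + \<xi>\<^sup>2)))"
      by (intro mult_left_mono cos_defect_bound) auto
    also have "\<dots> = (4 * (1 + \<xi>\<^sup>2)) * truncated_square_powr \<alpha> t"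
      unfolding truncated_square_powr_def by (simp only: mult_ac)
    finally show "norm ?L \<le> norm ((4 * (1 + \<xi>\<^sup>2)) * truncated_square_powr \<alpha> t)"
      using nonneg unfolding real_norm_def by linarith
  qed
qed measurable

lemma abs_D_const_pos:
  assumes "0 < \<alpha>" "\<alpha> < 2"
  shows "abs_D_const \<alpha> > 0"
proof -
  \<comment> \<open>A lower bound for the integrand on \<open>1 \<le> t \<le> 2\<close>, where the cosine is at most \<open>cos 1 < 1\<close>.\<close>
  let ?c = "2 powr (-1 - \<alpha>) * (2 - 2 * cos 1) :: real"
  have "cos 1 < cos (0::real)" using pi_ge_two by (intro cos_monotone_0_pi) auto
  then have "0 < ?c" by simp
  also have "?c = (LBINT t. indicator {1..2::real} t * ?c)" by simp
  also have "\<dots> \<le> abs_D_const \<alpha>"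
    unfolding abs_D_const_def
  proof (rule integral_mono)
    show "integrable lborel (\<lambda>t. indicator {0<..} t * (t powr (-1 - \<alpha>) * (2 - 2 * cos t)))"
      using cos_defect_integrable[OF assms, of 1] by simp
    show "indicator {1..2} t * ?c \<le> indicator {0<..} t * (t powr (-1 - \<alpha>) * (2 - 2 * cos t))" for t
    proof (cases "t \<in> {1..2}")
      case True
      then have "cos t \<le> cos 1" using pi_ge_two by (intro cos_monotone_0_pi_le) auto
      moreover have "2 powr (-1 - \<alpha>) \<le> t powr (-1 - \<alpha>)"
        using True assms by (intro powr_mono2') auto
      ultimately have "?c \<le> t powr (-1 - \<alpha>) * (2 - 2 * cos t)" by (intro mult_mono) auto
      then show ?thesis using True by simp
    qed (auto split: split_indicator)
  qed (auto simp: integrable_mult_left)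
  finally show ?thesis .
qed

text \<open>Substitute \<open>t / |\<xi>|\<close> for \<open>t\<close>.\<close>

lemma cos_defect_integral:
  assumes "0 < \<alpha>" "\<alpha> < 2"
  shows "(LBINT t. indicator {0<..} t * (t powr (-1 - \<alpha>) * (2 - 2 * cos (t * \<xi>)))) = \<bar>\<xi>\<bar> powr \<alpha> * abs_D_const \<alpha>"
proof (cases "\<xi> = 0")
  case False
  let ?e = "\<bar>\<xi>\<bar>"
  have e: "?e > 0" using False by simp
  have "abs_D_const \<alpha> = ?e *\<^sub>R (LBINT t. indicator {0<..} (0 + ?e * t) * ((0 + ?e * t) powr (-1 - \<alpha>) * (2 - 2 * cos (0 + ?e * t))))"
    unfolding abs_D_const_def using e by (subst lborel_integral_real_affine[of ?e _ 0]) auto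
  also have "\<dots> = (LBINT t. ?e powr (- \<alpha>) * (indicator {0<..} t * (t powr (-1 - \<alpha>) * (2 - 2 * cos (t * \<xi>)))))"
    unfolding real_scaleR_def integral_mult_right_zero[symmetric]
  proof (rule Bochner_Integration.integral_cong[OF refl])
    fix t :: real
    have c: "cos (?e * t) = cos (t * \<xi>)" by (metis abs_if cos_minus mult.commute mult_minus_left)
    have "?e * ?e powr (-1 - \<alpha>) = ?e powr (- \<alpha>)"
      using e powr_add[of ?e 1 "-1 - \<alpha>"] by simp
    then show "?e * (indicator {0<..} (0 + ?e * t) * ((0 + ?e * t) powr (-1 - \<alpha>) * (2 - 2 * cos (0 + ?e * t))))
      = ?e powr (- \<alpha>) * (indicator {0<..} t * (t powr (-1 - \<alpha>) * (2 - 2 * cos (t * \<xi>))))"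
    proof (cases "t > 0")
      case True
      have "?e * ((?e * t) powr (-1 - \<alpha>) * (2 - 2 * cos (?e * t))) = (?e * ?e powr (-1 - \<alpha>)) * (t powr (-1 - \<alpha>) * (2 - 2 * cos (t * \<xi>)))"
        using e True by (simp only: c powr_mult abs_ge_zero less_imp_le mult.assoc mult.left_commute)
      then show ?thesis using e True by (simp add: \<open>?e * ?e powr (-1 - \<alpha>) = ?e powr (- \<alpha>)\<close>)
    qed (use e in \<open>simp add: zero_less_mult_iff\<close>)
  qed
  also have "\<dots> = ?e powr (- \<alpha>) * (LBINT t. indicator {0<..} t * (t powr (-1 - \<alpha>) * (2 - 2 * cos (t * \<xi>))))"
    by simp
  finally show ?thesis using e by (simp add: powr_minus field_simps)
qed simp

lemma decaying_inversion:
  assumes "decaying 4 f"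
  shows "f x = of_real (1 / (2 * pi)) * (LBINT \<xi>. cis (x * \<xi>) * fourier_transform f \<xi>)"
    and "integrable lborel (fourier_transform f)"
proof -
  have q: "quadratic_decay f" using assms decaying_imp_quadratic_decay by blast
  obtain B where B: "\<And>x. norm (f x) \<le> B" using quadratic_decay_bound[OF q] by blast
  have [measurable]: "f \<in> borel_measurable borel" using q by (rule quadratic_decay_measurable)
  show i: "integrable lborel (fourier_transform f)"
    by (rule Bochner_Integration.integrable_bound[OF decaying_fourier_integrable[OF assms]])
       (auto intro!: AE_I2 simp: mult_le_cancel_right1)
  show "f x = of_real (1 / (2 * pi)) * (LBINT \<xi>. cis (x * \<xi>) * fourier_transform f \<xi>)"
    using fourier_inversion[OF quadratic_decay_integrable[OF q] _ B i] q
    by (simp add: inverse_fourier_transform_cis quadratic_decay_def)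
qed

lemma abs_D_measurable [measurable]:
  assumes [measurable]: "f \<in> borel_measurable borel"
  shows "abs_D s f \<in> borel_measurable borel"
  unfolding abs_D_def fourier_multiplier_def inverse_fourier_transform_cis[abs_def] fourier_transform_cis by measurable

text \<open>By inversion the second difference at step \<open>t\<close> is the multiplier with symbol \<open>2 - 2 cos (t \<xi>)\<close>. Integrating
against \<open>t\<^bsup>-1-\<alpha>\<^esup>\<close> turns it into a multiple of \<open>|\<xi>|\<^sup>\<alpha>\<close>. Because the differences are symmetric the integral
converges absolutely on the whole range \<open>0 < \<alpha> < 2\<close>.\<close>

theorem abs_D_singular_integral:
  assumes \<alpha>: "0 < \<alpha>" "\<alpha> < 2" and f: "decaying 4 f"
  shows "of_real (abs_D_const \<alpha>) * abs_D \<alpha> f x =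
      (LBINT t. of_real (indicator {0<..} t * t powr (-1 - \<alpha>)) * (2 * f x - f (x + t) - f (x - t)))" (is "_ = ?R")
    and "integrable lborel (\<lambda>t. of_real (indicator {0<..} t * t powr (-1 - \<alpha>)) * (2 * f x - f (x + t) - f (x - t)))"
proof -
  let ?F = "fourier_transform f"
  let ?p = "of_real (1 / (2 * pi)) :: complex"
  let ?w = "\<lambda>t. indicator {0<..} t * t powr (-1 - \<alpha>)"
  let ?G = "\<lambda>t \<xi>. of_real (?w t * (2 - 2 * cos (t * \<xi>))) * (cis (x * \<xi>) * ?F \<xi>)"
  have [measurable]: "f \<in> borel_measurable borel"
    using f decaying_imp_quadratic_decay quadratic_decay_measurable by blast
  have [measurable]: "?F \<in> borel_measurable borel" by (rule fourier_transform_measurable) fact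
  have ii: "integrable lborel (\<lambda>\<xi>. cis (y * \<xi>) * ?F \<xi>)" for y
    by (intro integrable_cis_mult decaying_inversion(2)[OF f]) simp
  have diff: "2 * f x - f (x + t) - f (x - t) = ?p * (LBINT \<xi>. of_real (2 - 2 * cos (t * \<xi>)) * (cis (x * \<xi>) * ?F \<xi>))" for t
  proof -
    have "2 * f x - f (x + t) - f (x - t) = ?p * (2 * (LBINT \<xi>. cis (x * \<xi>) * ?F \<xi>)
       - (LBINT \<xi>. cis ((x + t) * \<xi>) * ?F \<xi>) - (LBINT \<xi>. cis ((x - t) * \<xi>) * ?F \<xi>))"
      using decaying_inversion(1)[OF f, of x] decaying_inversion(1)[OF f, of "x + t"] decaying_inversion(1)[OF f, of "x - t"]
      by (simp only: right_diff_distrib mult.left_commute)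
    also have "2 * (LBINT \<xi>. cis (x * \<xi>) * ?F \<xi>)
       - (LBINT \<xi>. cis ((x + t) * \<xi>) * ?F \<xi>) - (LBINT \<xi>. cis ((x - t) * \<xi>) * ?F \<xi>)
      = (LBINT \<xi>. 2 * (cis (x * \<xi>) * ?F \<xi>) - cis ((x + t) * \<xi>) * ?F \<xi> - cis ((x - t) * \<xi>) * ?F \<xi>)"
      using ii by (simp del: integral_mult_right add: integral_mult_right_zero)
    also have "\<dots> = (LBINT \<xi>. of_real (2 - 2 * cos (t * \<xi>)) * (cis (x * \<xi>) * ?F \<xi>))"
    proof (rule Bochner_Integration.integral_cong[OF refl])
      fix \<xi>
      have "2 * cis (x * \<xi>) - cis ((x + t) * \<xi>) - cis ((x - t) * \<xi>) = of_real (2 - 2 * cos (t * \<xi>)) * cis (x * \<xi>)"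
        by (simp add: complex_eq_iff distrib_right left_diff_distrib cos_add cos_diff sin_add sin_diff)
      then show "2 * (cis (x * \<xi>) * ?F \<xi>) - cis ((x + t) * \<xi>) * ?F \<xi> - cis ((x - t) * \<xi>) * ?F \<xi>
         = of_real (2 - 2 * cos (t * \<xi>)) * (cis (x * \<xi>) * ?F \<xi>)"
        by (simp only: mult.assoc[symmetric] left_diff_distrib[symmetric])
    qed
    finally show ?thesis .
  qed
  have le: "norm (?G t \<xi>) \<le> (4 * truncated_square_powr \<alpha> t) * norm ((1 + \<xi>\<^sup>2) *\<^sub>R ?F \<xi>)" for t \<xi>
  proof (cases "t > 0")
    case True
    have "t powr (-1 - \<alpha>) * (2 - 2 * cos (t * \<xi>)) * norm (?F \<xi>) \<le> t powr (-1 - \<alpha>) * (4 * min 1 (t\<^sup>2) * (1 + \<xi>\<^sup>2)) * norm (?F \<xi>)"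
      by (intro mult_left_mono mult_right_mono cos_defect_bound) auto
    moreover have "\<bar>2 - 2 * cos (t * \<xi>)\<bar> = 2 - 2 * cos (t * \<xi>)" using cos_defect_bound(1) by (rule abs_of_nonneg)
    ultimately show ?thesis
      using True by (simp add: truncated_square_powr_def norm_mult mult_ac del: of_real_mult of_real_diff)
  qed (simp add: truncated_square_powr_def)
  have gi: "integrable lborel (\<lambda>t. 4 * truncated_square_powr \<alpha> t)"
    using truncated_square_powr_integrable[OF \<alpha>] by simp
  have Gm: "case_prod ?G \<in> borel_measurable (borel \<Otimes>\<^sub>M borel)" by measurable
  note fub = fubini_product_bound[OF Gm gi integrable_norm[OF decaying_fourier_integrable[OF f]] le]
  have inner: "of_real (?w t) * (2 * f x - f (x + t) - f (x - t)) = ?p * (LBINT \<xi>. ?G t \<xi>)" for t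
  proof -
    have "?G t \<xi> = of_real (?w t) * (of_real (2 - 2 * cos (t * \<xi>)) * (cis (x * \<xi>) * ?F \<xi>))" for \<xi>
      by (simp only: of_real_mult mult.assoc)
    then show ?thesis unfolding diff by (simp only:) (subst integral_mult_right_zero, rule mult.left_commute)
  qed
  show "integrable lborel (\<lambda>t. of_real (?w t) * (2 * f x - f (x + t) - f (x - t)))"
    unfolding inner using fub(3) by (rule integrable_mult_right)
  have "?R = ?p * (LBINT t. LBINT \<xi>. ?G t \<xi>)"
    unfolding inner by simp
  also have "\<dots> = ?p * (LBINT \<xi>. LBINT t. ?G t \<xi>)" using fub(2) by simp
  also have "(LBINT \<xi>. LBINT t. ?G t \<xi>) = (LBINT \<xi>. of_real (abs_D_const \<alpha>) * (cis (x * \<xi>) * (of_real (\<bar>\<xi>\<bar> powr \<alpha>) * ?F \<xi>)))"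
  proof (rule Bochner_Integration.integral_cong[OF refl])
    fix \<xi>
    have "(LBINT t. ?G t \<xi>) = (LBINT t. of_real (?w t * (2 - 2 * cos (t * \<xi>)))) * (cis (x * \<xi>) * ?F \<xi>)"
      by (rule integral_mult_left_zero)
    also have "(LBINT t. complex_of_real (?w t * (2 - 2 * cos (t * \<xi>)))) = of_real (\<bar>\<xi>\<bar> powr \<alpha> * abs_D_const \<alpha>)"
      using cos_defect_integral[OF \<alpha>, of \<xi>] by (simp only: integral_complex_of_real mult.assoc)
    finally show "(LBINT t. ?G t \<xi>) = of_real (abs_D_const \<alpha>) * (cis (x * \<xi>) * (of_real (\<bar>\<xi>\<bar> powr \<alpha>) * ?F \<xi>))"
      by (simp only: of_real_mult mult_ac)
  qed
  also have "?p * \<dots> = of_real (abs_D_const \<alpha>) * abs_D \<alpha> f x"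
    unfolding abs_D_def fourier_multiplier_def inverse_fourier_transform_cis
    by (simp only: integral_mult_right_zero mult.left_commute)
  finally show "of_real (abs_D_const \<alpha>) * abs_D \<alpha> f x = ?R" by simp
qed

text \<open>The value \<open>f x\<close> drops out: it has the coefficient \<open>2 g x\<close> both in the second difference of \<open>g f\<close> and in \<open>g x\<close>
times the second difference of \<open>f\<close>.\<close>

theorem commutator_singular_integral:
  assumes \<alpha>: "0 < \<alpha>" "\<alpha> < 2" and f: "decaying 4 f" and g: "bounded_derivs 4 g"
  shows "of_real (abs_D_const \<alpha>) * commutator (abs_D \<alpha>) g f x =
      (LBINT t. of_real (indicator {0<..} t * t powr (-1 - \<alpha>)) *
         (of_real (g x - g (x + t)) * f (x + t) + of_real (g x - g (x - t)) * f (x - t)))" (is "_ = (LBINT t. ?R t)")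
    and "integrable lborel (\<lambda>t. of_real (indicator {0<..} t * t powr (-1 - \<alpha>)) *
         (of_real (g x - g (x + t)) * f (x + t) + of_real (g x - g (x - t)) * f (x - t)))"
proof -
  let ?w = "\<lambda>t. complex_of_real (indicator {0<..} t * t powr (-1 - \<alpha>))"
  let ?gf = "\<lambda>y. of_real (g y) * f y"
  have gf: "decaying 4 ?gf" using decaying_mult[OF g f] .
  note A = abs_D_singular_integral[OF \<alpha> gf, of x] and B = abs_D_singular_integral[OF \<alpha> f, of x]
  have eq: "?R = (\<lambda>t. ?w t * (2 * ?gf x - ?gf (x + t) - ?gf (x - t)) - of_real (g x) * (?w t * (2 * f x - f (x + t) - f (x - t))))"
    by (rule ext) (simp only: of_real_diff, algebra)
  show "integrable lborel ?R" unfolding eq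
    by (intro Bochner_Integration.integrable_diff integrable_mult_right A(2) B(2))
  have "(LBINT t. ?R t) = (LBINT t. ?w t * (2 * ?gf x - ?gf (x + t) - ?gf (x - t)))
     - of_real (g x) * (LBINT t. ?w t * (2 * f x - f (x + t) - f (x - t)))"
    unfolding eq by (subst Bochner_Integration.integral_diff[OF A(2) integrable_mult_right[OF B(2)]])
      (simp only: integral_mult_right_zero)
  also have "\<dots> = of_real (abs_D_const \<alpha>) * abs_D \<alpha> ?gf x - of_real (g x) * (of_real (abs_D_const \<alpha>) * abs_D \<alpha> f x)"
    by (simp only: A(1) B(1))
  also have "\<dots> = of_real (abs_D_const \<alpha>) * commutator (abs_D \<alpha>) g f x"
    unfolding commutator_def by (simp only: right_diff_distrib mult.left_commute)
  finally show "of_real (abs_D_const \<alpha>) * commutator (abs_D \<alpha>) g f x = (LBINT t. ?R t)" ..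
qed

section \<open>The weight\<close>

text \<open>The power \<open>\<langle>x\<rangle>\<^bsup>-\<beta>\<^esup>\<close>, which for \<open>\<beta> = (1 + \<alpha>) / 2\<close> is the profile of \<open>\<Phi>\<^sub>1\<close> and \<open>\<Phi>\<^sub>2\<close>.\<close>

definition weight :: "real \<Rightarrow> real \<Rightarrow> real" where
  "weight \<beta> x = (1 + x\<^sup>2) powr (- (\<beta> / 2))"

lemma one_plus_square_pos [simp]: "0 < 1 + (x::real)\<^sup>2"
  by (simp add: add_pos_nonneg)

lemma weight_pos [simp]: "0 < weight \<beta> x" "0 \<le> weight \<beta> x" "weight \<beta> x \<noteq> 0"
proof -
  have "1 + x\<^sup>2 \<noteq> 0" using one_plus_square_pos[of x] by linarith
  then show "0 < weight \<beta> x" "0 \<le> weight \<beta> x" "weight \<beta> x \<noteq> 0" by (simp_all add: weight_def)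
qed

lemma weight_measurable [measurable]: "weight \<beta> \<in> borel_measurable borel"
  unfolding weight_def[abs_def] by measurable

lemma power_le_japanese_powr:
  fixes x :: real
  assumes "real j \<le> 2 * c"
  shows "\<bar>x\<bar> ^ j \<le> (1 + x\<^sup>2) powr c"
proof -
  have "\<bar>x\<bar> \<le> (1 + x\<^sup>2) powr (1 / 2)"
    using real_sqrt_le_mono[of "x\<^sup>2" "1 + x\<^sup>2"] by (simp add: powr_half_sqrt)
  then have "\<bar>x\<bar> ^ j \<le> ((1 + x\<^sup>2) powr (1 / 2)) ^ j" by (intro power_mono) auto
  also have "\<dots> = (1 + x\<^sup>2) powr (real j / 2)"
  proof -
    have "(1 + x\<^sup>2) powr (1 / 2) > 0" using one_plus_square_pos[of x] by (simp del: one_plus_square_pos)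
    then show ?thesis by (simp add: powr_powr flip: powr_realpow)
  qed
  also have "\<dots> \<le> (1 + x\<^sup>2) powr c" using assms by (intro powr_mono) auto
  finally show ?thesis .
qed

lemma japanese_deriv:
  fixes x c :: real
  shows "((\<lambda>x. (1 + x\<^sup>2) powr (- c)) has_real_derivative - 2 * c * (x * (1 + x\<^sup>2) powr (- (c + 1)))) (at x)"
proof -
  have "((\<lambda>x. (1 + x\<^sup>2) powr (- c)) has_real_derivative (- c) * (1 + x\<^sup>2) powr (- c - 1) * (2 * x)) (at x)"
    using one_plus_square_pos[of x] by (auto intro!: derivative_eq_intros)
  moreover have "- c - 1 = - (c + 1)" by simp
  ultimately show ?thesis by (simp only: mult_ac mult_minus_left mult_minus_right)
qed

text \<open>The family is closed under differentiation: the derivative is a combination of members with exponents \<open>(j - 1, c)\<close> and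
\<open>(j + 1, c + 1)\<close>, which again satisfy \<open>j \<le> 2 c\<close>. This carries the induction on the number of derivatives.\<close>

lemma bounded_derivs_japanese:
  "real j \<le> 2 * c \<Longrightarrow> bounded_derivs n (\<lambda>x. x ^ j * (1 + x\<^sup>2) powr (- c))"
proof (induction n arbitrary: j c)
  have q: "continuous_on UNIV (\<lambda>x. x ^ j * (1 + x\<^sup>2) powr (- c)) \<and> (\<exists>B. \<forall>x. \<bar>x ^ j * (1 + x\<^sup>2) powr (- c)\<bar> \<le> B)"
    if "real j \<le> 2 * c" for j :: nat and c :: real
  proof (intro conjI exI[of _ 1] allI)
    show "continuous_on UNIV (\<lambda>x. x ^ j * (1 + x\<^sup>2) powr (- c))"
      using one_plus_square_pos by (intro continuous_intros) (auto simp: less_imp_neq[symmetric])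
    show "\<bar>x ^ j * (1 + x\<^sup>2) powr (- c)\<bar> \<le> 1" for x :: real
      using power_le_japanese_powr[OF that, of x] by (simp add: abs_mult power_abs powr_minus divide_simps)
  qed
  { case 0 then show ?case using q by simp }
  case (Suc n)
  have d: "((\<lambda>x. x ^ j * (1 + x\<^sup>2) powr (- c)) has_real_derivative
     real j * (x ^ (j - 1) * (1 + x\<^sup>2) powr (- c)) + (- 2 * c) * (x ^ (j + 1) * (1 + x\<^sup>2) powr (- (c + 1)))) (at x)" for x :: real
    using DERIV_mult[OF DERIV_pow[of j x UNIV] japanese_deriv[of c x]] by (simp add: mult_ac)
  have "bounded_derivs n (\<lambda>x. real j * (x ^ (j - 1) * (1 + x\<^sup>2) powr (- c)) + (- 2 * c) * (x ^ (j + 1) * (1 + x\<^sup>2) powr (- (c + 1))))"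
    using Suc.prems by (intro bounded_derivs_add bounded_derivs_cmult Suc.IH) auto
  with d q[OF Suc.prems] show ?case unfolding bounded_derivs.simps
    by (intro conjI exI[of _ "\<lambda>x. real j * (x ^ (j - 1) * (1 + x\<^sup>2) powr (- c)) + (- 2 * c) * (x ^ (j + 1) * (1 + x\<^sup>2) powr (- (c + 1)))"] allI) auto
qed

lemma bounded_derivs_weight: "0 \<le> \<beta> \<Longrightarrow> bounded_derivs n (weight \<beta>)"
  using bounded_derivs_japanese[of 0 "\<beta> / 2" n] by (simp add: weight_def[abs_def])

text \<open>Peetre's inequality: \<open>1 + y\<^sup>2 \<le> 2 (1 + x\<^sup>2) (1 + (x - y)\<^sup>2)\<close>.\<close>

lemma peetre:
  assumes "0 \<le> \<beta>"
  shows "weight \<beta> x \<le> 2 powr (\<beta> / 2) * (weight \<beta> y * (1 + (x - y)\<^sup>2) powr (\<beta> / 2))"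
proof -
  have "y\<^sup>2 \<le> 2 * x\<^sup>2 + 2 * (x - y)\<^sup>2"
    using zero_le_power2[of "2 * x - y"] by (simp add: power2_eq_square algebra_simps)
  moreover have "0 \<le> x\<^sup>2 * (x - y)\<^sup>2" by simp
  moreover have "2 * ((1 + x\<^sup>2) * (1 + (x - y)\<^sup>2)) = 2 + (2 * x\<^sup>2 + 2 * (x - y)\<^sup>2) + 2 * (x\<^sup>2 * (x - y)\<^sup>2)"
    by (simp add: distrib_left distrib_right)
  ultimately have "1 + y\<^sup>2 \<le> 2 * ((1 + x\<^sup>2) * (1 + (x - y)\<^sup>2))" by linarith
  then have "(1 + y\<^sup>2) powr (\<beta> / 2) \<le> (2 * ((1 + x\<^sup>2) * (1 + (x - y)\<^sup>2))) powr (\<beta> / 2)"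
    using assms by (intro powr_mono2) auto
  also have "\<dots> = 2 powr (\<beta> / 2) * ((1 + x\<^sup>2) powr (\<beta> / 2) * (1 + (x - y)\<^sup>2) powr (\<beta> / 2))"
    by (simp add: powr_mult)
  finally have le: "(1 + y\<^sup>2) powr (\<beta> / 2) \<le> 2 powr (\<beta> / 2) * ((1 + x\<^sup>2) powr (\<beta> / 2) * (1 + (x - y)\<^sup>2) powr (\<beta> / 2))" .
  have aux: "inverse a \<le> K * (inverse b * d)" if "0 < a" "0 < b" "b \<le> K * (a * d)" for a b d K :: real
    using that by (simp add: field_simps)
  have "0 < (1 + z\<^sup>2) powr (\<beta> / 2)" for z :: real
    using one_plus_square_pos[of z] by (simp del: one_plus_square_pos)
  from aux[OF this this le] show ?thesis unfolding weight_def powr_minus .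
qed

lemma weight_near:
  assumes "0 \<le> \<beta>" "\<bar>x - y\<bar> \<le> 1"
  shows "weight \<beta> x \<le> 2 powr \<beta> * weight \<beta> y"
proof -
  have "(x - y)\<^sup>2 \<le> 1" using assms(2) by (simp add: abs_square_le_1)
  then have "(1 + (x - y)\<^sup>2) powr (\<beta> / 2) \<le> 2 powr (\<beta> / 2)" using assms(1) by (intro powr_mono2) auto
  then have "2 powr (\<beta> / 2) * (weight \<beta> y * (1 + (x - y)\<^sup>2) powr (\<beta> / 2)) \<le> 2 powr (\<beta> / 2) * (weight \<beta> y * 2 powr (\<beta> / 2))"
    by (intro mult_left_mono) auto
  also have "\<dots> = 2 powr \<beta> * weight \<beta> y" by (simp add: powr_add[symmetric] flip: mult.assoc)
  finally show ?thesis using peetre[OF assms(1), of x y] by linarith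
qed

text \<open>Better than Peetre's inequality where \<open>|x|\<close> is small compared with \<open>|y|\<close>: the growth \<open>|x - y|\<^sup>\<beta>\<close> comes with a
factor \<open>w(x)\<close>, which is square integrable for \<open>\<beta> > 1/2\<close>. The reason is that \<open>1 + y\<^sup>2\<close> is at most four times the larger of \<open>1 + x\<^sup>2\<close>
and \<open>(x - y)\<^sup>2\<close>.\<close>

lemma weight_far:
  assumes "0 \<le> \<beta>"
  shows "weight \<beta> x \<le> 2 powr \<beta> * (weight \<beta> y * (1 + weight \<beta> x * \<bar>x - y\<bar> powr \<beta>))"
proof -
  let ?a = "1 + x\<^sup>2" and ?d = "(x - y)\<^sup>2"
  have "y\<^sup>2 \<le> 2 * x\<^sup>2 + 2 * (x - y)\<^sup>2"
    using zero_le_power2[of "2 * x - y"] by (simp add: power2_eq_square algebra_simps)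
  then have "1 + y\<^sup>2 \<le> 4 * max ?a ?d" by (auto simp: max_def)
  then have "(1 + y\<^sup>2) powr (\<beta> / 2) \<le> (4 * max ?a ?d) powr (\<beta> / 2)" using assms by (intro powr_mono2) auto
  also have "\<dots> = 2 powr \<beta> * (max ?a ?d) powr (\<beta> / 2)"
    using powr_powr[of 2 2 "\<beta> / 2"] by (simp add: powr_mult)
  also have "(max ?a ?d) powr (\<beta> / 2) \<le> ?a powr (\<beta> / 2) + ?d powr (\<beta> / 2)" by (auto simp: max_def)
  also have "?d powr (\<beta> / 2) = \<bar>x - y\<bar> powr \<beta>"
  proof -
    have "?d = \<bar>x - y\<bar> powr 2" by (cases "x = y") simp_all
    then show ?thesis by (simp only: powr_powr) simp
  qed
  finally have *: "(1 + y\<^sup>2) powr (\<beta> / 2) \<le> 2 powr \<beta> * (?a powr (\<beta> / 2) + \<bar>x - y\<bar> powr \<beta>)" by simp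
  have w: "weight \<beta> z * (1 + z\<^sup>2) powr (\<beta> / 2) = 1" for z
    using one_plus_square_pos[of z] unfolding weight_def powr_minus by (simp add: less_imp_neq[symmetric])
  have "weight \<beta> x = weight \<beta> x * (weight \<beta> y * (1 + y\<^sup>2) powr (\<beta> / 2))" by (simp add: w)
  also have "\<dots> \<le> weight \<beta> x * (weight \<beta> y * (2 powr \<beta> * (?a powr (\<beta> / 2) + \<bar>x - y\<bar> powr \<beta>)))"
    by (intro mult_left_mono *) auto
  also have "\<dots> = 2 powr \<beta> * (weight \<beta> y * (weight \<beta> x * ?a powr (\<beta> / 2) + weight \<beta> x * \<bar>x - y\<bar> powr \<beta>))"
    by (simp only: distrib_left mult_ac)
  finally show ?thesis by (simp only: w)
qed

definition weight' :: "real \<Rightarrow> real \<Rightarrow> real" where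
  "weight' \<beta> x = - \<beta> * (x * (1 + x\<^sup>2) powr (- (\<beta> / 2 + 1)))"

lemma weight_deriv: "(weight \<beta> has_real_derivative weight' \<beta> x) (at x)"
  using japanese_deriv[of "\<beta> / 2" x] by (simp add: weight_def[abs_def] weight'_def)

lemma japanese_Suc_powr: "(1 + x\<^sup>2) powr (- (c + 1)) = (1 + x\<^sup>2) powr (- c) / (1 + x\<^sup>2)" for x c :: real
  using one_plus_square_pos[of x] by (simp add: powr_diff)

lemma abs_le_one_plus_square: "\<bar>x\<bar> \<le> 1 + x\<^sup>2" for x :: real
  using zero_le_power2[of "\<bar>x\<bar> - 1 / 2"] by (simp add: power2_eq_square algebra_simps)

lemma weight'_bound:
  assumes "0 \<le> \<beta>" shows "\<bar>weight' \<beta> x\<bar> \<le> \<beta> * weight \<beta> x"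
proof -
  have "\<bar>weight' \<beta> x\<bar> = \<beta> * (\<bar>x\<bar> / (1 + x\<^sup>2) * weight \<beta> x)"
    using assms unfolding weight'_def japanese_Suc_powr weight_def by (simp add: abs_mult)
  also have "\<dots> \<le> \<beta> * (1 * weight \<beta> x)"
    using assms abs_le_one_plus_square by (intro mult_left_mono mult_right_mono) (auto simp: divide_le_eq)
  finally show ?thesis by simp
qed

lemma weight'_deriv_bound:
  assumes "0 \<le> \<beta>"
  shows "\<exists>d. (weight' \<beta> has_real_derivative d) (at x) \<and> \<bar>d\<bar> \<le> \<beta> * (\<beta> + 3) * weight \<beta> x"
proof -
  let ?p = "(1 + x\<^sup>2) powr (- (\<beta> / 2 + 1))" and ?q = "(1 + x\<^sup>2) powr (- (\<beta> / 2 + 1 + 1))"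
  let ?d = "- \<beta> * (?p + x * (- 2 * (\<beta> / 2 + 1) * (x * ?q)))"
  have "(weight' \<beta> has_real_derivative ?d) (at x)"
    unfolding weight'_def[abs_def]
    by (rule derivative_eq_intros japanese_deriv refl | simp)+
  moreover have "\<bar>?d\<bar> \<le> \<beta> * (\<beta> + 3) * weight \<beta> x"
  proof -
    have p: "?p \<le> weight \<beta> x" unfolding weight_def by (intro powr_mono) auto
    have "x\<^sup>2 * ?q = x\<^sup>2 / (1 + x\<^sup>2) * ?p" unfolding japanese_Suc_powr[of x "\<beta> / 2 + 1"] by simp
    also have "\<dots> \<le> 1 * ?p" by (intro mult_right_mono) (auto simp: divide_le_eq)
    finally have q: "x\<^sup>2 * ?q \<le> weight \<beta> x" using p by linarith
    have "?d = - (\<beta> * ?p) + \<beta> * ((\<beta> + 2) * (x\<^sup>2 * ?q))" by (simp add: power2_eq_square algebra_simps)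
    then have "\<bar>?d\<bar> \<le> \<beta> * ?p + \<beta> * ((\<beta> + 2) * (x\<^sup>2 * ?q))"
      using assms by (simp only:) (rule order_trans[OF abs_triangle_ineq], simp add: abs_mult)
    also have "\<dots> \<le> \<beta> * weight \<beta> x + \<beta> * ((\<beta> + 2) * weight \<beta> x)"
      using assms p q by (intro add_mono mult_left_mono) auto
    also have "\<dots> = \<beta> * (\<beta> + 3) * weight \<beta> x" by (simp add: algebra_simps)
    finally show ?thesis .
  qed
  ultimately show ?thesis by (intro exI conjI)
qed

lemma mean_value_bound:
  fixes f :: "real \<Rightarrow> real"
  assumes "\<And>z. z \<in> closed_segment y x \<Longrightarrow> \<exists>d. (f has_real_derivative d) (at z) \<and> \<bar>d\<bar> \<le> B"
  shows "\<bar>f x - f y\<bar> \<le> B * \<bar>x - y\<bar>"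
proof -
  have d: "(f has_real_derivative deriv f z) (at z)" "\<bar>deriv f z\<bar> \<le> B" if "z \<in> closed_segment y x" for z
  proof -
    from assms[OF that] obtain d where d: "(f has_real_derivative d) (at z)" "\<bar>d\<bar> \<le> B" by blast
    then have "deriv f z = d" using DERIV_imp_deriv by blast
    with d show "(f has_real_derivative deriv f z) (at z)" "\<bar>deriv f z\<bar> \<le> B" by simp_all
  qed
  have "norm (f x - f y) \<le> B * norm (x - y)"
    by (rule field_differentiable_bound[where S = "closed_segment y x" and f' = "deriv f"])
       (use d in \<open>auto intro: has_field_derivative_at_within\<close>)
  then show ?thesis by simp
qed

lemma closed_segment_abs: "z \<in> closed_segment y x \<Longrightarrow> \<bar>z - y\<bar> \<le> \<bar>x - y\<bar>" for x y z :: real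
  by (auto simp: closed_segment_eq_real_ivl split: if_splits)

lemma weight_diff_near:
  assumes "0 \<le> \<beta>" "\<bar>x - y\<bar> \<le> 1"
  shows "\<bar>weight \<beta> x - weight \<beta> y\<bar> \<le> \<beta> * 2 powr \<beta> * weight \<beta> y * \<bar>x - y\<bar>"
proof (rule mean_value_bound)
  fix z assume "z \<in> closed_segment y x"
  then have "weight \<beta> z \<le> 2 powr \<beta> * weight \<beta> y" using assms closed_segment_abs by (intro weight_near) force+
  then have "\<beta> * weight \<beta> z \<le> \<beta> * (2 powr \<beta> * weight \<beta> y)" using assms by (intro mult_left_mono) auto
  then have "\<bar>weight' \<beta> z\<bar> \<le> \<beta> * 2 powr \<beta> * weight \<beta> y"
    using weight'_bound[OF assms(1), of z] by (simp add: mult.assoc)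
  then show "\<exists>d. (weight \<beta> has_real_derivative d) (at z) \<and> \<bar>d\<bar> \<le> \<beta> * 2 powr \<beta> * weight \<beta> y"
    using weight_deriv by blast
qed

text \<open>The expansion is around \<open>x\<close>, but the error is measured by the weight at \<open>y\<close>, where \<open>u\<close> is evaluated.\<close>

lemma weight_taylor_near:
  assumes "0 \<le> \<beta>" "\<bar>x - y\<bar> \<le> 1"
  shows "\<bar>weight \<beta> x - weight \<beta> y - weight' \<beta> x * (x - y)\<bar> \<le> \<beta> * (\<beta> + 3) * 2 powr \<beta> * weight \<beta> y * (x - y)\<^sup>2"
proof -
  let ?K = "\<beta> * (\<beta> + 3) * 2 powr \<beta> * weight \<beta> y"
  have K: "\<beta> * (\<beta> + 3) * weight \<beta> z \<le> ?K" if "z \<in> closed_segment y x" for z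
    unfolding mult.assoc using weight_near[of \<beta> z y] assms closed_segment_abs[OF that]
    by (intro mult_left_mono) auto
  have d': "\<bar>weight' \<beta> z - weight' \<beta> x\<bar> \<le> ?K * \<bar>z - x\<bar>" if z: "z \<in> closed_segment y x" for z
  proof (rule mean_value_bound)
    fix v assume "v \<in> closed_segment x z"
    then have "v \<in> closed_segment y x" using z by (auto simp: closed_segment_eq_real_ivl split: if_splits)
    from K[OF this] show "\<exists>d. (weight' \<beta> has_real_derivative d) (at v) \<and> \<bar>d\<bar> \<le> ?K"
      using weight'_deriv_bound[OF assms(1), of v] by (elim exE conjE) (intro exI conjI, assumption, linarith)
  qed
  \<comment> \<open>The mean value theorem twice: for \<open>w'\<close>, then for \<open>w\<close> minus its linear part at \<open>x\<close>.\<close>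
  have "\<bar>(\<lambda>z. weight \<beta> z - weight' \<beta> x * z) x - (\<lambda>z. weight \<beta> z - weight' \<beta> x * z) y\<bar> \<le> (?K * \<bar>x - y\<bar>) * \<bar>x - y\<bar>"
  proof (rule mean_value_bound)
    fix z assume z: "z \<in> closed_segment y x"
    have "((\<lambda>z. weight \<beta> z - weight' \<beta> x * z) has_real_derivative weight' \<beta> z - weight' \<beta> x) (at z)"
      by (rule derivative_eq_intros weight_deriv refl | simp)+
    moreover have "?K * \<bar>z - x\<bar> \<le> ?K * \<bar>x - y\<bar>"
      using z assms(1) by (intro mult_left_mono) (auto simp: closed_segment_eq_real_ivl split: if_splits)
    ultimately show "\<exists>d. ((\<lambda>z. weight \<beta> z - weight' \<beta> x * z) has_real_derivative d) (at z) \<and> \<bar>d\<bar> \<le> ?K * \<bar>x - y\<bar>"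
      using d'[OF z] by (intro exI conjI) (assumption, linarith)
  qed
  moreover have "(?K * \<bar>x - y\<bar>) * \<bar>x - y\<bar> = ?K * (x - y)\<^sup>2"
    by (simp only: mult.assoc power2_eq_square abs_mult_self_eq)
  ultimately show ?thesis by (simp add: algebra_simps)
qed

section \<open>Convolution inequalities\<close>

text \<open>Kernels and functions are real and nonnegative here, but the values are extended, so that divergent convolutions are
covered by the estimates.\<close>

definition nn_conv :: "(real \<Rightarrow> real) \<Rightarrow> (real \<Rightarrow> real) \<Rightarrow> real \<Rightarrow> ennreal" where
  "nn_conv K F x = (\<integral>\<^sup>+z. ennreal (K z * F (x - z)))"

lemma nn_integral_reflect_translate:
  assumes [measurable]: "(F :: real \<Rightarrow> ennreal) \<in> borel_measurable borel"
  shows "(\<integral>\<^sup>+z. F (x - z)) = (\<integral>\<^sup>+z. F z)"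
  using nn_integral_real_affine[OF assms, of "-1" x] by simp

lemma nn_integral_translate:
  assumes [measurable]: "(F :: real \<Rightarrow> ennreal) \<in> borel_measurable borel"
  shows "(\<integral>\<^sup>+z. F (x + z)) = (\<integral>\<^sup>+z. F z)"
  using nn_integral_real_affine[OF assms, of 1 x] by simp

lemma nn_integral_even:
  assumes [measurable]: "(F :: real \<Rightarrow> ennreal) \<in> borel_measurable borel"
  shows "(\<integral>\<^sup>+t. indicator {0<..} t * (F t + F (- t))) = (\<integral>\<^sup>+z. F z)"
proof -
  have "(\<integral>\<^sup>+t. indicator {0<..} t * (F t + F (- t)))
      = (\<integral>\<^sup>+t. indicator {0<..} t * F t) + (\<integral>\<^sup>+t. indicator {0<..} t * F (- t))"
    by (simp add: distrib_left nn_integral_add)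
  also have "(\<integral>\<^sup>+t. indicator {0<..} t * F (- t)) = (\<integral>\<^sup>+z. indicator {..<0} z * F z)"
    by (subst nn_integral_reflect_translate[symmetric, of _ 0])
       (auto intro!: nn_integral_cong split: split_indicator)
  also have "(\<integral>\<^sup>+t. indicator {0<..} t * F t) + (\<integral>\<^sup>+z. indicator {..<0} z * F z)
     = (\<integral>\<^sup>+z. indicator {0<..} z * F z + indicator {..<0} z * F z)"
    by (simp add: nn_integral_add)
  also have "\<dots> = (\<integral>\<^sup>+z. F z)"
    by (rule nn_integral_cong_AE, rule AE_mp[OF AE_lborel_singleton[of 0]])
       (auto intro!: AE_I2 split: split_indicator)
  finally show ?thesis .
qed

lemma tonelli_kernel:
  fixes a :: "real \<Rightarrow> real \<Rightarrow> ennreal" and \<tau> b :: "real \<Rightarrow> ennreal"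
  assumes [measurable]: "(\<lambda>(t, z). a t z) \<in> borel_measurable (borel \<Otimes>\<^sub>M borel)" "\<tau> \<in> borel_measurable borel" "b \<in> borel_measurable borel"
  shows "(\<integral>\<^sup>+t. \<tau> t * (\<integral>\<^sup>+z. a t z * b z)) = (\<integral>\<^sup>+z. (\<integral>\<^sup>+t. \<tau> t * a t z) * b z)"
proof -
  have "(\<integral>\<^sup>+t. \<tau> t * (\<integral>\<^sup>+z. a t z * b z)) = (\<integral>\<^sup>+t. (\<integral>\<^sup>+z. \<tau> t * (a t z * b z)))"
    by (intro nn_integral_cong nn_integral_cmult[symmetric]) measurable
  also have "\<dots> = (\<integral>\<^sup>+z. (\<integral>\<^sup>+t. \<tau> t * (a t z * b z)))"
    by (rule lborel_pair.Fubini') measurable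
  also have "\<dots> = (\<integral>\<^sup>+z. (\<integral>\<^sup>+t. \<tau> t * a t z) * b z)"
    unfolding mult.assoc[symmetric] by (intro nn_integral_cong nn_integral_multc) measurable
  finally show ?thesis .
qed

text \<open>Cauchy-Schwarz with respect to the measure with density \<open>K\<close>, then Tonelli.\<close>

lemma young_L1_L2_ennreal:
  fixes K F :: "real \<Rightarrow> ennreal"
  assumes [measurable]: "K \<in> borel_measurable borel" "F \<in> borel_measurable borel"
  shows "(\<integral>\<^sup>+x. (\<integral>\<^sup>+z. K z * F (x - z))\<^sup>2) \<le> (\<integral>\<^sup>+z. K z)\<^sup>2 * (\<integral>\<^sup>+x. (F x)\<^sup>2)"
proof -
  let ?M = "density lborel K"
  have "(\<integral>\<^sup>+z. K z * F (x - z))\<^sup>2 \<le> (\<integral>\<^sup>+z. K z) * (\<integral>\<^sup>+z. K z * (F (x - z))\<^sup>2)" for x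
  proof -
    have "(\<integral>\<^sup>+z. 1 * F (x - z) \<partial>?M)\<^sup>2 \<le> (\<integral>\<^sup>+z. 1\<^sup>2 \<partial>?M) * (\<integral>\<^sup>+z. (F (x - z))\<^sup>2 \<partial>?M)"
      by (rule Cauchy_Schwarz_nn_integral) auto
    moreover have "(\<integral>\<^sup>+z. 1 * F (x - z) \<partial>?M) = (\<integral>\<^sup>+z. K z * F (x - z))"
      by (subst nn_integral_density) auto
    moreover have "(\<integral>\<^sup>+z. 1\<^sup>2 \<partial>?M) = (\<integral>\<^sup>+z. K z)" by (subst nn_integral_density) auto
    moreover have "(\<integral>\<^sup>+z. (F (x - z))\<^sup>2 \<partial>?M) = (\<integral>\<^sup>+z. K z * (F (x - z))\<^sup>2)"
      by (subst nn_integral_density) auto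
    ultimately show ?thesis by simp
  qed
  then have "(\<integral>\<^sup>+x. (\<integral>\<^sup>+z. K z * F (x - z))\<^sup>2)
      \<le> (\<integral>\<^sup>+x. (\<integral>\<^sup>+z. K z) * (\<integral>\<^sup>+z. K z * (F (x - z))\<^sup>2))"
    by (rule nn_integral_mono)
  also have "\<dots> = (\<integral>\<^sup>+z. K z) * (\<integral>\<^sup>+x. \<integral>\<^sup>+z. K z * (F (x - z))\<^sup>2)"
    by (rule nn_integral_cmult) measurable
  also have "(\<integral>\<^sup>+x. \<integral>\<^sup>+z. K z * (F (x - z))\<^sup>2)
      = (\<integral>\<^sup>+z. \<integral>\<^sup>+x. K z * (F (x - z))\<^sup>2)"
    by (rule lborel_pair.Fubini') measurable
  also have "\<dots> = (\<integral>\<^sup>+z. K z * (\<integral>\<^sup>+x. (F x)\<^sup>2))"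
  proof (rule nn_integral_cong)
    fix z
    have "(\<integral>\<^sup>+x. K z * (F (x - z))\<^sup>2) = K z * (\<integral>\<^sup>+x. (F (- z + x))\<^sup>2)"
      by (subst nn_integral_cmult) auto
    also have "(\<integral>\<^sup>+x. (F (- z + x))\<^sup>2) = (\<integral>\<^sup>+x. (F x)\<^sup>2)"
      by (rule nn_integral_translate[of "\<lambda>x. (F x)\<^sup>2"]) measurable
    finally show "(\<integral>\<^sup>+x. K z * (F (x - z))\<^sup>2) = K z * (\<integral>\<^sup>+x. (F x)\<^sup>2)" .
  qed
  also have "\<dots> = (\<integral>\<^sup>+z. K z) * (\<integral>\<^sup>+x. (F x)\<^sup>2)"
    by (rule nn_integral_multc) measurable
  finally show ?thesis by (simp add: power2_eq_square mult.assoc)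
qed

lemma young_L1_L2:
  assumes [measurable]: "K \<in> borel_measurable borel" "F \<in> borel_measurable borel"
    and "\<And>z. 0 \<le> K z" "\<And>z. 0 \<le> F z"
  shows "(\<integral>\<^sup>+x. (nn_conv K F x)\<^sup>2) \<le> (\<integral>\<^sup>+z. ennreal (K z))\<^sup>2 * (\<integral>\<^sup>+x. (ennreal (F x))\<^sup>2)"
  using young_L1_L2_ennreal[of "\<lambda>z. ennreal (K z)" "\<lambda>z. ennreal (F z)"] assms
  by (simp add: nn_conv_def ennreal_mult)

text \<open>For kernels that are square integrable but not integrable: \<open>nn_conv K F\<close> is bounded by Cauchy-Schwarz, and \<open>w\<close>
provides the square integrability.\<close>

lemma weighted_conv_L2_L2:
  assumes [measurable]: "K \<in> borel_measurable borel" "F \<in> borel_measurable borel" "w \<in> borel_measurable borel"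
    and "\<And>z. 0 \<le> K z" "\<And>z. 0 \<le> F z" "\<And>z. 0 \<le> w z"
  shows "(\<integral>\<^sup>+x. (ennreal (w x) * nn_conv K F x)\<^sup>2)
    \<le> (\<integral>\<^sup>+x. (ennreal (w x))\<^sup>2) * (\<integral>\<^sup>+z. (ennreal (K z))\<^sup>2) * (\<integral>\<^sup>+x. (ennreal (F x))\<^sup>2)"
proof -
  have "(nn_conv K F x)\<^sup>2 \<le> (\<integral>\<^sup>+z. (ennreal (K z))\<^sup>2) * (\<integral>\<^sup>+x. (ennreal (F x))\<^sup>2)" for x
  proof -
    have "(nn_conv K F x)\<^sup>2 = (\<integral>\<^sup>+z. ennreal (K z) * ennreal (F (x - z)))\<^sup>2"
      unfolding nn_conv_def using assms by (simp add: ennreal_mult)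
    also have "\<dots> \<le> (\<integral>\<^sup>+z. (ennreal (K z))\<^sup>2) * (\<integral>\<^sup>+z. (ennreal (F (x - z)))\<^sup>2)"
      by (rule Cauchy_Schwarz_nn_integral) auto
    also have "(\<integral>\<^sup>+z. (ennreal (F (x - z)))\<^sup>2) = (\<integral>\<^sup>+x. (ennreal (F x))\<^sup>2)"
      by (rule nn_integral_reflect_translate[of "\<lambda>z. (ennreal (F z))\<^sup>2"]) measurable
    finally show ?thesis .
  qed
  then have "(\<integral>\<^sup>+x. (ennreal (w x) * nn_conv K F x)\<^sup>2)
     \<le> (\<integral>\<^sup>+x. (ennreal (w x))\<^sup>2 * ((\<integral>\<^sup>+z. (ennreal (K z))\<^sup>2) * (\<integral>\<^sup>+x. (ennreal (F x))\<^sup>2)))"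
    unfolding power_mult_distrib by (intro nn_integral_mono mult_left_mono) auto
  also have "\<dots> = (\<integral>\<^sup>+x. (ennreal (w x))\<^sup>2) * ((\<integral>\<^sup>+z. (ennreal (K z))\<^sup>2) * (\<integral>\<^sup>+x. (ennreal (F x))\<^sup>2))"
    by (rule nn_integral_multc) measurable
  finally show ?thesis by (simp add: mult.assoc)
qed

lemma nn_conv_measurable [measurable]:
  assumes [measurable]: "K \<in> borel_measurable borel" "F \<in> borel_measurable borel"
  shows "nn_conv K F \<in> borel_measurable borel"
  unfolding nn_conv_def[abs_def] by measurable

lemma ennreal_square_add: "(a + b :: ennreal)\<^sup>2 \<le> 2 * a\<^sup>2 + 2 * b\<^sup>2"
  using add_left_mono[OF sum_of_squares_ge_ennreal[of a b], of "a\<^sup>2 + b\<^sup>2"]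
  unfolding power2_sum mult_2 by (simp add: ac_simps)

lemma nn_integral_square_add:
  assumes [measurable]: "a \<in> borel_measurable lborel" "b \<in> borel_measurable lborel"
  shows "(\<integral>\<^sup>+x. (a x + b x :: ennreal)\<^sup>2) \<le> 2 * (\<integral>\<^sup>+x. (a x)\<^sup>2) + 2 * (\<integral>\<^sup>+x. (b x)\<^sup>2)"
proof -
  have "(\<integral>\<^sup>+x. (a x + b x)\<^sup>2) \<le> (\<integral>\<^sup>+x. 2 * (a x)\<^sup>2 + 2 * (b x)\<^sup>2)"
    by (intro nn_integral_mono ennreal_square_add)
  then show ?thesis by (simp add: nn_integral_add nn_integral_cmult)
qed

lemma nn_integral_square_cmult:
  assumes [measurable]: "g \<in> borel_measurable lborel"
  shows "(\<integral>\<^sup>+x. (c * g x :: ennreal)\<^sup>2) = c\<^sup>2 * (\<integral>\<^sup>+x. (g x)\<^sup>2)"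
  by (simp add: power_mult_distrib nn_integral_cmult)

definition near_kernel :: "real \<Rightarrow> real \<Rightarrow> real" where
  "near_kernel a z = (if \<bar>z\<bar> \<le> 1 then \<bar>z\<bar> powr (- a) else 0)"

definition far_kernel :: "real \<Rightarrow> real \<Rightarrow> real" where
  "far_kernel a z = (if \<bar>z\<bar> > 1 then \<bar>z\<bar> powr (- a) else 0)"

lemma near_far_kernel_simps [simp]:
  "0 \<le> near_kernel a z" "0 \<le> far_kernel a z"
  "near_kernel a (- z) = near_kernel a z" "far_kernel a (- z) = far_kernel a z"
  by (auto simp: near_kernel_def far_kernel_def)

lemma near_far_kernel_measurable [measurable]:
  "near_kernel a \<in> borel_measurable borel" "far_kernel a \<in> borel_measurable borel"
  unfolding near_kernel_def[abs_def] far_kernel_def[abs_def] by measurable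

lemma near_kernel_integral:
  assumes "a < 1" shows "(\<integral>\<^sup>+z. ennreal (near_kernel a z)) < \<infinity>"
proof -
  have *: "(\<integral>\<^sup>+t. ennreal (indicator {0<..<1} t * t powr (- a))) < \<infinity>"
    using powr_set_integrable_near[of "- a"] assms by (auto simp: set_integrable_def integrable_iff_bounded)
  have "(\<integral>\<^sup>+z. ennreal (near_kernel a z)) = (\<integral>\<^sup>+t. indicator {0<..} t * (ennreal (near_kernel a t) + ennreal (near_kernel a (- t))))"
    by (rule nn_integral_even[symmetric]) measurable
  also have "\<dots> = (\<integral>\<^sup>+t. 2 * ennreal (indicator {0<..<1} t * t powr (- a)))"
    by (rule nn_integral_cong_AE, rule AE_mp[OF AE_lborel_singleton[of 1]])
       (auto intro!: AE_I2 simp: near_kernel_def mult_2 split: split_indicator)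
  also have "\<dots> = 2 * (\<integral>\<^sup>+t. ennreal (indicator {0<..<1} t * t powr (- a)))"
    by (rule nn_integral_cmult) measurable
  finally show ?thesis using * by (simp add: ennreal_mult_less_top)
qed

lemma far_kernel_integral:
  assumes "a > 1" shows "(\<integral>\<^sup>+z. ennreal (far_kernel a z)) < \<infinity>"
proof -
  have *: "(\<integral>\<^sup>+t. ennreal (indicator {1<..} t * t powr (- a))) < \<infinity>"
    using powr_set_integrable_far[of "- a"] assms by (auto simp: set_integrable_def integrable_iff_bounded)
  have "(\<integral>\<^sup>+z. ennreal (far_kernel a z)) = (\<integral>\<^sup>+t. indicator {0<..} t * (ennreal (far_kernel a t) + ennreal (far_kernel a (- t))))"
    by (rule nn_integral_even[symmetric]) measurable
  also have "\<dots> = (\<integral>\<^sup>+t. 2 * ennreal (indicator {1<..} t * t powr (- a)))"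
    by (intro nn_integral_cong) (auto simp: far_kernel_def mult_2 split: split_indicator)
  also have "\<dots> = 2 * (\<integral>\<^sup>+t. ennreal (indicator {1<..} t * t powr (- a)))"
    by (rule nn_integral_cmult) measurable
  finally show ?thesis using * by (simp add: ennreal_mult_less_top)
qed

lemma far_kernel_square: "(far_kernel a z)\<^sup>2 = far_kernel (2 * a) z"
  by (simp add: far_kernel_def power2_eq_square flip: powr_add)

lemma weight_square: "(weight \<beta> x)\<^sup>2 = weight (2 * \<beta>) x"
  by (simp add: weight_def power2_eq_square flip: powr_add)

lemma weight_square_integral:
  assumes "2 * \<beta> > 1" shows "(\<integral>\<^sup>+x. (ennreal (weight \<beta> x))\<^sup>2) < \<infinity>"
proof -
  have le: "(weight \<beta> x)\<^sup>2 \<le> near_kernel 0 x + far_kernel (2 * \<beta>) x + indicator {0} x" for x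
  proof (cases "\<bar>x\<bar> \<le> 1")
    case True
    have "(weight \<beta> x)\<^sup>2 \<le> 1"
    proof (rule power_le_one)
      have "weight \<beta> x \<le> (1 + x\<^sup>2) powr 0" unfolding weight_def using assms by (intro powr_mono) auto
      then show "weight \<beta> x \<le> 1" using one_plus_square_pos[of x] by (simp del: one_plus_square_pos split: if_splits)
    qed simp
    then show ?thesis using True by (cases "x = 0") (auto simp: near_kernel_def far_kernel_def)
  next
    case False
    have "(1 + x\<^sup>2) powr (- \<beta>) \<le> (x\<^sup>2) powr (- \<beta>)" using False assms by (intro powr_mono2') auto
    also have "\<dots> = \<bar>x\<bar> powr (- (2 * \<beta>))"
    proof -
      have "x\<^sup>2 = \<bar>x\<bar> powr 2" using False by simp
      then show ?thesis by (simp only: powr_powr) simp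
    qed
    finally show ?thesis using False unfolding weight_square by (simp add: weight_def near_kernel_def far_kernel_def)
  qed
  have "(\<integral>\<^sup>+x. (ennreal (weight \<beta> x))\<^sup>2)
     \<le> (\<integral>\<^sup>+x. ennreal (near_kernel 0 x) + ennreal (far_kernel (2 * \<beta>) x) + ennreal (indicator {0} x))"
    using le by (intro nn_integral_mono) (simp add: ennreal_power flip: ennreal_plus del: indicator_simps)
  also have "\<dots> = (\<integral>\<^sup>+x. ennreal (near_kernel 0 x)) + (\<integral>\<^sup>+x. ennreal (far_kernel (2 * \<beta>) x))
      + (\<integral>\<^sup>+x. ennreal (indicator {0::real} x))"
    by (simp add: nn_integral_add)
  also have "\<dots> < \<infinity>"
    using near_kernel_integral[of 0] far_kernel_integral[OF assms] by (simp add: ennreal_indicator)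
  finally show ?thesis .
qed

lemma ennreal_norm_integral_le:
  fixes f :: "'a \<Rightarrow> 'b::{banach, second_countable_topology}"
  shows "ennreal (norm (integral\<^sup>L M f)) \<le> (\<integral>\<^sup>+x. ennreal (norm (f x)) \<partial>M)"
  by (cases "integrable M f") (rule integral_norm_bound_ennreal, simp_all add: not_integrable_integral_eq)

text \<open>Passes from integrals over \<open>t > 0\<close>, with the two points \<open>x + t\<close> and \<open>x - t\<close>, to convolution with an even
kernel on the line.\<close>

lemma norm_integral_le_nn_conv:
  fixes J :: "real \<Rightarrow> complex"
  assumes [measurable]: "K \<in> borel_measurable borel" "F \<in> borel_measurable borel"
    and K: "\<And>z. 0 \<le> K z" "\<And>z. K (- z) = K z" and F: "\<And>z. 0 \<le> F z"
    and J: "\<And>t. t > 0 \<Longrightarrow> norm (J t) \<le> K t * (F (x + t) + F (x - t))" "\<And>t. t \<le> 0 \<Longrightarrow> J t = 0"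
  shows "ennreal (norm (LBINT t. J t)) \<le> nn_conv K F x"
proof -
  have "ennreal (norm (LBINT t. J t)) \<le> (\<integral>\<^sup>+t. ennreal (norm (J t)))"
    by (rule ennreal_norm_integral_le)
  also have "\<dots> \<le> (\<integral>\<^sup>+t. indicator {0<..} t * (ennreal (K t * F (x - t)) + ennreal (K (- t) * F (x - (- t)))))"
  proof (rule nn_integral_mono)
    fix t
    show "ennreal (norm (J t)) \<le> indicator {0<..} t * (ennreal (K t * F (x - t)) + ennreal (K (- t) * F (x - (- t))))"
      using J(1)[of t] J(2)[of t] K F
      by (cases "t > 0") (auto simp: distrib_left add.commute simp flip: ennreal_plus intro!: ennreal_leI)
  qed
  also have "\<dots> = nn_conv K F x" unfolding nn_conv_def by (rule nn_integral_even) measurable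
  finally show ?thesis .
qed

text \<open>The reciprocal of the weight, which by Peetre's inequality bounds the ratio \<open>w(x) / w(x - z)\<close> up to a constant.\<close>

definition japanese :: "real \<Rightarrow> real \<Rightarrow> real" where
  "japanese \<beta> z = (1 + z\<^sup>2) powr (\<beta> / 2)"

lemma japanese_nonneg [simp]: "0 \<le> japanese \<beta> z" by (simp add: japanese_def)

lemma japanese_measurable [measurable]: "japanese \<beta> \<in> borel_measurable borel"
  unfolding japanese_def[abs_def] by measurable

abbreviation moment :: "real \<Rightarrow> (real \<Rightarrow> ennreal) \<Rightarrow> ennreal" where
  "moment \<beta> K \<equiv> \<integral>\<^sup>+z. K z * ennreal (japanese \<beta> z)"

lemma japanese_translate:
  assumes "0 \<le> \<beta>" "\<bar>t\<bar> \<le> 1"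
  shows "japanese \<beta> (z + t) \<le> 2 powr \<beta> * japanese \<beta> z"
proof -
  have inv: "weight \<beta> y * japanese \<beta> y = 1" for y
    using one_plus_square_pos[of y] unfolding weight_def japanese_def powr_minus by (simp add: less_imp_neq[symmetric] del: one_plus_square_pos)
  have "weight \<beta> z * (japanese \<beta> z * japanese \<beta> (z + t)) \<le> 2 powr \<beta> * weight \<beta> (z + t) * (japanese \<beta> z * japanese \<beta> (z + t))"
    using assms by (intro mult_right_mono weight_near) auto
  moreover have "weight \<beta> z * (japanese \<beta> z * japanese \<beta> (z + t)) = japanese \<beta> (z + t)"
    using inv[of z] by (simp flip: mult.assoc)
  moreover have "2 powr \<beta> * weight \<beta> (z + t) * (japanese \<beta> z * japanese \<beta> (z + t)) = 2 powr \<beta> * japanese \<beta> z * (weight \<beta> (z + t) * japanese \<beta> (z + t))"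
    by (simp only: mult_ac)
  ultimately show ?thesis using inv[of "z + t"] by simp
qed

text \<open>Peetre's inequality lets the weight pass to the other side of the convolution at the cost of the factor \<open>japanese \<beta> z\<close>.\<close>

lemma weighted_young:
  fixes K :: "real \<Rightarrow> ennreal" and f :: "real \<Rightarrow> complex"
  assumes [measurable]: "K \<in> borel_measurable borel" "f \<in> borel_measurable borel" and \<beta>: "0 \<le> \<beta>"
  shows "(\<integral>\<^sup>+x. (ennreal (weight \<beta> x) * (\<integral>\<^sup>+z. K z * ennreal (norm (f (x - z)))))\<^sup>2)
    \<le> (ennreal (2 powr (\<beta> / 2)) * moment \<beta> K)\<^sup>2 * (\<integral>\<^sup>+x. (ennreal (weight \<beta> x * norm (f x)))\<^sup>2)"
proof -
  let ?c = "ennreal (2 powr (\<beta> / 2))"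
  let ?K = "\<lambda>z. ?c * (K z * ennreal (japanese \<beta> z))"
  have "ennreal (weight \<beta> x) * (\<integral>\<^sup>+z. K z * ennreal (norm (f (x - z))))
     \<le> (\<integral>\<^sup>+z. ?K z * ennreal (weight \<beta> (x - z) * norm (f (x - z))))" for x
  proof -
    have "ennreal (weight \<beta> x) * (\<integral>\<^sup>+z. K z * ennreal (norm (f (x - z))))
       = (\<integral>\<^sup>+z. ennreal (weight \<beta> x) * (K z * ennreal (norm (f (x - z)))))"
      by (rule nn_integral_cmult[symmetric]) measurable
    also have "\<dots> \<le> (\<integral>\<^sup>+z. ?K z * ennreal (weight \<beta> (x - z) * norm (f (x - z))))"
    proof (rule nn_integral_mono)
      fix z
      have "ennreal (weight \<beta> x) \<le> ennreal (2 powr (\<beta> / 2) * (weight \<beta> (x - z) * japanese \<beta> z))"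
        using peetre[OF \<beta>, of x "x - z"] by (intro ennreal_leI) (simp add: japanese_def)
      then have "ennreal (weight \<beta> x) * (K z * ennreal (norm (f (x - z)))) \<le> (?c * (ennreal (weight \<beta> (x - z)) * ennreal (japanese \<beta> z))) * (K z * ennreal (norm (f (x - z))))"
        by (intro mult_right_mono) (simp_all add: ennreal_mult)
      also have "\<dots> = ?K z * ennreal (weight \<beta> (x - z) * norm (f (x - z)))"
        by (simp add: ennreal_mult mult_ac)
      finally show "ennreal (weight \<beta> x) * (K z * ennreal (norm (f (x - z)))) \<le> ?K z * ennreal (weight \<beta> (x - z) * norm (f (x - z)))" .
    qed
    finally show ?thesis .
  qed
  then have "(\<integral>\<^sup>+x. (ennreal (weight \<beta> x) * (\<integral>\<^sup>+z. K z * ennreal (norm (f (x - z)))))\<^sup>2)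
    \<le> (\<integral>\<^sup>+x. (\<integral>\<^sup>+z. ?K z * ennreal (weight \<beta> (x - z) * norm (f (x - z))))\<^sup>2)"
    by (intro nn_integral_mono power_mono) auto
  also have "\<dots> \<le> (\<integral>\<^sup>+z. ?K z)\<^sup>2 * (\<integral>\<^sup>+x. (ennreal (weight \<beta> x * norm (f x)))\<^sup>2)"
    by (rule young_L1_L2_ennreal[where F = "\<lambda>x. ennreal (weight \<beta> x * norm (f x))"]) measurable
  also have "(\<integral>\<^sup>+z. ?K z) = ?c * moment \<beta> K"
    by (rule nn_integral_cmult) measurable
  finally show ?thesis .
qed

lemma weighted_translate:
  fixes f :: "real \<Rightarrow> ennreal"
  assumes [measurable]: "f \<in> borel_measurable borel" and "0 \<le> \<beta>" "\<bar>t\<bar> \<le> 1"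
  shows "moment \<beta> (\<lambda>z. f (z + t)) \<le> ennreal (2 powr \<beta>) * moment \<beta> f"
proof -
  have "moment \<beta> (\<lambda>z. f (z + t)) = (\<integral>\<^sup>+z. f (- t + z + t) * ennreal (japanese \<beta> (- t + z)))"
    by (rule nn_integral_translate[symmetric]) measurable
  also have "\<dots> \<le> (\<integral>\<^sup>+z. ennreal (2 powr \<beta>) * (f z * ennreal (japanese \<beta> z)))"
  proof (rule nn_integral_mono)
    fix z
    have "ennreal (japanese \<beta> (z + - t)) \<le> ennreal (2 powr \<beta> * japanese \<beta> z)"
      using assms by (intro ennreal_leI japanese_translate) auto
    then have "f z * ennreal (japanese \<beta> (z + - t)) \<le> f z * (ennreal (2 powr \<beta>) * ennreal (japanese \<beta> z))"
      by (intro mult_left_mono) (simp_all add: ennreal_mult)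
    then show "f (- t + z + t) * ennreal (japanese \<beta> (- t + z)) \<le> ennreal (2 powr \<beta>) * (f z * ennreal (japanese \<beta> z))"
      by (simp add: mult_ac)
  qed
  also have "\<dots> = ennreal (2 powr \<beta>) * moment \<beta> f"
    by (rule nn_integral_cmult) measurable
  finally show ?thesis .
qed

section \<open>Near and far parts of the commutator\<close>

text \<open>With \<open>a = \<alpha>\<close> this is the principal term \<open>T\<close> of the near part, an odd operator of order \<open>\<alpha> - 1\<close>.\<close>

definition localized_difference :: "real \<Rightarrow> (real \<Rightarrow> complex) \<Rightarrow> real \<Rightarrow> complex" where
  "localized_difference a f x =
     (LBINT t. of_real (indicator {0<..1} t * t powr (- a)) * (f (x + t) - f (x - t)))"

lemma localized_difference_measurable [measurable]:
  assumes [measurable]: "f \<in> borel_measurable borel"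
  shows "localized_difference a f \<in> borel_measurable borel"
  unfolding localized_difference_def[abs_def] by measurable

lemma decaying_difference_bound:
  assumes "decaying (Suc 0) f"
  shows "\<exists>C>0. \<forall>x t. 0 \<le> t \<longrightarrow> t \<le> 1 \<longrightarrow> norm (f (x + t) - f (x - t)) \<le> C * t / (1 + x\<^sup>2)"
proof -
  from assms obtain f' where f': "\<And>x. (f has_vector_derivative f' x) (at x)" "quadratic_decay f'" by auto
  obtain C where C: "C > 0" "\<And>x. norm (f' x) \<le> C / (1 + x\<^sup>2)"
    using quadratic_decay_bound[OF f'(2)] by blast
  have "norm (f (x + t) - f (x - t)) \<le> (6 * C) * t / (1 + x\<^sup>2)" if t: "0 \<le> t" "t \<le> 1" for x t
  proof -
    \<comment> \<open>For \<open>|x - z| \<le> 1\<close> the factors \<open>1 + x\<^sup>2\<close> and \<open>1 + z\<^sup>2\<close> are comparable, with the constant 3.\<close>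
    have "norm (f (x + t) - f (x - t)) \<le> 3 * C / (1 + x\<^sup>2) * norm ((x + t) - (x - t))"
    proof (rule differentiable_bound[where S = "{x - t..x + t}" and f' = "\<lambda>z h. h *\<^sub>R f' z"])
      fix z assume z: "z \<in> {x - t..x + t}"
      show "(f has_derivative (\<lambda>h. h *\<^sub>R f' z)) (at z within {x - t..x + t})"
        using f'(1)[of z] unfolding has_vector_derivative_def by (rule has_derivative_at_withinI)
      have "\<bar>x - z\<bar> \<le> 1" using z t by auto
      then have "(x - z)\<^sup>2 \<le> 1" by (simp add: abs_square_le_1)
      moreover have "x\<^sup>2 \<le> 2 * z\<^sup>2 + 2 * (x - z)\<^sup>2"
        using zero_le_power2[of "x - 2 * z"] by (simp add: power2_eq_square algebra_simps)
      ultimately have le: "1 + x\<^sup>2 \<le> 3 * (1 + z\<^sup>2)" using zero_le_power2[of z] unfolding distrib_left by linarith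
      have "norm (f' z) \<le> C / (1 + z\<^sup>2)" by (rule C)
      also have "\<dots> \<le> 3 * C / (1 + x\<^sup>2)"
      proof -
        have "C * (1 + x\<^sup>2) \<le> 3 * C * (1 + z\<^sup>2)" using mult_left_mono[OF le, of C] C(1) by (simp add: mult_ac)
        then show ?thesis by (simp add: divide_le_eq le_divide_eq mult.commute field_simps)
      qed
      finally have n: "norm (f' z) \<le> 3 * C / (1 + x\<^sup>2)" .
      show "onorm (\<lambda>h. h *\<^sub>R f' z) \<le> 3 * C / (1 + x\<^sup>2)"
        by (rule onorm_le) (use mult_left_mono[OF n] in \<open>simp add: mult.commute\<close>)
    qed (use t in auto)
    then show ?thesis using t by (simp add: mult_ac)
  qed
  then show ?thesis using C(1) by (intro exI[of _ "6 * C"]) auto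
qed

lemma localized_difference_integrable:
  assumes "decaying (Suc 0) f" "a < 2"
  shows "integrable lborel (\<lambda>t. of_real (indicator {0<..1} t * t powr (- a)) * (f (x + t) - f (x - t)))"
proof -
  obtain C where C: "C > 0" "\<And>x t. 0 \<le> t \<Longrightarrow> t \<le> 1 \<Longrightarrow> norm (f (x + t) - f (x - t)) \<le> C * t / (1 + x\<^sup>2)"
    using decaying_difference_bound[OF assms(1)] by blast
  have [measurable]: "f \<in> borel_measurable borel"
    using assms(1) decaying_imp_quadratic_decay quadratic_decay_measurable by blast
  have "(\<integral>\<^sup>+t. ennreal (norm (C / (1 + x\<^sup>2) * near_kernel (a - 1) t))) = ennreal (C / (1 + x\<^sup>2)) * (\<integral>\<^sup>+t. ennreal (near_kernel (a - 1) t))"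
  proof -
    have "(\<integral>\<^sup>+t. ennreal (norm (c * near_kernel (a - 1) t))) = ennreal c * (\<integral>\<^sup>+t. ennreal (near_kernel (a - 1) t))"
      if "0 \<le> c" for c :: real
      using that by (subst nn_integral_cmult[symmetric]) (auto simp: abs_mult ennreal_mult)
    from this[of "C / (1 + x\<^sup>2)"] show ?thesis using C(1) by (simp only: divide_nonneg_pos less_imp_le one_plus_square_pos)
  qed
  then have i: "integrable lborel (\<lambda>t. C / (1 + x\<^sup>2) * near_kernel (a - 1) t)"
    using near_kernel_integral[of "a - 1"] assms(2) unfolding integrable_iff_bounded by (simp add: ennreal_mult_less_top)
  show ?thesis
  proof (rule Bochner_Integration.integrable_bound[OF i])
    show "AE t in lborel. norm (of_real (indicator {0<..1} t * t powr (- a)) * (f (x + t) - f (x - t))) \<le> norm (C / (1 + x\<^sup>2) * near_kernel (a - 1) t)"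
    proof (rule AE_I2)
      fix t
      show "norm (of_real (indicator {0<..1} t * t powr (- a)) * (f (x + t) - f (x - t))) \<le> norm (C / (1 + x\<^sup>2) * near_kernel (a - 1) t)"
      proof (cases "0 < t \<and> t \<le> 1")
        case True
        then have "t powr (- a) * norm (f (x + t) - f (x - t)) \<le> t powr (- a) * (C * t / (1 + x\<^sup>2))"
          by (intro mult_left_mono C) auto
        also have "\<dots> = C / (1 + x\<^sup>2) * t powr (- (a - 1))" using True by (simp add: powr_diff powr_minus divide_simps)
        finally show ?thesis using True C(1) by (simp add: norm_mult near_kernel_def)
      qed auto
    qed
  qed measurable
qed

text \<open>The estimates up to the constants are proved for one function \<open>u\<close> at a time; the constants are expressions in \<open>\<alpha>\<close> and
\<open>\<beta>\<close> alone.\<close>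

locale weighted_setting =
  fixes \<alpha> \<beta> :: real and u :: "real \<Rightarrow> complex"
  assumes \<alpha>: "0 < \<alpha>" "\<alpha> < 2" and \<beta>: "\<beta> = (1 + \<alpha>) / 2" and u: "decaying 4 u"
begin

definition F :: "real \<Rightarrow> real" where "F y = weight \<beta> y * norm (u y)"

text \<open>The integrand of \<open>commutator_singular_integral\<close> for \<open>g = w\<close>, without the factor \<open>t\<^bsup>-1-\<alpha>\<^esup>\<close>.\<close>

definition D :: "real \<Rightarrow> real \<Rightarrow> complex" where
  "D x t = of_real (weight \<beta> x - weight \<beta> (x + t)) * u (x + t) + of_real (weight \<beta> x - weight \<beta> (x - t)) * u (x - t)"

text \<open>The contribution of the steps \<open>t \<in> S\<close> to the commutator; it is used for \<open>0 < t \<le> 1\<close> and for \<open>t > 1\<close>.\<close>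

definition part :: "real set \<Rightarrow> real \<Rightarrow> complex" where
  "part S x = (LBINT t. of_real (indicator S t * t powr (-1 - \<alpha>)) * D x t)"

lemma \<beta>_nonneg: "0 \<le> \<beta>" "1 < 2 * \<beta>" using \<alpha> \<beta> by auto

lemma u_measurable [measurable]: "u \<in> borel_measurable borel"
  using u decaying_imp_quadratic_decay quadratic_decay_measurable by blast

lemma F_measurable [measurable]: "F \<in> borel_measurable borel"
  unfolding F_def[abs_def] by measurable

lemma F_nonneg [simp]: "0 \<le> F y" by (simp add: F_def)

lemma D_measurable [measurable]: "D x \<in> borel_measurable borel"
  unfolding D_def[abs_def] by measurable

lemma part_measurable [measurable]: "part S \<in> borel_measurable borel" if [measurable]: "S \<in> sets borel" for S
  unfolding part_def[abs_def] D_def by measurable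

lemma norm_D_le:
  assumes "\<And>y. \<bar>x - y\<bar> = \<bar>t\<bar> \<Longrightarrow> \<bar>weight \<beta> x - weight \<beta> y\<bar> \<le> c * weight \<beta> y"
  shows "norm (D x t) \<le> c * (F (x + t) + F (x - t))"
proof -
  have "norm (of_real (weight \<beta> x - weight \<beta> y) * u y) \<le> c * F y" if "\<bar>x - y\<bar> = \<bar>t\<bar>" for y
    using mult_right_mono[OF assms[OF that], of "norm (u y)"] by (simp add: F_def norm_mult mult.assoc flip: of_real_diff)
  from add_mono[OF this this] show ?thesis
    unfolding D_def by (intro order_trans[OF norm_triangle_ineq]) (simp add: distrib_left)
qed

text \<open>By \<open>weight_far\<close>, and since \<open>t\<^bsup>-1-\<alpha>\<^esup> t\<^sup>\<beta> = t\<^bsup>-\<beta>\<^esup>\<close>. No difference is exploited here: \<open>w(x)\<close> and \<open>w(y)\<close>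
are estimated separately.\<close>

lemma far_bound:
  "ennreal (norm (part {1<..} x))
    \<le> ennreal (2 * 2 powr \<beta>) * nn_conv (far_kernel (1 + \<alpha>)) F x
      + ennreal (2 * 2 powr \<beta>) * (ennreal (weight \<beta> x) * nn_conv (far_kernel \<beta>) F x)"
proof -
  let ?c = "2 * 2 powr \<beta>"
  let ?K = "\<lambda>t. ?c * (far_kernel (1 + \<alpha>) t + weight \<beta> x * far_kernel \<beta> t)"
  have "ennreal (norm (part {1<..} x)) \<le> nn_conv ?K F x"
    unfolding part_def
  proof (rule norm_integral_le_nn_conv)
    fix t :: real assume "t > 0"
    show "norm (of_real (indicator {1<..} t * t powr (-1 - \<alpha>)) * D x t) \<le> ?K t * (F (x + t) + F (x - t))"
    proof (cases "t > 1")
      case True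
      have "norm (D x t) \<le> (?c * (1 + weight \<beta> x * t powr \<beta>)) * (F (x + t) + F (x - t))"
      proof (rule norm_D_le)
        fix y assume y: "\<bar>x - y\<bar> = \<bar>t\<bar>"
        have 1: "weight \<beta> x \<le> 2 powr \<beta> * (weight \<beta> y * (1 + weight \<beta> x * t powr \<beta>))"
          using weight_far[OF \<beta>_nonneg(1), of x y] y True by simp
        have "1 * (weight \<beta> y * 1) \<le> 2 powr \<beta> * (weight \<beta> y * (1 + weight \<beta> x * t powr \<beta>))"
          using \<beta>_nonneg(1) by (intro mult_mono) (auto simp: ge_one_powr_ge_zero)
        with 1 have "\<bar>weight \<beta> x - weight \<beta> y\<bar> \<le> 2 powr \<beta> * (weight \<beta> y * (1 + weight \<beta> x * t powr \<beta>)) + 2 powr \<beta> * (weight \<beta> y * (1 + weight \<beta> x * t powr \<beta>))"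
          using weight_pos(1)[of \<beta> x] weight_pos(1)[of \<beta> y] by linarith
        also have "\<dots> = (?c * (1 + weight \<beta> x * t powr \<beta>)) * weight \<beta> y" by (simp add: algebra_simps)
        finally show "\<bar>weight \<beta> x - weight \<beta> y\<bar> \<le> (?c * (1 + weight \<beta> x * t powr \<beta>)) * weight \<beta> y" .
      qed
      then have "t powr (-1 - \<alpha>) * norm (D x t) \<le> t powr (-1 - \<alpha>) * ((?c * (1 + weight \<beta> x * t powr \<beta>)) * (F (x + t) + F (x - t)))"
        by (rule mult_left_mono) simp
      also have "\<dots> = (?c * (t powr (-1 - \<alpha>) + weight \<beta> x * (t powr (-1 - \<alpha>) * t powr \<beta>))) * (F (x + t) + F (x - t))"
        by (simp add: algebra_simps)
      also have "t powr (-1 - \<alpha>) * t powr \<beta> = t powr (- \<beta>)"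
      proof -
        have "-1 - \<alpha> + \<beta> = - \<beta>" by (simp add: \<beta> field_simps)
        then show ?thesis by (simp only: powr_add[symmetric])
      qed
      also have "(?c * (t powr (-1 - \<alpha>) + weight \<beta> x * t powr (- \<beta>))) = ?K t"
      proof -
        have "-1 - \<alpha> = - (1 + \<alpha>)" by simp
        then show ?thesis using True unfolding far_kernel_def by (simp only:) simp
      qed
      finally show ?thesis using True by (simp add: norm_mult)
    qed (auto intro!: mult_nonneg_nonneg add_nonneg_nonneg)
  qed (auto intro!: mult_nonneg_nonneg add_nonneg_nonneg)
  also have "nn_conv ?K F x = (\<integral>\<^sup>+z. ennreal ?c * ennreal (far_kernel (1 + \<alpha>) z * F (x - z)) + ennreal ?c * (ennreal (weight \<beta> x) * ennreal (far_kernel \<beta> z * F (x - z))))"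
    unfolding nn_conv_def by (intro nn_integral_cong) (simp add: distrib_left distrib_right mult.assoc flip: ennreal_plus ennreal_mult)
  also have "\<dots> = ennreal ?c * nn_conv (far_kernel (1 + \<alpha>)) F x + ennreal ?c * (ennreal (weight \<beta> x) * nn_conv (far_kernel \<beta>) F x)"
    unfolding nn_conv_def by (simp add: nn_integral_add nn_integral_cmult)
  finally show ?thesis .
qed

text \<open>Useful only for \<open>\<alpha> < 1\<close>, where the kernel is integrable.\<close>

lemma near_bound:
  "ennreal (norm (part {0<..1} x))
    \<le> ennreal (\<beta> * 2 powr \<beta>) * nn_conv (near_kernel \<alpha>) F x"
proof -
  let ?c = "\<beta> * 2 powr \<beta>"
  have "ennreal (norm (part {0<..1} x)) \<le> nn_conv (\<lambda>z. ?c * near_kernel \<alpha> z) F x"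
    unfolding part_def
  proof (rule norm_integral_le_nn_conv)
    fix t :: real assume "t > 0"
    show "norm (of_real (indicator {0<..1} t * t powr (-1 - \<alpha>)) * D x t) \<le> (?c * near_kernel \<alpha> t) * (F (x + t) + F (x - t))"
    proof (cases "t \<le> 1")
      case True
      have "norm (D x t) \<le> (?c * t) * (F (x + t) + F (x - t))"
      proof (rule norm_D_le)
        fix y assume y: "\<bar>x - y\<bar> = \<bar>t\<bar>"
        then show "\<bar>weight \<beta> x - weight \<beta> y\<bar> \<le> (?c * t) * weight \<beta> y"
          using weight_diff_near[OF \<beta>_nonneg(1), of x y] True \<open>t > 0\<close> by (simp add: mult_ac)
      qed
      then have "t powr (-1 - \<alpha>) * norm (D x t) \<le> t powr (-1 - \<alpha>) * ((?c * t) * (F (x + t) + F (x - t)))"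
        by (rule mult_left_mono) simp
      also have "\<dots> = (?c * (t powr (-1 - \<alpha>) * t powr 1)) * (F (x + t) + F (x - t))" using \<open>t > 0\<close> by simp
      also have "t powr (-1 - \<alpha>) * t powr 1 = near_kernel \<alpha> t"
        unfolding powr_add[symmetric] using True \<open>t > 0\<close> by (simp add: near_kernel_def)
      finally show ?thesis using True \<open>t > 0\<close> by (simp add: norm_mult)
    qed (use \<beta>_nonneg in \<open>auto intro!: mult_nonneg_nonneg add_nonneg_nonneg\<close>)
  qed (use \<beta>_nonneg in \<open>auto intro!: mult_nonneg_nonneg add_nonneg_nonneg\<close>)
  also have "nn_conv (\<lambda>z. ?c * near_kernel \<alpha> z) F x = ennreal ?c * nn_conv (near_kernel \<alpha>) F x"
    unfolding nn_conv_def using \<beta>_nonneg by (simp add: mult.assoc ennreal_mult nn_integral_cmult)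
  finally show ?thesis .
qed

text \<open>The terms of first order in \<open>t\<close> have opposite signs at \<open>x + t\<close> and \<open>x - t\<close>, which produces the symmetric
difference of \<open>u\<close>. The error of second order leaves a kernel with the exponent \<open>\<alpha> - 1 < 1\<close>.\<close>

lemma near_bound_principal:
  "ennreal (norm (part {0<..1} x))
    \<le> ennreal (\<beta> * weight \<beta> x * norm (localized_difference \<alpha> u x))
      + ennreal (\<beta> * (\<beta> + 3) * 2 powr \<beta>) * nn_conv (near_kernel (\<alpha> - 1)) F x"
proof -
  let ?c = "\<beta> * (\<beta> + 3) * 2 powr \<beta>" and ?w = "\<lambda>t. of_real (indicator {0<..1} t * t powr (-1 - \<alpha>)) :: complex"
  let ?P = "\<lambda>t. of_real (indicator {0<..1} t * t powr (- \<alpha>)) * (u (x + t) - u (x - t))"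
  \<comment> \<open>The sign of the second summand undoes the first-order terms of \<open>D\<close>.\<close>
  let ?E = "\<lambda>t. ?w t * (D x t + of_real (weight' \<beta> x * t) * (u (x + t) - u (x - t)))"
  have i: "integrable lborel ?P"
    using decaying_mono[OF u, of "Suc 0"] \<alpha> by (intro localized_difference_integrable) auto
  have eq: "?w t * D x t = ?E t - of_real (weight' \<beta> x) * ?P t" for t
  proof (cases "0 < t \<and> t \<le> 1")
    case True
    have "t powr (- \<alpha>) = t powr (-1 - \<alpha>) * t" using True powr_add[of t "-1 - \<alpha>" 1] by simp
    then show ?thesis using True by (simp add: algebra_simps)
  qed auto
  have E: "ennreal (norm (LBINT t. ?E t)) \<le> nn_conv (\<lambda>z. ?c * near_kernel (\<alpha> - 1) z) F x"
  proof (rule norm_integral_le_nn_conv)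
    fix t :: real assume "t > 0"
    show "norm (?E t) \<le> (?c * near_kernel (\<alpha> - 1) t) * (F (x + t) + F (x - t))"
    proof (cases "t \<le> 1")
      case True
      have n: "norm (of_real (weight \<beta> x - weight \<beta> y - weight' \<beta> x * (x - y)) * u y) \<le> (?c * t\<^sup>2) * F y" if y: "\<bar>x - y\<bar> = t" for y
      proof -
        have "\<bar>weight \<beta> x - weight \<beta> y - weight' \<beta> x * (x - y)\<bar> \<le> ?c * weight \<beta> y * (x - y)\<^sup>2"
          using y True by (intro weight_taylor_near \<beta>_nonneg) auto
        also have "(x - y)\<^sup>2 = t\<^sup>2" using y by auto
        finally have "\<bar>weight \<beta> x - weight \<beta> y - weight' \<beta> x * (x - y)\<bar> * norm (u y) \<le> ?c * weight \<beta> y * t\<^sup>2 * norm (u y)"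
          by (rule mult_right_mono) simp
        then show ?thesis unfolding norm_mult norm_of_real by (simp add: F_def mult_ac)
      qed
      have "D x t + of_real (weight' \<beta> x * t) * (u (x + t) - u (x - t))
        = of_real (weight \<beta> x - weight \<beta> (x + t) - weight' \<beta> x * (x - (x + t))) * u (x + t)
        + of_real (weight \<beta> x - weight \<beta> (x - t) - weight' \<beta> x * (x - (x - t))) * u (x - t)"
        unfolding D_def by (simp add: algebra_simps)
      then have "norm (D x t + of_real (weight' \<beta> x * t) * (u (x + t) - u (x - t))) \<le> (?c * t\<^sup>2) * F (x + t) + (?c * t\<^sup>2) * F (x - t)"
        using n[of "x + t"] n[of "x - t"] \<open>t > 0\<close> by (simp only:) (intro order_trans[OF norm_triangle_ineq] add_mono, simp_all)
      then have "t powr (-1 - \<alpha>) * norm (D x t + of_real (weight' \<beta> x * t) * (u (x + t) - u (x - t)))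
         \<le> t powr (-1 - \<alpha>) * ((?c * t\<^sup>2) * F (x + t) + (?c * t\<^sup>2) * F (x - t))"
        by (rule mult_left_mono) simp
      also have "\<dots> = (?c * (t powr (-1 - \<alpha>) * t powr 2)) * (F (x + t) + F (x - t))"
        using \<open>t > 0\<close> by (simp add: algebra_simps)
      also have "t powr (-1 - \<alpha>) * t powr 2 = near_kernel (\<alpha> - 1) t"
        unfolding powr_add[symmetric] using True \<open>t > 0\<close> by (simp add: near_kernel_def)
      finally show ?thesis using True \<open>t > 0\<close> unfolding norm_mult by simp
    qed (use \<beta>_nonneg in \<open>auto intro!: mult_nonneg_nonneg add_nonneg_nonneg\<close>)
  qed (use \<beta>_nonneg in \<open>auto intro!: mult_nonneg_nonneg add_nonneg_nonneg\<close>)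
  show ?thesis
  proof (cases "integrable lborel (\<lambda>t. ?w t * D x t)")
    case True
    have "integrable lborel (\<lambda>t. ?w t * D x t + of_real (weight' \<beta> x) * ?P t)"
      using True i by (intro Bochner_Integration.integrable_add integrable_mult_right)
    then have iE: "integrable lborel ?E" unfolding eq by simp
    have "(LBINT t. ?w t * D x t) = (LBINT t. ?E t) - of_real (weight' \<beta> x) * localized_difference \<alpha> u x"
      unfolding eq localized_difference_def
      by (subst Bochner_Integration.integral_diff[OF iE integrable_mult_right[OF i]]) (simp only: integral_mult_right_zero)
    then have "norm (LBINT t. ?w t * D x t) \<le> norm (LBINT t. ?E t) + \<bar>weight' \<beta> x\<bar> * norm (localized_difference \<alpha> u x)"
      using norm_triangle_ineq4[of "LBINT t. ?E t" "of_real (weight' \<beta> x) * localized_difference \<alpha> u x"] by (simp add: norm_mult)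
    also have "\<bar>weight' \<beta> x\<bar> * norm (localized_difference \<alpha> u x) \<le> \<beta> * weight \<beta> x * norm (localized_difference \<alpha> u x)"
      by (intro mult_right_mono weight'_bound \<beta>_nonneg) simp
    finally have "ennreal (norm (LBINT t. ?w t * D x t)) \<le> ennreal (norm (LBINT t. ?E t) + \<beta> * weight \<beta> x * norm (localized_difference \<alpha> u x))"
      by (simp add: ennreal_leI)
    also have "\<dots> = ennreal (\<beta> * weight \<beta> x * norm (localized_difference \<alpha> u x)) + ennreal (norm (LBINT t. ?E t))"
      using \<beta>_nonneg by (simp add: add.commute)
    also have "\<dots> \<le> ennreal (\<beta> * weight \<beta> x * norm (localized_difference \<alpha> u x)) + nn_conv (\<lambda>z. ?c * near_kernel (\<alpha> - 1) z) F x"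
      by (intro add_left_mono E)
    also have "nn_conv (\<lambda>z. ?c * near_kernel (\<alpha> - 1) z) F x = ennreal ?c * nn_conv (near_kernel (\<alpha> - 1)) F x"
      unfolding nn_conv_def using \<beta>_nonneg by (simp add: mult.assoc ennreal_mult nn_integral_cmult)
    finally show ?thesis unfolding part_def .
  qed (simp add: part_def not_integrable_integral_eq)
qed

lemma commutator_split:
  "abs_D_const \<alpha> * norm (commutator (abs_D \<alpha>) (weight \<beta>) u x)
    \<le> norm (part {0<..1} x)
      + norm (part {1<..} x)"
proof -
  let ?J = "\<lambda>t. of_real (indicator {0<..} t * t powr (-1 - \<alpha>)) * D x t"
  note c = commutator_singular_integral[OF \<alpha> u bounded_derivs_weight[OF \<beta>_nonneg(1)], of x, folded D_def]
  have n: "(\<lambda>t. of_real (indicator {0<..1} t * t powr (-1 - \<alpha>)) * D x t) = (\<lambda>t. indicator {0<..1} t *\<^sub>R ?J t)"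
    "(\<lambda>t. of_real (indicator {1<..} t * t powr (-1 - \<alpha>)) * D x t) = (\<lambda>t. indicator {1<..} t *\<^sub>R ?J t)"
    by (auto split: split_indicator)
  have "(LBINT t. ?J t) = (LBINT t. indicator {0<..1} t *\<^sub>R ?J t + indicator {1<..} t *\<^sub>R ?J t)"
    by (intro Bochner_Integration.integral_cong) (auto split: split_indicator)
  also have "\<dots> = (LBINT t. indicator {0<..1} t *\<^sub>R ?J t) + (LBINT t. indicator {1<..} t *\<^sub>R ?J t)"
    by (intro Bochner_Integration.integral_add integrable_mult_indicator c(2)) auto
  finally have "of_real (abs_D_const \<alpha>) * commutator (abs_D \<alpha>) (weight \<beta>) u x = \<dots>" using c(1) by simp
  then have "norm (of_real (abs_D_const \<alpha>) * commutator (abs_D \<alpha>) (weight \<beta>) u x)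
     \<le> norm (LBINT t. indicator {0<..1} t *\<^sub>R ?J t) + norm (LBINT t. indicator {1<..} t *\<^sub>R ?J t)"
    by (simp only:) (rule norm_triangle_ineq)
  then show ?thesis unfolding part_def n using abs_D_const_pos[OF \<alpha>] by (simp add: norm_mult)
qed

end

definition far_const :: "real \<Rightarrow> real \<Rightarrow> ennreal" where
  "far_const \<alpha> \<beta> = 2 * ((ennreal (2 * 2 powr \<beta>))\<^sup>2 * (\<integral>\<^sup>+z. ennreal (far_kernel (1 + \<alpha>) z))\<^sup>2)
     + 2 * ((ennreal (2 * 2 powr \<beta>))\<^sup>2 * ((\<integral>\<^sup>+x. (ennreal (weight \<beta> x))\<^sup>2) * (\<integral>\<^sup>+z. (ennreal (far_kernel \<beta> z))\<^sup>2)))"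

lemma far_const_finite:
  assumes "0 < \<alpha>" "\<beta> = (1 + \<alpha>) / 2" shows "far_const \<alpha> \<beta> < \<infinity>"
proof -
  have "(\<integral>\<^sup>+z. (ennreal (far_kernel \<beta> z))\<^sup>2) = (\<integral>\<^sup>+z. ennreal (far_kernel (2 * \<beta>) z))"
    by (simp add: ennreal_power far_kernel_square)
  also have "\<dots> < \<infinity>" using assms by (intro far_kernel_integral) auto
  finally have 1: "(\<integral>\<^sup>+z. (ennreal (far_kernel \<beta> z))\<^sup>2) < \<infinity>" .
  have 2: "(\<integral>\<^sup>+z. ennreal (far_kernel (1 + \<alpha>) z)) < \<infinity>"
    using assms by (intro far_kernel_integral) auto
  have 3: "(\<integral>\<^sup>+x. (ennreal (weight \<beta> x))\<^sup>2) < \<infinity>"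
    using assms by (intro weight_square_integral) auto
  show ?thesis
    using 1 2 3 by (simp add: far_const_def ennreal_mult_less_top power_less_top_ennreal)
qed

context weighted_setting
begin

abbreviation "F2 \<equiv> \<integral>\<^sup>+x. (ennreal (F x))\<^sup>2"

lemma near_kernel_L2:
  "(\<integral>\<^sup>+x. (nn_conv (near_kernel a) F x)\<^sup>2) \<le> (\<integral>\<^sup>+z. ennreal (near_kernel a z))\<^sup>2 * F2"
  by (rule young_L1_L2) auto

lemma far_L2:
  "(\<integral>\<^sup>+x. (ennreal (norm (part {1<..} x)))\<^sup>2)
    \<le> far_const \<alpha> \<beta> * F2"
proof -
  let ?c = "ennreal (2 * 2 powr \<beta>)"
  have "(\<integral>\<^sup>+x. (ennreal (norm (part {1<..} x)))\<^sup>2)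
    \<le> (\<integral>\<^sup>+x. (?c * nn_conv (far_kernel (1 + \<alpha>)) F x + ?c * (ennreal (weight \<beta> x) * nn_conv (far_kernel \<beta>) F x))\<^sup>2)"
    by (intro nn_integral_mono power_mono far_bound) auto
  also have "\<dots> \<le> 2 * (?c\<^sup>2 * (\<integral>\<^sup>+x. (nn_conv (far_kernel (1 + \<alpha>)) F x)\<^sup>2))
      + 2 * (?c\<^sup>2 * (\<integral>\<^sup>+x. (ennreal (weight \<beta> x) * nn_conv (far_kernel \<beta>) F x)\<^sup>2))"
    by (rule order_trans[OF nn_integral_square_add]) (simp_all add: nn_integral_square_cmult)
  also have "\<dots> \<le> 2 * (?c\<^sup>2 * ((\<integral>\<^sup>+z. ennreal (far_kernel (1 + \<alpha>) z))\<^sup>2 * F2))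
      + 2 * (?c\<^sup>2 * ((\<integral>\<^sup>+x. (ennreal (weight \<beta> x))\<^sup>2) * (\<integral>\<^sup>+z. (ennreal (far_kernel \<beta> z))\<^sup>2) * F2))"
    by (intro add_mono mult_left_mono young_L1_L2 weighted_conv_L2_L2) auto
  also have "\<dots> = far_const \<alpha> \<beta> * F2" by (simp only: far_const_def distrib_right mult.assoc)
  finally show ?thesis .
qed

lemma commutator_L2:
  "(ennreal (abs_D_const \<alpha>))\<^sup>2 * L2_norm_squared (commutator (abs_D \<alpha>) (weight \<beta>) u)
    \<le> 2 * (\<integral>\<^sup>+x. (ennreal (norm (part {0<..1} x)))\<^sup>2)
      + 2 * (far_const \<alpha> \<beta> * F2)" (is "?L \<le> 2 * (\<integral>\<^sup>+x. (ennreal (norm (?N x)))\<^sup>2) + _")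
proof -
  let ?R = "part {1<..}"
  have [measurable]: "commutator (abs_D \<alpha>) (weight \<beta>) u \<in> borel_measurable borel"
    unfolding commutator_def by measurable
  have "?L \<le> (\<integral>\<^sup>+x. (ennreal (abs_D_const \<alpha>))\<^sup>2 * ennreal ((cmod (commutator (abs_D \<alpha>) (weight \<beta>) u x))\<^sup>2))"
    unfolding L2_norm_squared_def
    by (subst nn_integral_cmult) simp_all
  also have "\<dots> \<le> (\<integral>\<^sup>+x. (ennreal (norm (?N x)) + ennreal (norm (?R x)))\<^sup>2)"
  proof (rule nn_integral_mono)
    fix x
    have "(abs_D_const \<alpha> * norm (commutator (abs_D \<alpha>) (weight \<beta>) u x))\<^sup>2 \<le> (norm (?N x) + norm (?R x))\<^sup>2"
      using abs_D_const_pos[OF \<alpha>] by (intro power_mono commutator_split) simp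
    then have "ennreal ((abs_D_const \<alpha> * norm (commutator (abs_D \<alpha>) (weight \<beta>) u x))\<^sup>2) \<le> ennreal ((norm (?N x) + norm (?R x))\<^sup>2)"
      by (rule ennreal_leI)
    then show "(ennreal (abs_D_const \<alpha>))\<^sup>2 * ennreal ((cmod (commutator (abs_D \<alpha>) (weight \<beta>) u x))\<^sup>2) \<le> (ennreal (norm (?N x)) + ennreal (norm (?R x)))\<^sup>2"
      using abs_D_const_pos[OF \<alpha>] by (simp add: power_mult_distrib ennreal_mult ennreal_power flip: ennreal_plus)
  qed
  also have "\<dots> \<le> 2 * (\<integral>\<^sup>+x. (ennreal (norm (?N x)))\<^sup>2) + 2 * (\<integral>\<^sup>+x. (ennreal (norm (?R x)))\<^sup>2)"
    by (rule nn_integral_square_add) measurable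
  also have "\<dots> \<le> 2 * (\<integral>\<^sup>+x. (ennreal (norm (?N x)))\<^sup>2) + 2 * (far_const \<alpha> \<beta> * F2)"
    by (intro add_left_mono mult_left_mono far_L2) simp
  finally show ?thesis .
qed

lemma near_L2_subcritical:
  "(\<integral>\<^sup>+x. (ennreal (norm (part {0<..1} x)))\<^sup>2)
    \<le> (ennreal (\<beta> * 2 powr \<beta>))\<^sup>2 * (\<integral>\<^sup>+z. ennreal (near_kernel \<alpha> z))\<^sup>2 * F2"
proof -
  have "(\<integral>\<^sup>+x. (ennreal (norm (part {0<..1} x)))\<^sup>2)
      \<le> (\<integral>\<^sup>+x. (ennreal (\<beta> * 2 powr \<beta>) * nn_conv (near_kernel \<alpha>) F x)\<^sup>2)"
    by (intro nn_integral_mono power_mono near_bound) auto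
  also have "\<dots> = (ennreal (\<beta> * 2 powr \<beta>))\<^sup>2 * (\<integral>\<^sup>+x. (nn_conv (near_kernel \<alpha>) F x)\<^sup>2)"
    by (rule nn_integral_square_cmult) measurable
  also have "\<dots> \<le> (ennreal (\<beta> * 2 powr \<beta>))\<^sup>2 * ((\<integral>\<^sup>+z. ennreal (near_kernel \<alpha> z))\<^sup>2 * F2)"
    by (intro mult_left_mono near_kernel_L2) simp
  finally show ?thesis by (simp add: mult.assoc)
qed

text \<open>Reduces the case \<open>\<alpha> \<ge> 1\<close> to a bound for \<open>w T u\<close>.\<close>

lemma near_L2_principal:
  "(\<integral>\<^sup>+x. (ennreal (norm (part {0<..1} x)))\<^sup>2)
    \<le> 2 * ((ennreal \<beta>)\<^sup>2 * (\<integral>\<^sup>+x. (ennreal (weight \<beta> x * norm (localized_difference \<alpha> u x)))\<^sup>2))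
      + 2 * ((ennreal (\<beta> * (\<beta> + 3) * 2 powr \<beta>))\<^sup>2 * (\<integral>\<^sup>+z. ennreal (near_kernel (\<alpha> - 1) z))\<^sup>2 * F2)"
proof -
  let ?c = "ennreal (\<beta> * (\<beta> + 3) * 2 powr \<beta>)"
  have "(\<integral>\<^sup>+x. (ennreal (norm (part {0<..1} x)))\<^sup>2)
      \<le> (\<integral>\<^sup>+x. (ennreal \<beta> * ennreal (weight \<beta> x * norm (localized_difference \<alpha> u x)) + ?c * nn_conv (near_kernel (\<alpha> - 1)) F x)\<^sup>2)"
    using near_bound_principal \<beta>_nonneg by (intro nn_integral_mono power_mono) (auto simp: mult.assoc simp flip: ennreal_mult)
  also have "\<dots> \<le> 2 * ((ennreal \<beta>)\<^sup>2 * (\<integral>\<^sup>+x. (ennreal (weight \<beta> x * norm (localized_difference \<alpha> u x)))\<^sup>2))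
      + 2 * (?c\<^sup>2 * (\<integral>\<^sup>+x. (nn_conv (near_kernel (\<alpha> - 1)) F x)\<^sup>2))"
    by (rule order_trans[OF nn_integral_square_add]) (simp_all add: nn_integral_square_cmult)
  also have "\<dots> \<le> 2 * ((ennreal \<beta>)\<^sup>2 * (\<integral>\<^sup>+x. (ennreal (weight \<beta> x * norm (localized_difference \<alpha> u x)))\<^sup>2))
      + 2 * (?c\<^sup>2 * ((\<integral>\<^sup>+z. ennreal (near_kernel (\<alpha> - 1) z))\<^sup>2 * F2))"
    by (intro add_left_mono mult_left_mono near_kernel_L2) auto
  finally show ?thesis by (simp add: mult.assoc)
qed

end

section \<open>The principal term at the critical exponent\<close>

text \<open>The symbol of \<open>T\<close> for \<open>\<alpha> = 1\<close>, up to the factor \<open>2 \<i>\<close>.\<close>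

lemma sine_integral_bounded:
  "\<exists>B::real. \<forall>\<xi>. \<bar>LBINT t. indicator {0<..1} t * (t powr (-1) * sin (t * \<xi>))\<bar> \<le> B"
proof -
  obtain B where B: "\<And>T. \<bar>Si T\<bar> \<le> B" using bounded_Si by blast
  have "\<bar>LBINT t. indicator {0<..1} t * (t powr (-1) * sin (t * \<xi>))\<bar> \<le> B" for \<xi>
  proof -
    have "(LBINT t. indicator {0<..1} t * (t powr (-1) * sin (t * \<xi>))) = (LBINT t=0..1. sin (t * \<xi>) / t)"
      unfolding zero_ereal_def one_ereal_def by (subst interval_integral_Ioc)
       (auto simp: set_lebesgue_integral_def powr_minus divide_inverse mult.commute intro!: Bochner_Integration.integral_cong split: split_indicator)
    also have "\<dots> = sgn \<xi> * Si (1 * \<bar>\<xi>\<bar>)"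
      using LBINT_I0c_sin_scale_divide[of 1 \<xi>] by (simp add: one_ereal_def)
    finally have "\<bar>LBINT t. indicator {0<..1} t * (t powr (-1) * sin (t * \<xi>))\<bar> = \<bar>sgn \<xi>\<bar> * \<bar>Si \<bar>\<xi>\<bar>\<bar>"
      by (simp only: abs_mult mult_1)
    also have "\<dots> \<le> \<bar>Si \<bar>\<xi>\<bar>\<bar>" by (intro mult_left_le_one_le) (auto simp: abs_sgn_eq)
    finally show ?thesis using B[of "\<bar>\<xi>\<bar>"] by linarith
  qed
  then show ?thesis by blast
qed

text \<open>The symbol of \<open>T\<close> is bounded, so Plancherel's theorem for \<open>f\<close> and for \<open>T f\<close> gives the claim. The relation between
\<open>T f\<close> and its transform \<open>h\<close> is needed in both directions: the difference bound \<open>C t / (1 + x\<^sup>2)\<close> makes \<open>T f\<close> integrable,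
and the transform of \<open>f\<close> is integrable against \<open>1 + \<xi>\<^sup>2\<close>.\<close>

lemma localized_difference_1_L2:
  "\<exists>B\<ge>0. \<forall>f. decaying 4 f \<longrightarrow>
    (\<integral>\<^sup>+x. (ennreal (norm (localized_difference 1 f x)))\<^sup>2) \<le> ennreal B * (\<integral>\<^sup>+x. (ennreal (norm (f x)))\<^sup>2)"
proof -
  define S where "S \<xi> = (LBINT t. indicator {0<..1} t * (t powr (-1) * sin (t * \<xi>)))" for \<xi> :: real
  obtain B where B: "\<And>\<xi>. \<bar>S \<xi>\<bar> \<le> B" using sine_integral_bounded unfolding S_def by blast
  have "(\<integral>\<^sup>+x. (ennreal (norm (localized_difference 1 f x)))\<^sup>2) \<le> ennreal ((2 * B)\<^sup>2) * (\<integral>\<^sup>+x. (ennreal (norm (f x)))\<^sup>2)"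
    if f: "decaying 4 f" for f
  proof -
    let ?F = "fourier_transform f" and ?p = "of_real (1 / (2 * pi)) :: complex"
    let ?w = "\<lambda>t. indicator {0<..1} t * t powr (-1) :: real"
    define h where "h \<xi> = of_real (S \<xi>) * (2 * \<i> * ?F \<xi>)" for \<xi>
    let ?g = "localized_difference 1 f"
    have q: "quadratic_decay f" using f by (rule decaying_imp_quadratic_decay)
    have fi: "integrable lborel f" using q by (rule quadratic_decay_integrable)
    have Fi: "integrable lborel ?F" using f by (rule decaying_inversion(2))
    have [measurable]: "f \<in> borel_measurable borel" "?F \<in> borel_measurable borel"
      using fi Fi by auto
    have [measurable]: "S \<in> borel_measurable borel" unfolding S_def[abs_def] by measurable
    have S2: "of_real (S \<xi>) * z = (LBINT t. of_real (?w t * sin (t * \<xi>)) * z)" for \<xi> and z :: complex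
      unfolding S_def integral_complex_of_real[symmetric] integral_mult_left_zero[symmetric] by (simp only: mult.assoc)
    have hb: "norm (h \<xi>) \<le> 2 * B * norm (?F \<xi>)" for \<xi>
      using mult_right_mono[OF B[of \<xi>], of "2 * norm (?F \<xi>)"] by (simp add: h_def norm_mult)
    have hi: "integrable lborel h"
      by (rule Bochner_Integration.integrable_bound[OF integrable_mult_right[OF integrable_norm[OF Fi], of "2 * B"]])
         (use hb order_trans[OF hb abs_ge_self] in \<open>auto simp: h_def[abs_def] intro!: AE_I2\<close>)
    have ind: "integrable lborel (\<lambda>t. c * indicator {0<..1::real} t)" for c :: real
      by (intro integrable_mult_right) (simp add: integrable_indicator_iff)
    have diff: "f (x + t) - f (x - t) = ?p * (LBINT \<xi>. cis (x * \<xi>) * (of_real (sin (t * \<xi>)) * (2 * \<i> * ?F \<xi>)))" for x t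
    proof -
      have ii: "integrable lborel (\<lambda>\<xi>. cis (y * \<xi>) * ?F \<xi>)" for y by (intro integrable_cis_mult Fi) simp
      have "f (x + t) - f (x - t) = ?p * ((LBINT \<xi>. cis ((x + t) * \<xi>) * ?F \<xi>) - (LBINT \<xi>. cis ((x - t) * \<xi>) * ?F \<xi>))"
        using decaying_inversion(1)[OF f, of "x + t"] decaying_inversion(1)[OF f, of "x - t"]
        by (simp only: right_diff_distrib)
      also have "(LBINT \<xi>. cis ((x + t) * \<xi>) * ?F \<xi>) - (LBINT \<xi>. cis ((x - t) * \<xi>) * ?F \<xi>)
        = (LBINT \<xi>. cis ((x + t) * \<xi>) * ?F \<xi> - cis ((x - t) * \<xi>) * ?F \<xi>)"
        by (rule Bochner_Integration.integral_diff[symmetric]) (rule ii)+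
      also have "\<dots> = (LBINT \<xi>. cis (x * \<xi>) * (of_real (sin (t * \<xi>)) * (2 * \<i> * ?F \<xi>)))"
      proof (rule Bochner_Integration.integral_cong[OF refl])
        fix \<xi>
        have "cis ((x + t) * \<xi>) - cis ((x - t) * \<xi>) = cis (x * \<xi>) * (of_real (sin (t * \<xi>)) * (2 * \<i>))"
          by (simp add: complex_eq_iff distrib_right left_diff_distrib cos_add cos_diff sin_add sin_diff)
        then show "cis ((x + t) * \<xi>) * ?F \<xi> - cis ((x - t) * \<xi>) * ?F \<xi> = cis (x * \<xi>) * (of_real (sin (t * \<xi>)) * (2 * \<i> * ?F \<xi>))"
          by (simp only: left_diff_distrib[symmetric] mult.assoc)
      qed
      finally show ?thesis .
    qed
    have gh: "?g x = ?p * (LBINT \<xi>. cis (x * \<xi>) * h \<xi>)" for x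
    proof -
      let ?G = "\<lambda>t \<xi>. of_real (?w t) * (cis (x * \<xi>) * (of_real (sin (t * \<xi>)) * (2 * \<i> * ?F \<xi>)))"
      have "?g x = (LBINT t. ?p * (LBINT \<xi>. ?G t \<xi>))"
        unfolding localized_difference_def diff
        by (rule Bochner_Integration.integral_cong[OF refl], subst integral_mult_right_zero, rule mult.left_commute)
      also have "\<dots> = ?p * (LBINT t. LBINT \<xi>. ?G t \<xi>)" by (rule integral_mult_right_zero)
      also have "(LBINT t. LBINT \<xi>. ?G t \<xi>) = (LBINT \<xi>. LBINT t. ?G t \<xi>)"
      proof (rule fubini_product_bound(2)[OF _ ind[of 2] integrable_norm[OF decaying_fourier_integrable[OF f]]])
        show "case_prod ?G \<in> borel_measurable (borel \<Otimes>\<^sub>M borel)" by measurable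
        show "norm (?G t \<xi>) \<le> 2 * indicator {0<..1} t * norm ((1 + \<xi>\<^sup>2) *\<^sub>R ?F \<xi>)" for t \<xi>
        proof (cases "0 < t \<and> t \<le> 1")
          case True
          have "\<bar>sin (t * \<xi>)\<bar> \<le> t * \<bar>\<xi>\<bar>" using abs_sin_x_le_abs_x[of "t * \<xi>"] True by (simp add: abs_mult)
          also have "\<dots> \<le> t * (1 + \<xi>\<^sup>2)" using True abs_le_one_plus_square by (intro mult_left_mono) auto
          finally have "inverse t * \<bar>sin (t * \<xi>)\<bar> \<le> inverse t * (t * (1 + \<xi>\<^sup>2))" using True by (intro mult_left_mono) auto
          also have "\<dots> = 1 + \<xi>\<^sup>2" using True by simp
          finally have "inverse t * \<bar>sin (t * \<xi>)\<bar> * (2 * norm (?F \<xi>)) \<le> (1 + \<xi>\<^sup>2) * (2 * norm (?F \<xi>))"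
            by (rule mult_right_mono) simp
          then show ?thesis using True by (simp add: norm_mult norm_inverse powr_minus mult_ac)
        qed auto
      qed
      also have "\<dots> = (LBINT \<xi>. cis (x * \<xi>) * h \<xi>)"
      proof (rule Bochner_Integration.integral_cong[OF refl])
        fix \<xi>
        have "cis (x * \<xi>) * h \<xi> = (LBINT t. cis (x * \<xi>) * (of_real (?w t * sin (t * \<xi>)) * (2 * \<i> * ?F \<xi>)))"
          unfolding h_def S2 by (rule integral_mult_right_zero[symmetric])
        then show "(LBINT t. ?G t \<xi>) = cis (x * \<xi>) * h \<xi>" by (simp only: of_real_mult mult_ac)
      qed
      finally show ?thesis .
    qed
    obtain C where C: "C > 0" "\<And>x t. 0 \<le> t \<Longrightarrow> t \<le> 1 \<Longrightarrow> norm (f (x + t) - f (x - t)) \<le> C * t / (1 + x\<^sup>2)"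
      using decaying_difference_bound[OF decaying_mono[OF f, of "Suc 0"]] by auto
    let ?H = "\<lambda>\<xi> x t. of_real (?w t) * (cis (- (x * \<xi>)) * (f (x + t) - f (x - t)))"
    have Hm: "case_prod (?H \<xi>) \<in> borel_measurable (borel \<Otimes>\<^sub>M borel)" for \<xi> by measurable
    have Hle: "norm (?H \<xi> x t) \<le> 1 / (1 + x\<^sup>2) * (C * indicator {0<..1} t)" for \<xi> x t
    proof (cases "0 < t \<and> t \<le> 1")
      case True
      then have "inverse t * norm (f (x + t) - f (x - t)) \<le> inverse t * (C * t / (1 + x\<^sup>2))" by (intro mult_left_mono C) auto
      also have "\<dots> = C / (1 + x\<^sup>2)" using True by (simp add: divide_simps)
      finally show ?thesis using True by (simp add: norm_mult norm_inverse powr_minus)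
    qed auto
    note Hf = fubini_product_bound[OF Hm integrable_rational[of 1] ind[of C] Hle]
    have Hx: "(LBINT t. ?H \<xi> x t) = cis (- (x * \<xi>)) * ?g x" for \<xi> x
      unfolding localized_difference_def integral_mult_right_zero[symmetric] by (simp only: mult.left_commute)
    have gi: "integrable lborel ?g"
      using Hf(3)[of 0] unfolding Hx by simp
    have hg: "h \<xi> = (LBINT x. cis (- (x * \<xi>)) * ?g x)" for \<xi>
    proof -
      have tr: "(LBINT x. cis (- (x * \<xi>)) * f (x + t)) = cis (t * \<xi>) * ?F \<xi>" for t
      proof -
        have "?F \<xi> = \<bar>1\<bar> *\<^sub>R (LBINT x. cis (- ((t + 1 * x) * \<xi>)) * f (t + 1 * x))"
          unfolding fourier_transform_cis by (rule lborel_integral_real_affine) simp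
        then have "cis (t * \<xi>) * ?F \<xi> = (LBINT x. cis (t * \<xi>) * (cis (- ((t + x) * \<xi>)) * f (t + x)))" by simp
        also have "\<dots> = (LBINT x. cis (- (x * \<xi>)) * f (x + t))"
          by (simp only: mult.assoc[symmetric] cis_mult) (simp add: algebra_simps)
        finally show ?thesis ..
      qed
      have tri: "integrable lborel (\<lambda>x. cis (- (x * \<xi>)) * f (x + t))" for t
        using lborel_integrable_real_affine[OF fi, of 1 t] by (intro integrable_cis_mult) (simp_all add: add.commute)
      have "(LBINT x. cis (- (x * \<xi>)) * ?g x) = (LBINT x. LBINT t. ?H \<xi> x t)" unfolding Hx ..
      also have "\<dots> = (LBINT t. LBINT x. ?H \<xi> x t)" by (rule Hf(2))
      also have "\<dots> = (LBINT t. of_real (?w t * sin (t * \<xi>)) * (2 * \<i> * ?F \<xi>))"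
      proof (rule Bochner_Integration.integral_cong[OF refl])
        fix t
        have "(LBINT x. ?H \<xi> x t) = of_real (?w t) * (LBINT x. cis (- (x * \<xi>)) * f (x + t) - cis (- (x * \<xi>)) * f (x + - t))"
          unfolding integral_mult_right_zero by (simp only: right_diff_distrib add_uminus_conv_diff)
        also have "\<dots> = of_real (?w t) * (cis (t * \<xi>) * ?F \<xi> - cis (- t * \<xi>) * ?F \<xi>)"
          by (subst Bochner_Integration.integral_diff[OF tri tri]) (simp only: tr)
        also have "cis (t * \<xi>) * ?F \<xi> - cis (- t * \<xi>) * ?F \<xi> = of_real (sin (t * \<xi>)) * (2 * \<i> * ?F \<xi>)"
        proof -
          have "cis (t * \<xi>) - cis (- t * \<xi>) = of_real (sin (t * \<xi>)) * (2 * \<i>)" by (simp add: complex_eq_iff)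
          then show ?thesis by (simp only: left_diff_distrib[symmetric] mult.assoc)
        qed
        finally show "(LBINT x. ?H \<xi> x t) = of_real (?w t * sin (t * \<xi>)) * (2 * \<i> * ?F \<xi>)" by (simp only: of_real_mult mult.assoc)
      qed
      also have "\<dots> = h \<xi>" unfolding h_def S2 ..
      finally show ?thesis ..
    qed
    have B0: "0 \<le> B" using B[of 0] by linarith
    have "(\<integral>\<^sup>+x. (ennreal (norm (?g x)))\<^sup>2) = ennreal (1 / (2 * pi)) * (\<integral>\<^sup>+\<xi>. (ennreal (norm (h \<xi>)))\<^sup>2)"
      by (rule plancherel[OF gi hi gh hg])
    also have "\<dots> \<le> ennreal (1 / (2 * pi)) * (\<integral>\<^sup>+\<xi>. (ennreal (2 * B) * ennreal (norm (?F \<xi>)))\<^sup>2)"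
      using hb B0 by (intro mult_left_mono nn_integral_mono power_mono) (auto simp flip: ennreal_mult intro: ennreal_leI)
    also have "(\<integral>\<^sup>+\<xi>. (ennreal (2 * B) * ennreal (norm (?F \<xi>)))\<^sup>2) = (ennreal (2 * B))\<^sup>2 * (\<integral>\<^sup>+\<xi>. (ennreal (norm (?F \<xi>)))\<^sup>2)"
      by (rule nn_integral_square_cmult) measurable
    also have "ennreal (1 / (2 * pi)) * \<dots> = (ennreal (2 * B))\<^sup>2 * (ennreal (1 / (2 * pi)) * (\<integral>\<^sup>+\<xi>. (ennreal (norm (?F \<xi>)))\<^sup>2))"
      by (rule mult.left_commute)
    also have "ennreal (1 / (2 * pi)) * (\<integral>\<^sup>+\<xi>. (ennreal (norm (?F \<xi>)))\<^sup>2) = (\<integral>\<^sup>+x. (ennreal (norm (f x)))\<^sup>2)"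
      by (rule plancherel[symmetric, OF fi Fi decaying_inversion(1)[OF f] fourier_transform_cis])
    finally show ?thesis using B0 by (simp add: ennreal_power)
  qed
  then show ?thesis by (intro exI[of _ "(2 * B)\<^sup>2"]) auto
qed

context weighted_setting
begin

text \<open>Moving \<open>w\<close> inside \<open>T\<close> replaces \<open>w(x)\<close> by \<open>w(x \<plusminus> t)\<close>. The error is of size \<open>t\<close>, which cancels the factor
\<open>t\<^bsup>-1\<^esup>\<close>.\<close>

lemma weighted_localized_difference_1:
  "ennreal (weight \<beta> x * norm (localized_difference 1 u x))
    \<le> ennreal (norm (localized_difference 1 (\<lambda>y. of_real (weight \<beta> y) * u y) x))
      + ennreal (\<beta> * 2 powr \<beta>) * nn_conv (near_kernel 0) F x"
proof -
  let ?v = "\<lambda>y. of_real (weight \<beta> y) * u y" and ?w = "\<lambda>t. of_real (indicator {0<..1} t * t powr (-1)) :: complex"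
  let ?c = "\<beta> * 2 powr \<beta>"
  let ?E = "\<lambda>t. of_real (weight \<beta> x) * (?w t * (u (x + t) - u (x - t))) - ?w t * (?v (x + t) - ?v (x - t))"
  have v: "decaying 4 ?v" by (intro decaying_mult bounded_derivs_weight \<beta>_nonneg u)
  have i: "integrable lborel (\<lambda>t. ?w t * (u (x + t) - u (x - t)))" "integrable lborel (\<lambda>t. ?w t * (?v (x + t) - ?v (x - t)))"
    using decaying_mono[OF u, of "Suc 0"] decaying_mono[OF v, of "Suc 0"] by (intro localized_difference_integrable; simp)+
  have eq: "of_real (weight \<beta> x) * localized_difference 1 u x = localized_difference 1 ?v x + (LBINT t. ?E t)"
    unfolding localized_difference_def
    by (subst Bochner_Integration.integral_diff[OF integrable_mult_right[OF i(1)] i(2)])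
       (simp only: integral_mult_right_zero add_diff_eq add_diff_cancel_left')
  have E: "ennreal (norm (LBINT t. ?E t)) \<le> nn_conv (\<lambda>z. ?c * near_kernel 0 z) F x"
  proof (rule norm_integral_le_nn_conv)
    fix t :: real assume "t > 0"
    show "norm (?E t) \<le> (?c * near_kernel 0 t) * (F (x + t) + F (x - t))"
    proof (cases "t \<le> 1")
      case True
      have n: "norm (of_real (weight \<beta> x - weight \<beta> y) * u y) \<le> (?c * t) * F y" if y: "\<bar>x - y\<bar> = t" for y
      proof -
        have "\<bar>weight \<beta> x - weight \<beta> y\<bar> \<le> ?c * weight \<beta> y * t"
          using weight_diff_near[OF \<beta>_nonneg(1), of x y] y True by simp
        then have "\<bar>weight \<beta> x - weight \<beta> y\<bar> * norm (u y) \<le> ?c * weight \<beta> y * t * norm (u y)"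
          by (rule mult_right_mono) simp
        then show ?thesis unfolding norm_mult norm_of_real by (simp add: F_def mult_ac)
      qed
      have "?E t = ?w t * (of_real (weight \<beta> x - weight \<beta> (x + t)) * u (x + t) - of_real (weight \<beta> x - weight \<beta> (x - t)) * u (x - t))"
        by (simp only: of_real_diff) algebra
      also have "norm \<dots> \<le> inverse t * ((?c * t) * F (x + t) + (?c * t) * F (x - t))"
        using n[of "x + t"] n[of "x - t"] \<open>t > 0\<close> True unfolding norm_mult[of "?w t"]
        by (intro mult_mono order_trans[OF norm_triangle_ineq4] add_mono) (auto simp: powr_minus norm_inverse)
      also have "\<dots> = (?c * near_kernel 0 t) * (F (x + t) + F (x - t))"
        using \<open>t > 0\<close> True by (simp add: near_kernel_def field_simps)
      finally show ?thesis .
    qed (use \<beta>_nonneg in \<open>auto intro!: mult_nonneg_nonneg add_nonneg_nonneg\<close>)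
  qed (use \<beta>_nonneg in \<open>auto intro!: mult_nonneg_nonneg add_nonneg_nonneg\<close>)
  have "norm (of_real (weight \<beta> x) * localized_difference 1 u x) \<le> norm (localized_difference 1 ?v x) + norm (LBINT t. ?E t)"
    unfolding eq by (rule norm_triangle_ineq)
  then have "ennreal (weight \<beta> x * norm (localized_difference 1 u x)) \<le> ennreal (norm (localized_difference 1 ?v x)) + ennreal (norm (LBINT t. ?E t))"
    by (simp add: norm_mult flip: ennreal_plus)
  also have "\<dots> \<le> ennreal (norm (localized_difference 1 ?v x)) + nn_conv (\<lambda>z. ?c * near_kernel 0 z) F x"
    by (intro add_left_mono E)
  also have "nn_conv (\<lambda>z. ?c * near_kernel 0 z) F x = ennreal ?c * nn_conv (near_kernel 0) F x"
    unfolding nn_conv_def using \<beta>_nonneg by (simp add: mult.assoc ennreal_mult nn_integral_cmult)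
  finally show ?thesis .
qed

lemma weighted_localized_difference_1_L2:
  assumes B: "\<And>f. decaying 4 f \<Longrightarrow>
    (\<integral>\<^sup>+x. (ennreal (norm (localized_difference 1 f x)))\<^sup>2) \<le> ennreal B * (\<integral>\<^sup>+x. (ennreal (norm (f x)))\<^sup>2)"
  shows "(\<integral>\<^sup>+x. (ennreal (weight \<beta> x * norm (localized_difference 1 u x)))\<^sup>2)
    \<le> (2 * ennreal B + 2 * ((ennreal (\<beta> * 2 powr \<beta>))\<^sup>2 * (\<integral>\<^sup>+z. ennreal (near_kernel 0 z))\<^sup>2)) * F2"
proof -
  let ?v = "\<lambda>y. of_real (weight \<beta> y) * u y" and ?c = "ennreal (\<beta> * 2 powr \<beta>)"
  have v: "decaying 4 ?v" by (intro decaying_mult bounded_derivs_weight \<beta>_nonneg u)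
  have "(\<integral>\<^sup>+x. (ennreal (weight \<beta> x * norm (localized_difference 1 u x)))\<^sup>2)
     \<le> (\<integral>\<^sup>+x. (ennreal (norm (localized_difference 1 ?v x)) + ?c * nn_conv (near_kernel 0) F x)\<^sup>2)"
    by (intro nn_integral_mono power_mono weighted_localized_difference_1) auto
  also have "\<dots> \<le> 2 * (\<integral>\<^sup>+x. (ennreal (norm (localized_difference 1 ?v x)))\<^sup>2) + 2 * (?c\<^sup>2 * (\<integral>\<^sup>+x. (nn_conv (near_kernel 0) F x)\<^sup>2))"
    by (rule order_trans[OF nn_integral_square_add]) (simp_all add: nn_integral_square_cmult)
  also have "\<dots> \<le> 2 * (ennreal B * (\<integral>\<^sup>+x. (ennreal (norm (?v x)))\<^sup>2)) + 2 * (?c\<^sup>2 * ((\<integral>\<^sup>+z. ennreal (near_kernel 0 z))\<^sup>2 * F2))"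
    by (intro add_mono mult_left_mono near_kernel_L2 B v) auto
  also have "(\<integral>\<^sup>+x. (ennreal (norm (?v x)))\<^sup>2) = F2"
    by (simp add: F_def norm_mult)
  finally show ?thesis by (simp only: distrib_right mult.assoc)
qed

end

section \<open>Convolution kernels given by their symbols\<close>

text \<open>The kernel of the convolution operator that has the given function as its symbol.\<close>

abbreviation kernel :: "(real \<Rightarrow> complex) \<Rightarrow> real \<Rightarrow> complex" where "kernel \<equiv> inverse_fourier_transform"

lemma kernel_measurable [measurable (raw)]:
  assumes [measurable]: "(\<lambda>p. G (fst p) (snd p)) \<in> borel_measurable (M \<Otimes>\<^sub>M borel)" "f \<in> borel_measurable M"
  shows "(\<lambda>x. kernel (G x) (f x)) \<in> borel_measurable M"
proof -
  have [measurable]: "(\<lambda>(x, y). G x y) \<in> borel_measurable (M \<Otimes>\<^sub>M borel)" using assms(1) by (simp add: split_beta')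
  show ?thesis unfolding inverse_fourier_transform_cis by measurable
qed

lemma kernel_eq_fourier_transform: "kernel G z = of_real (1 / (2 * pi)) * fourier_transform G (- z)"
  unfolding inverse_fourier_transform_cis fourier_transform_cis by (simp add: mult.commute)

lemma kernel_cmult: "kernel (\<lambda>\<xi>. c * V \<xi>) x = c * kernel V x"
proof -
  have "(LBINT \<xi>. cis (x * \<xi>) * (c * V \<xi>)) = (LBINT \<xi>. c * (cis (x * \<xi>) * V \<xi>))"
    by (rule Bochner_Integration.integral_cong[OF refl], rule mult.left_commute)
  then show ?thesis unfolding inverse_fourier_transform_cis integral_mult_right_zero by (simp only: mult.left_commute)
qed

lemma kernel_bound:
  assumes "decaying 4 G"
  shows "\<exists>C>0. \<forall>z. norm (kernel G z) \<le> C / (1 + z\<^sup>2)\<^sup>2"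
proof -
  obtain C where C: "C > 0" "\<And>\<xi>. norm (fourier_transform G \<xi>) \<le> C / (1 + \<xi>\<^sup>2)\<^sup>2"
    using fourier_transform_decay4[OF assms] by blast
  have "norm (kernel G z) \<le> C / (1 + z\<^sup>2)\<^sup>2" for z
  proof -
    have "norm (kernel G z) = 1 / (2 * pi) * norm (fourier_transform G (- z))"
      unfolding kernel_eq_fourier_transform norm_mult norm_of_real by simp
    also have "\<dots> \<le> 1 * norm (fourier_transform G (- z))" using pi_gt3 by (intro mult_right_mono) auto
    finally show ?thesis using C(2)[of "- z"] by simp
  qed
  with C(1) show ?thesis by blast
qed

lemma kernel_integrable:
  assumes "decaying 4 G" shows "integrable lborel (kernel G)"
proof -
  have "integrable lborel (\<lambda>z. of_real (1 / (2 * pi)) * fourier_transform G (0 + (- 1) * z))"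
    by (intro integrable_mult_right lborel_integrable_real_affine decaying_inversion(2) assms) simp
  then show ?thesis by (simp add: kernel_eq_fourier_transform[abs_def])
qed

lemma fourier_transform_kernel:
  assumes "decaying 4 G" shows "fourier_transform (kernel G) \<xi> = G \<xi>"
proof -
  have "fourier_transform (kernel G) \<xi> = (LBINT z. of_real (1 / (2 * pi)) * (cis (- (z * \<xi>)) * fourier_transform G (- z)))"
    unfolding fourier_transform_cis[of "kernel G"] kernel_eq_fourier_transform by (simp only: mult.left_commute)
  also have "\<dots> = of_real (1 / (2 * pi)) * (LBINT z. cis (- (z * \<xi>)) * fourier_transform G (- z))"
    by (rule integral_mult_right_zero)
  also have "(LBINT z. cis (- (z * \<xi>)) * fourier_transform G (- z)) = (LBINT z. cis (\<xi> * z) * fourier_transform G z)"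
    by (subst (2) lborel_integral_real_affine[of "-1" _ 0]) (simp_all add: mult.commute)
  finally show ?thesis using decaying_inversion(1)[OF assms, of \<xi>] by simp
qed

lemma kernel_convolution:
  assumes G: "decaying 4 G" and V: "integrable lborel V"
  shows "(LBINT z. kernel G z * kernel V (x - z)) = kernel (\<lambda>\<xi>. G \<xi> * V \<xi>) x"
proof -
  have [measurable]: "V \<in> borel_measurable borel" "kernel G \<in> borel_measurable borel"
    using V kernel_integrable[OF G] by auto
  let ?p = "of_real (1 / (2 * pi)) :: complex"
  let ?H = "\<lambda>z \<xi>. kernel G z * (cis ((x - z) * \<xi>) * V \<xi>)"
  have "(LBINT z. kernel G z * kernel V (x - z)) = (LBINT z. ?p * (LBINT \<xi>. ?H z \<xi>))"
    unfolding inverse_fourier_transform_cis[of V]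
    by (rule Bochner_Integration.integral_cong[OF refl], subst integral_mult_right_zero, rule mult.left_commute)
  also have "\<dots> = ?p * (LBINT z. LBINT \<xi>. ?H z \<xi>)" by (rule integral_mult_right_zero)
  also have "(LBINT z. LBINT \<xi>. ?H z \<xi>) = (LBINT \<xi>. LBINT z. ?H z \<xi>)"
    by (rule fubini_product_bound(2)[OF _ integrable_norm[OF kernel_integrable[OF G]] integrable_norm[OF V]]) (auto simp: norm_mult)
  also have "\<dots> = (LBINT \<xi>. cis (x * \<xi>) * (G \<xi> * V \<xi>))"
  proof (rule Bochner_Integration.integral_cong[OF refl])
    fix \<xi>
    have "?H z \<xi> = cis (- (z * \<xi>)) * kernel G z * (cis (x * \<xi>) * V \<xi>)" for z
    proof -
      have "cis ((x - z) * \<xi>) = cis (- (z * \<xi>)) * cis (x * \<xi>)" by (simp add: cis_mult algebra_simps)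
      then show ?thesis by (simp only: mult_ac)
    qed
    then have "(LBINT z. ?H z \<xi>) = fourier_transform (kernel G) \<xi> * (cis (x * \<xi>) * V \<xi>)"
      unfolding fourier_transform_cis[of "kernel G"] by (simp only: integral_mult_left_zero)
    then show "(LBINT z. ?H z \<xi>) = cis (x * \<xi>) * (G \<xi> * V \<xi>)"
      unfolding fourier_transform_kernel[OF G] by (simp only: mult_ac)
  qed
  finally show ?thesis unfolding inverse_fourier_transform_cis[of "\<lambda>\<xi>. G \<xi> * V \<xi>"] .
qed

lemma kernel_norm_bound: "integrable lborel V \<Longrightarrow> norm (kernel V x) \<le> (LBINT \<xi>. norm (V \<xi>))"
proof -
  have "norm (kernel V x) = 1 / (2 * pi) * norm (fourier_transform V (- x))"
    unfolding kernel_eq_fourier_transform norm_mult norm_of_real by simp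
  also have "\<dots> \<le> 1 * norm (fourier_transform V (- x))" using pi_gt3 by (intro mult_right_mono) auto
  finally show ?thesis using fourier_transform_bound[of V "- x"] by simp
qed

text \<open>A symmetric difference of a convolution falls on the kernel.\<close>

lemma kernel_convolution_difference:
  assumes G: "decaying 4 G" and V: "integrable lborel V"
  shows "kernel (\<lambda>\<xi>. G \<xi> * V \<xi>) (x + t) - kernel (\<lambda>\<xi>. G \<xi> * V \<xi>) (x - t)
    = (LBINT z. (kernel G (z + t) - kernel G (z - t)) * kernel V (x - z))"
proof -
  have [measurable]: "V \<in> borel_measurable borel" using V by auto
  have sh: "kernel (\<lambda>\<xi>. G \<xi> * V \<xi>) (x + t) = (LBINT z. kernel G (z + t) * kernel V (x - z))" for t
    unfolding kernel_convolution[OF G V, symmetric] by (subst lborel_integral_real_affine[of 1 _ t]) (simp_all add: algebra_simps)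
  have i: "integrable lborel (\<lambda>z. kernel G (z + t) * kernel V (x - z))" for t
  proof (rule Bochner_Integration.integrable_bound)
    show "integrable lborel (\<lambda>z. (LBINT \<xi>. norm (V \<xi>)) *\<^sub>R kernel G (t + 1 * z))"
      by (intro integrable_scaleR_right lborel_integrable_real_affine kernel_integrable G) simp
    have [measurable]: "kernel G \<in> borel_measurable borel" using kernel_integrable[OF G] by auto
    show "(\<lambda>z. kernel G (z + t) * kernel V (x - z)) \<in> borel_measurable lborel" by measurable
    show "AE z in lborel. norm (kernel G (z + t) * kernel V (x - z)) \<le> norm ((LBINT \<xi>. norm (V \<xi>)) *\<^sub>R kernel G (t + 1 * z))"
    proof (rule AE_I2)
      fix z
      have "norm (kernel V (x - z)) * norm (kernel G (t + z)) \<le> \<bar>LBINT \<xi>. norm (V \<xi>)\<bar> * norm (kernel G (t + z))"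
        by (intro mult_right_mono order_trans[OF kernel_norm_bound[OF V] abs_ge_self]) simp
      then show "norm (kernel G (z + t) * kernel V (x - z)) \<le> norm ((LBINT \<xi>. norm (V \<xi>)) *\<^sub>R kernel G (t + 1 * z))"
        by (simp add: norm_mult add.commute mult.commute)
    qed
  qed
  have "kernel (\<lambda>\<xi>. G \<xi> * V \<xi>) (x + t) - kernel (\<lambda>\<xi>. G \<xi> * V \<xi>) (x + - t) = (LBINT z. kernel G (z + t) * kernel V (x - z) - kernel G (z + - t) * kernel V (x - z))"
    unfolding sh by (rule Bochner_Integration.integral_diff[symmetric]) (rule i)+
  then show ?thesis by (simp only: left_diff_distrib add_uminus_conv_diff)
qed

text \<open>The derivative of the kernel of \<open>G\<close> is the kernel of \<open>\<i> \<xi> G(\<xi>)\<close>.\<close>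

lemma kernel_difference_integral:
  assumes G1: "integrable lborel G1" and eq: "\<And>\<xi>. G1 \<xi> = \<i> * of_real \<xi> * G \<xi>" and G: "integrable lborel G" and t: "0 \<le> t"
  shows "kernel G (z + t) - kernel G (z - t) = (LBINT \<tau>. indicator {-t..t} \<tau> *\<^sub>R kernel G1 (z + \<tau>))"
proof -
  let ?p = "of_real (1 / (2 * pi)) :: complex"
  have [measurable]: "G1 \<in> borel_measurable borel" using G1 by auto
  let ?H = "\<lambda>\<tau> \<xi>. indicator {-t..t} \<tau> *\<^sub>R (cis ((z + \<tau>) * \<xi>) * G1 \<xi>)"
  have "(LBINT \<tau>. indicator {-t..t} \<tau> *\<^sub>R kernel G1 (z + \<tau>)) = (LBINT \<tau>. ?p * (LBINT \<xi>. ?H \<tau> \<xi>))"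
    unfolding inverse_fourier_transform_cis by simp
  also have "\<dots> = ?p * (LBINT \<tau>. LBINT \<xi>. ?H \<tau> \<xi>)" by (rule integral_mult_right_zero)
  also have "(LBINT \<tau>. LBINT \<xi>. ?H \<tau> \<xi>) = (LBINT \<xi>. LBINT \<tau>. ?H \<tau> \<xi>)"
  proof (rule fubini_product_bound(2)[OF _ _ integrable_norm[OF G1]])
    show "integrable lborel (indicator {-t..t} :: real \<Rightarrow> real)" by (simp add: integrable_indicator_iff emeasure_lborel_Icc_eq)
    show "norm (?H \<tau> \<xi>) \<le> indicator {-t..t} \<tau> * norm (G1 \<xi>)" for \<tau> \<xi> by (simp add: norm_mult)
  qed measurable
  also have "\<dots> = (LBINT \<xi>. cis ((z + t) * \<xi>) * G \<xi> - cis ((z - t) * \<xi>) * G \<xi>)"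
  proof (rule Bochner_Integration.integral_cong[OF refl])
    fix \<xi>
    have d: "((\<lambda>\<tau>. cis ((z + \<tau>) * \<xi>) * G \<xi>) has_vector_derivative cis ((z + \<tau>) * \<xi>) * G1 \<xi>) (at \<tau>)" for \<tau>
    proof -
      have "((\<lambda>y. exp (\<i> * ((of_real z + y) * of_real \<xi>)) * G \<xi>) has_field_derivative \<i> * of_real \<xi> * exp (\<i> * ((of_real z + of_real \<tau>) * of_real \<xi>)) * G \<xi>) (at (of_real \<tau>))"
        by (rule derivative_eq_intros refl | simp)+
      from has_vector_derivative_real_field[OF this] show ?thesis by (simp add: cis_conv_exp eq mult_ac)
    qed
    have "(LBINT \<tau>. ?H \<tau> \<xi>) = cis ((z + t) * \<xi>) * G \<xi> - cis ((z + - t) * \<xi>) * G \<xi>"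
    proof (rule integral_FTC_atLeastAtMost)
      show "- t \<le> t" using t by simp
      show "((\<lambda>\<tau>. cis ((z + \<tau>) * \<xi>) * G \<xi>) has_vector_derivative cis ((z + \<tau>) * \<xi>) * G1 \<xi>) (at \<tau> within {- t..t})" for \<tau>
        using d by (rule has_vector_derivative_at_within)
      show "continuous_on {- t..t} (\<lambda>\<tau>. cis ((z + \<tau>) * \<xi>) * G1 \<xi>)"
        by (intro continuous_intros continuous_on_cis)
    qed
    then show "(LBINT \<tau>. ?H \<tau> \<xi>) = cis ((z + t) * \<xi>) * G \<xi> - cis ((z - t) * \<xi>) * G \<xi>" by simp
  qed
  also have "\<dots> = (LBINT \<xi>. cis ((z + t) * \<xi>) * G \<xi>) - (LBINT \<xi>. cis ((z - t) * \<xi>) * G \<xi>)"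
    by (intro Bochner_Integration.integral_diff integrable_cis_mult G) simp_all
  finally show ?thesis unfolding inverse_fourier_transform_cis by (simp only: right_diff_distrib)
qed

lemma kernel_dilation:
  assumes "\<rho> > 0"
  shows "kernel (\<lambda>\<xi>. G (\<rho> * \<xi>)) z = of_real (1 / \<rho>) * kernel G (z / \<rho>)"
proof -
  have "kernel G (z / \<rho>) = of_real (1 / (2 * pi)) * (\<bar>\<rho>\<bar> *\<^sub>R (LBINT \<xi>. cis (z / \<rho> * (0 + \<rho> * \<xi>)) * G (0 + \<rho> * \<xi>)))"
    unfolding inverse_fourier_transform_cis using assms by (subst lborel_integral_real_affine[of \<rho> _ 0]) auto
  then show ?thesis using assms unfolding inverse_fourier_transform_cis by (simp add: scaleR_conv_of_real)
qed

text \<open>The kernel of \<open>G(\<rho> \<xi>)\<close> is the kernel of \<open>G\<close> squeezed to width \<open>\<rho>\<close>, which for \<open>\<rho> \<le> 1\<close> does not increase moments. The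
decay \<open>(1 + z\<^sup>2)\<^bsup>-2\<^esup>\<close> of the kernel leaves the integrable \<open>1 / (1 + z\<^sup>2)\<close> after multiplication by the factor
\<open>japanese \<beta> z \<le> 1 + z\<^sup>2\<close>.\<close>

lemma dilated_kernel_weighted_bound:
  assumes G: "decaying 4 G" and \<beta>: "0 \<le> \<beta>" "\<beta> \<le> 2"
  shows "\<exists>C\<ge>0. \<forall>\<rho>. 0 < \<rho> \<longrightarrow> \<rho> \<le> 1 \<longrightarrow> (moment \<beta> (\<lambda>z. ennreal (norm (kernel (\<lambda>\<xi>. G (\<rho> * \<xi>)) z)))) \<le> ennreal C"
proof -
  obtain C where C: "C > 0" "\<And>z. norm (kernel G z) \<le> C / (1 + z\<^sup>2)\<^sup>2" using kernel_bound[OF G] by blast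
  have [measurable]: "kernel G \<in> borel_measurable borel" using kernel_integrable[OF G] by auto
  define I where "I = (LBINT z. C / (1 + z\<^sup>2))"
  have I: "(\<integral>\<^sup>+z. ennreal (C / (1 + z\<^sup>2))) = ennreal I"
    unfolding I_def by (rule nn_integral_eq_integral[OF integrable_rational]) (use C(1) in auto)
  have "moment \<beta> (\<lambda>z. ennreal (norm (kernel (\<lambda>\<xi>. G (\<rho> * \<xi>)) z))) \<le> ennreal I"
    if \<rho>: "0 < \<rho>" "\<rho> \<le> 1" for \<rho>
  proof -
    have "moment \<beta> (\<lambda>z. ennreal (norm (kernel (\<lambda>\<xi>. G (\<rho> * \<xi>)) z)))
       = (\<integral>\<^sup>+z. ennreal (1 / \<rho> * norm (kernel G (z / \<rho>)) * japanese \<beta> z))"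
      unfolding kernel_dilation[OF \<rho>(1)] using \<rho> by (simp add: norm_mult norm_divide ennreal_mult[symmetric])
    also have "\<dots> = \<bar>\<rho>\<bar> * (\<integral>\<^sup>+z. ennreal (1 / \<rho> * norm (kernel G ((0 + \<rho> * z) / \<rho>)) * japanese \<beta> (0 + \<rho> * z)))"
      by (rule nn_integral_real_affine) (use \<rho> in auto)
    also have "\<dots> = (\<integral>\<^sup>+z. ennreal (norm (kernel G z) * japanese \<beta> (\<rho> * z)))"
      using \<rho> by (subst nn_integral_cmult[symmetric]) (auto simp flip: ennreal_mult)
    also have "\<dots> \<le> (\<integral>\<^sup>+z. ennreal (C / (1 + z\<^sup>2)))"
    proof (intro nn_integral_mono ennreal_leI)
      fix z :: real
      have "(\<rho> * z)\<^sup>2 \<le> z\<^sup>2" using \<rho> by (simp add: power_mult_distrib mult_left_le_one_le power_le_one)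
      then have "japanese \<beta> (\<rho> * z) \<le> (1 + z\<^sup>2) powr (\<beta> / 2)"
        unfolding japanese_def using \<beta> by (intro powr_mono2) auto
      also have "\<dots> \<le> (1 + z\<^sup>2) powr 1" using \<beta> by (intro powr_mono) auto
      finally have "norm (kernel G z) * japanese \<beta> (\<rho> * z) \<le> C / (1 + z\<^sup>2)\<^sup>2 * (1 + z\<^sup>2)"
        using C by (intro mult_mono) (auto simp: less_imp_le)
      also have "\<dots> = C / (1 + z\<^sup>2)" by (simp add: power2_eq_square)
      finally show "norm (kernel G z) * japanese \<beta> (\<rho> * z) \<le> C / (1 + z\<^sup>2)" .
    qed
    finally show ?thesis unfolding I .
  qed
  moreover have "0 \<le> I" unfolding I_def using C(1) by (intro Bochner_Integration.integral_nonneg) auto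
  ultimately show ?thesis by blast
qed

text \<open>The bound by 1 estimates both translates separately. The bound by \<open>t / \<rho>\<close> writes the difference as an integral over
translates of the derivative, whose moment is of order \<open>1 / \<rho>\<close>.\<close>

lemma difference_kernel_bound:
  assumes G: "decaying 4 G" and G1: "decaying 4 G1" and eq: "\<And>\<xi>. G1 \<xi> = \<i> * of_real \<xi> * G \<xi>" and \<beta>: "0 \<le> \<beta>" "\<beta> \<le> 2"
  shows "\<exists>C\<ge>0. \<forall>\<rho> t. 0 < \<rho> \<longrightarrow> \<rho> \<le> 1 \<longrightarrow> 0 < t \<longrightarrow> t \<le> 1 \<longrightarrow>
     (moment \<beta> (\<lambda>z. ennreal (norm (kernel (\<lambda>\<xi>. G (\<rho> * \<xi>)) (z + t) - kernel (\<lambda>\<xi>. G (\<rho> * \<xi>)) (z - t)))))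
       \<le> ennreal (C * min 1 (t / \<rho>))"
proof -
  obtain A where A: "0 \<le> A" "\<And>\<rho>. 0 < \<rho> \<Longrightarrow> \<rho> \<le> 1 \<Longrightarrow> (moment \<beta> (\<lambda>z. ennreal (norm (kernel (\<lambda>\<xi>. G (\<rho> * \<xi>)) z)))) \<le> ennreal A"
    using dilated_kernel_weighted_bound[OF G \<beta>] by blast
  obtain B where B: "0 \<le> B" "\<And>\<rho>. 0 < \<rho> \<Longrightarrow> \<rho> \<le> 1 \<Longrightarrow> (moment \<beta> (\<lambda>z. ennreal (norm (kernel (\<lambda>\<xi>. G1 (\<rho> * \<xi>)) z)))) \<le> ennreal B"
    using dilated_kernel_weighted_bound[OF G1 \<beta>] by blast
  let ?c = "2 powr \<beta>"
  define C where "C = 2 * ?c * (A + B)"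
  have "moment \<beta> (\<lambda>z. ennreal (norm (kernel (\<lambda>\<xi>. G (\<rho> * \<xi>)) (z + t) - kernel (\<lambda>\<xi>. G (\<rho> * \<xi>)) (z - t)))) \<le> ennreal (C * min 1 (t / \<rho>))"
    (is "?I \<le> _") if \<rho>: "0 < \<rho>" "\<rho> \<le> 1" and t: "0 < t" "t \<le> 1" for \<rho> t
  proof -
    let ?G = "\<lambda>\<xi>. G (\<rho> * \<xi>)" and ?G1 = "\<lambda>\<xi>. G1 (\<rho> * \<xi>)"
    have d: "decaying 4 ?G" "decaying 4 ?G1" using G G1 \<rho> by (simp_all add: decaying_dilation)
    have [measurable]: "kernel ?G \<in> borel_measurable borel" "kernel ?G1 \<in> borel_measurable borel" using kernel_integrable[OF d(1)] kernel_integrable[OF d(2)] by auto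
    have tr: "moment \<beta> (\<lambda>z. ennreal (norm (kernel ?G (z + s)))) \<le> ennreal (?c * A)"
      "moment \<beta> (\<lambda>z. ennreal (norm (kernel ?G1 (z + s)))) \<le> ennreal (?c * B)" if "\<bar>s\<bar> \<le> 1" for s
    proof -
      have "moment \<beta> (\<lambda>z. ennreal (norm (kernel ?G (z + s)))) \<le> ennreal ?c * moment \<beta> (\<lambda>z. ennreal (norm (kernel ?G z)))"
        by (rule weighted_translate[of "\<lambda>z. ennreal (norm (kernel ?G z))"]) (use \<beta> that in auto)
      also have "\<dots> \<le> ennreal ?c * ennreal A" by (intro mult_left_mono A \<rho>) simp
      finally show "moment \<beta> (\<lambda>z. ennreal (norm (kernel ?G (z + s)))) \<le> ennreal (?c * A)" using A by (simp add: ennreal_mult)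
      have "moment \<beta> (\<lambda>z. ennreal (norm (kernel ?G1 (z + s)))) \<le> ennreal ?c * moment \<beta> (\<lambda>z. ennreal (norm (kernel ?G1 z)))"
        by (rule weighted_translate[of "\<lambda>z. ennreal (norm (kernel ?G1 z))"]) (use \<beta> that in auto)
      also have "\<dots> \<le> ennreal ?c * ennreal B" by (intro mult_left_mono B \<rho>) simp
      finally show "moment \<beta> (\<lambda>z. ennreal (norm (kernel ?G1 (z + s)))) \<le> ennreal (?c * B)" using B by (simp add: ennreal_mult)
    qed
    have 1: "?I \<le> ennreal C"
    proof -
      have "?I \<le> (\<integral>\<^sup>+z. ennreal (norm (kernel ?G (z + t))) * ennreal (japanese \<beta> z) + ennreal (norm (kernel ?G (z + - t))) * ennreal (japanese \<beta> z))"
      proof (rule nn_integral_mono)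
        fix z
        have "ennreal (norm (kernel ?G (z + t) - kernel ?G (z - t))) \<le> ennreal (norm (kernel ?G (z + t))) + ennreal (norm (kernel ?G (z + - t)))"
          using norm_triangle_ineq4[of "kernel ?G (z + t)" "kernel ?G (z - t)"] by (simp flip: ennreal_plus add: ennreal_leI)
        then show "ennreal (norm (kernel ?G (z + t) - kernel ?G (z - t))) * ennreal (japanese \<beta> z) \<le> ennreal (norm (kernel ?G (z + t))) * ennreal (japanese \<beta> z) + ennreal (norm (kernel ?G (z + - t))) * ennreal (japanese \<beta> z)"
          unfolding distrib_right[symmetric] by (rule mult_right_mono) simp
      qed
      also have "\<dots> = moment \<beta> (\<lambda>z. ennreal (norm (kernel ?G (z + t)))) + moment \<beta> (\<lambda>z. ennreal (norm (kernel ?G (z + - t))))"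
        by (rule nn_integral_add) measurable
      also have "\<dots> \<le> ennreal (?c * A) + ennreal (?c * A)" using t by (intro add_mono tr) auto
      also have "\<dots> = ennreal (?c * A + ?c * A)" by (rule ennreal_plus[symmetric]) (use A in auto)
      also have "\<dots> \<le> ennreal C" unfolding C_def using A(1) B(1) by (intro ennreal_leI) (simp add: distrib_left)
      finally show ?thesis .
    qed
    \<comment> \<open>Here \<open>\<i> \<xi> G(\<rho> \<xi>) = G1(\<rho> \<xi>) / \<rho>\<close>, which accounts for the factor \<open>1 / \<rho>\<close>.\<close>
    have 2: "?I \<le> ennreal (C * (t / \<rho>))"
    proof -
      have "?I \<le> (\<integral>\<^sup>+z. (\<integral>\<^sup>+\<tau>. indicator {-t..t} \<tau> * (ennreal (1 / \<rho>) * (ennreal (norm (kernel ?G1 (z + \<tau>))) * ennreal (japanese \<beta> z)))))"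
      proof (rule nn_integral_mono)
        fix z
        let ?H = "\<lambda>\<xi>. of_real (1 / \<rho>) * ?G1 \<xi>"
        have "kernel ?G (z + t) - kernel ?G (z - t) = (LBINT \<tau>. indicator {-t..t} \<tau> *\<^sub>R kernel ?H (z + \<tau>))"
        proof (rule kernel_difference_integral)
          show "integrable lborel ?H" "integrable lborel ?G"
            by (intro integrable_mult_right quadratic_decay_integrable decaying_imp_quadratic_decay[OF d(1)] decaying_imp_quadratic_decay[OF d(2)])+
          show "?H \<xi> = \<i> * of_real \<xi> * ?G \<xi>" for \<xi> using \<rho> by (simp add: eq)
        qed (use t in simp)
        moreover have "kernel ?H y = of_real (1 / \<rho>) * kernel ?G1 y" for y
          by (rule kernel_cmult)
        ultimately have "ennreal (norm (kernel ?G (z + t) - kernel ?G (z - t))) = ennreal (norm (LBINT \<tau>. indicator {-t..t} \<tau> *\<^sub>R (of_real (1 / \<rho>) * kernel ?G1 (z + \<tau>))))"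
          by simp
        also have "\<dots> \<le> (\<integral>\<^sup>+\<tau>. ennreal (norm (indicator {-t..t} \<tau> *\<^sub>R (of_real (1 / \<rho>) * kernel ?G1 (z + \<tau>)))))"
          by (cases "integrable lborel (\<lambda>\<tau>. indicator {-t..t} \<tau> *\<^sub>R (of_real (1 / \<rho>) * kernel ?G1 (z + \<tau>)))")
             (rule integral_norm_bound_ennreal, simp_all add: not_integrable_integral_eq)
        finally have "ennreal (norm (kernel ?G (z + t) - kernel ?G (z - t))) * ennreal (japanese \<beta> z)
            \<le> (\<integral>\<^sup>+\<tau>. ennreal (norm (indicator {-t..t} \<tau> *\<^sub>R (of_real (1 / \<rho>) * kernel ?G1 (z + \<tau>))))) * ennreal (japanese \<beta> z)"
          by (rule mult_right_mono) simp
        also have "\<dots> = (\<integral>\<^sup>+\<tau>. ennreal (norm (indicator {-t..t} \<tau> *\<^sub>R (of_real (1 / \<rho>) * kernel ?G1 (z + \<tau>)))) * ennreal (japanese \<beta> z))"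
          by (rule nn_integral_multc[symmetric]) measurable
        also have "\<dots> = (\<integral>\<^sup>+\<tau>. indicator {-t..t} \<tau> * (ennreal (1 / \<rho>) * (ennreal (norm (kernel ?G1 (z + \<tau>))) * ennreal (japanese \<beta> z))))"
          using \<rho> by (intro nn_integral_cong) (auto simp: norm_mult norm_divide ennreal_mult[symmetric] split: split_indicator)
        finally show "ennreal (norm (kernel ?G (z + t) - kernel ?G (z - t))) * ennreal (japanese \<beta> z) \<le> \<dots>" .
      qed
      also have "\<dots> = (\<integral>\<^sup>+\<tau>. (\<integral>\<^sup>+z. indicator {-t..t} \<tau> * (ennreal (1 / \<rho>) * (ennreal (norm (kernel ?G1 (z + \<tau>))) * ennreal (japanese \<beta> z)))))"
        by (rule lborel_pair.Fubini') measurable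
      also have "\<dots> \<le> (\<integral>\<^sup>+\<tau>. ennreal (1 / \<rho> * (?c * B)) * indicator {-t..t} \<tau>)"
      proof (rule nn_integral_mono)
        fix \<tau>
        show "(\<integral>\<^sup>+z. indicator {-t..t} \<tau> * (ennreal (1 / \<rho>) * (ennreal (norm (kernel ?G1 (z + \<tau>))) * ennreal (japanese \<beta> z)))) \<le> ennreal (1 / \<rho> * (?c * B)) * indicator {-t..t} \<tau>"
        proof (cases "\<tau> \<in> {-t..t}")
          case True
          then have "\<bar>\<tau>\<bar> \<le> 1" using t by auto
          have "(\<integral>\<^sup>+z. ennreal (1 / \<rho>) * (ennreal (norm (kernel ?G1 (z + \<tau>))) * ennreal (japanese \<beta> z))) = ennreal (1 / \<rho>) * moment \<beta> (\<lambda>z. ennreal (norm (kernel ?G1 (z + \<tau>))))"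
            by (rule nn_integral_cmult) measurable
          also have "\<dots> \<le> ennreal (1 / \<rho>) * ennreal (?c * B)" by (intro mult_left_mono tr \<open>\<bar>\<tau>\<bar> \<le> 1\<close>) simp
          also have "\<dots> = ennreal (1 / \<rho> * (?c * B))" using \<rho> B by (intro ennreal_mult[symmetric]) auto
          finally show ?thesis using True by simp
        qed simp
      qed
      also have "\<dots> = ennreal (1 / \<rho> * (?c * B)) * ennreal (2 * t)"
        using t by (simp add: nn_integral_cmult_indicator)
      also have "\<dots> = ennreal (1 / \<rho> * (?c * B) * (2 * t))" using \<rho> B t by (intro ennreal_mult[symmetric]) auto
      also have "\<dots> \<le> ennreal (C * (t / \<rho>))"
      proof (rule ennreal_leI)
        have "2 * ?c * B * (t / \<rho>) \<le> C * (t / \<rho>)" unfolding C_def using A(1) \<rho> t by (intro mult_right_mono) (auto simp: distrib_left)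
        then show "1 / \<rho> * (?c * B) * (2 * t) \<le> C * (t / \<rho>)" by (simp add: mult_ac)
      qed
      finally show ?thesis .
    qed
    show ?thesis using 1 2 by (simp add: min_def)
  qed
  moreover have "0 \<le> C" unfolding C_def using A(1) B(1) by simp
  ultimately show ?thesis by blast
qed

section \<open>Gaussian symbols\<close>

lemma power_mult_exp_le_fact:
  fixes y :: real assumes "0 \<le> y" shows "y ^ m * exp (- y) \<le> fact m"
proof -
  have "(\<lambda>n. y ^ n /\<^sub>R fact n) sums exp y" by (rule exp_converges)
  then have "y ^ m /\<^sub>R fact m \<le> exp y"
    using sum_le_suminf[of "\<lambda>n. y ^ n /\<^sub>R fact n" "{m}"] assms by (auto simp: sums_iff)
  then have "y ^ m \<le> fact m * exp y" by (simp add: divide_simps mult.commute)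
  then have "y ^ m * exp (- y) \<le> fact m * exp y * exp (- y)" by (intro mult_right_mono) auto
  then show ?thesis by (simp add: exp_minus_inverse mult.assoc)
qed

lemma gaussian_quadratic_decay:
  assumes "continuous_on UNIV p" "\<And>\<xi>. \<bar>p \<xi>\<bar> \<le> 2 + \<xi> ^ (2 * m)"
  shows "quadratic_decay (\<lambda>\<xi>. complex_of_real (p \<xi> * exp (- \<xi>\<^sup>2)))"
proof -
  let ?C = "2 + 2 + fact m + fact (Suc m) :: real"
  have "norm (complex_of_real (p \<xi> * exp (- \<xi>\<^sup>2))) \<le> ?C / (1 + \<xi>\<^sup>2)" for \<xi>
  proof -
    have f: "(\<xi>\<^sup>2) ^ n * exp (- \<xi>\<^sup>2) \<le> fact n" for n by (rule power_mult_exp_le_fact) simp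
    have "\<bar>p \<xi>\<bar> * exp (- \<xi>\<^sup>2) * (1 + \<xi>\<^sup>2) \<le> (2 + (\<xi>\<^sup>2) ^ m) * exp (- \<xi>\<^sup>2) * (1 + \<xi>\<^sup>2)"
      using assms(2)[of \<xi>] by (intro mult_right_mono) (auto simp: power_mult)
    also have "\<dots> = 2 * ((\<xi>\<^sup>2) ^ 0 * exp (- \<xi>\<^sup>2)) + 2 * ((\<xi>\<^sup>2) ^ 1 * exp (- \<xi>\<^sup>2)) + (\<xi>\<^sup>2) ^ m * exp (- \<xi>\<^sup>2) + (\<xi>\<^sup>2) ^ Suc m * exp (- \<xi>\<^sup>2)"
      by (simp add: algebra_simps)
    also have "\<dots> \<le> ?C" using f[of 0, unfolded fact_0] f[of 1, unfolded fact_1] f[of m] f[of "Suc m"] by linarith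
    finally have "\<bar>p \<xi>\<bar> * exp (- \<xi>\<^sup>2) * (1 + \<xi>\<^sup>2) \<le> ?C" .
    then show ?thesis unfolding norm_of_real abs_mult abs_exp_cancel
      using one_plus_square_pos[of \<xi>] by (simp only: pos_le_divide_eq)
  qed
  moreover have "continuous_on UNIV (\<lambda>\<xi>. complex_of_real (p \<xi> * exp (- \<xi>\<^sup>2)))"
    using assms(1) by (intro continuous_intros)
  ultimately show ?thesis unfolding quadratic_decay_def by (intro conjI exI allI)
qed

lemma abs_power_le: "\<bar>\<xi>\<bar> ^ m \<le> 1 + \<xi> ^ (2 * m)" for \<xi> :: real
proof -
  have "(\<bar>\<xi>\<bar> ^ m)\<^sup>2 = \<xi> ^ (2 * m)" by (simp add: power_mult power_even_abs flip: power_mult_distrib) (simp add: power2_eq_square flip: power_mult_distrib)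
  then show ?thesis using abs_le_one_plus_square[of "\<bar>\<xi>\<bar> ^ m"] by simp
qed

lemma gaussian_mult_deriv:
  assumes "(p has_real_derivative d) (at \<xi>)"
  shows "((\<lambda>\<xi>. complex_of_real (p \<xi> * exp (- \<xi>\<^sup>2))) has_vector_derivative complex_of_real ((d - 2 * \<xi> * p \<xi>) * exp (- \<xi>\<^sup>2))) (at \<xi>)"
proof -
  have "((\<lambda>\<xi>. p \<xi> * exp (- \<xi>\<^sup>2)) has_real_derivative (d - 2 * \<xi> * p \<xi>) * exp (- \<xi>\<^sup>2)) (at \<xi>)"
    by (rule derivative_eq_intros assms refl | simp add: algebra_simps)+
  then show ?thesis by (intro has_vector_derivative_of_real) (simp add: has_real_derivative_iff_has_vector_derivative)
qed

definition gauss_power :: "nat \<Rightarrow> real \<Rightarrow> complex" where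
  "gauss_power j \<xi> = of_real (\<xi> ^ j * exp (- \<xi>\<^sup>2))"

lemma decaying_gauss_power: "decaying n (gauss_power j)"
proof (induction n arbitrary: j)
  have q: "quadratic_decay (gauss_power j)" for j
    unfolding gauss_power_def[abs_def]
  proof (rule gaussian_quadratic_decay)
    show "continuous_on UNIV (\<lambda>\<xi>::real. \<xi> ^ j)" by (intro continuous_intros)
    show "\<bar>\<xi> ^ j\<bar> \<le> 2 + \<xi> ^ (2 * j)" for \<xi> :: real using abs_power_le[of \<xi> j] by (simp add: power_abs)
  qed
  { case 0 show ?case using q by simp }
  case (Suc n)
  have "(gauss_power j has_vector_derivative of_real (real j) * gauss_power (j - 1) \<xi> + of_real (-2) * gauss_power (j + 1) \<xi>) (at \<xi>)" for \<xi>
    using gaussian_mult_deriv[OF DERIV_pow[of j \<xi>]] unfolding gauss_power_def[abs_def]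
    by (rule has_vector_derivative_eq_rhs) (simp add: algebra_simps)
  moreover have "decaying n (\<lambda>\<xi>. of_real (real j) * gauss_power (j - 1) \<xi> + of_real (-2) * gauss_power (j + 1) \<xi>)"
    by (intro decaying_add decaying_cmult Suc.IH)
  ultimately show ?case using q unfolding decaying.simps by (intro conjI exI allI)
qed

text \<open>The singular symbol \<open>|\<xi>|\<^bsup>-s\<^esup>\<close>, smoothed by the factor \<open>\<xi>\<^sup>j\<close>: for \<open>0 < s < 1\<close> the product has \<open>j - 1\<close>
derivatives at 0.\<close>

definition sing_power :: "real \<Rightarrow> nat \<Rightarrow> real \<Rightarrow> real" where
  "sing_power s j \<xi> = \<xi> ^ j * \<bar>\<xi>\<bar> powr (- s)"

lemma abs_sing_power: "\<bar>sing_power s j \<xi>\<bar> = \<bar>\<xi>\<bar> powr (real j - s)"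
  if "\<xi> \<noteq> 0 \<or> 0 < j"
proof (cases "\<xi> = 0")
  case False
  then show ?thesis by (simp add: sing_power_def abs_mult power_abs powr_diff powr_realpow powr_minus divide_inverse)
qed (use that in \<open>simp add: sing_power_def\<close>)

lemma sing_power_isCont:
  assumes "0 < s" "s < 1" "0 < j"
  shows "isCont (sing_power s j) \<xi>"
proof (cases "\<xi> = 0")
  case True
  have "((\<lambda>\<xi>. \<bar>\<xi>\<bar> powr (real j - s)) \<longlongrightarrow> 0) (at 0)"
  proof -
    have "isCont (\<lambda>\<xi>::real. \<bar>\<xi>\<bar> powr (real j - s)) 0" using assms by (intro continuous_intros) auto
    then show ?thesis using assms by (simp add: isCont_def)
  qed
  then have "((\<lambda>\<xi>. \<bar>sing_power s j \<xi>\<bar>) \<longlongrightarrow> 0) (at 0)" using assms by (simp add: abs_sing_power)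
  then have "(sing_power s j \<longlongrightarrow> 0) (at 0)" by (simp add: tendsto_rabs_zero_iff)
  then show ?thesis using True by (simp add: isCont_def sing_power_def)
qed (auto simp: sing_power_def[abs_def] intro!: continuous_intros)

lemma sing_power_deriv:
  assumes "0 < s" "s < 1" "1 < j"
  shows "(sing_power s j has_real_derivative (real j - s) * sing_power s (j - 1) \<xi>) (at \<xi>)"
proof -
  consider "\<xi> = 0" | "\<xi> > 0" | "\<xi> < 0" by linarith
  then show ?thesis
  proof cases
    case 1
    have "(sing_power s (j - 1) \<longlongrightarrow> sing_power s (j - 1) 0) (at 0)"
      using sing_power_isCont[of s "j - 1" 0] assms by (simp add: isCont_def)
    then have "(sing_power s (j - 1) \<longlongrightarrow> 0) (at 0)" using assms by (simp add: sing_power_def)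
    moreover have "\<forall>\<^sub>F h in at 0. sing_power s (j - 1) h = (sing_power s j (0 + h) - sing_power s j 0) / h"
    proof (rule eventually_at_filter[THEN iffD2], rule always_eventually, intro allI impI)
      fix h :: real assume "h \<noteq> 0"
      moreover have "h ^ j = h * h ^ (j - 1)" using assms by (cases j) auto
      ultimately show "sing_power s (j - 1) h = (sing_power s j (0 + h) - sing_power s j 0) / h"
        using assms by (simp add: sing_power_def)
    qed
    ultimately have "((\<lambda>h. (sing_power s j (0 + h) - sing_power s j 0) / h) \<longlongrightarrow> 0) (at 0)"
      by (rule Lim_transform_eventually)
    then show ?thesis using 1 assms by (simp add: DERIV_def sing_power_def)
  next
    case 2
    have "((\<lambda>\<xi>. \<xi> powr (real j - s)) has_real_derivative (real j - s) * \<xi> powr (real j - s - 1)) (at \<xi>)"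
      using 2 by (auto intro!: derivative_eq_intros)
    moreover have "\<forall>\<^sub>F y in nhds \<xi>. y powr (real j - s) = sing_power s j y"
      using eventually_nhds_in_open[of "{0<..}" \<xi>] 2
      by (auto elim!: eventually_mono simp: sing_power_def powr_diff powr_realpow powr_minus divide_inverse)
    moreover have "\<xi> powr (real j - s - 1) = sing_power s (j - 1) \<xi>"
    proof -
      have "real j - s - 1 = real (j - 1) - s" using assms by simp
      then show ?thesis using 2 by (simp only: powr_diff powr_realpow) (simp add: sing_power_def powr_minus divide_inverse)
    qed
    ultimately show ?thesis by (simp add: DERIV_cong_ev[OF refl, of "\<lambda>y. y powr (real j - s)"])
  next
    case 3
    have "((\<lambda>\<xi>. (-1) ^ j * (- \<xi>) powr (real j - s)) has_real_derivative (-1) ^ j * (- ((real j - s) * (- \<xi>) powr (real j - s - 1)))) (at \<xi>)"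
      using 3 by (auto intro!: derivative_eq_intros)
    moreover have "\<forall>\<^sub>F y in nhds \<xi>. (-1) ^ j * (- y) powr (real j - s) = sing_power s j y"
      using eventually_nhds_in_open[of "{..<0}" \<xi>] 3
      by (auto elim!: eventually_mono simp: sing_power_def powr_diff powr_realpow powr_minus divide_inverse simp flip: power_mult_distrib)
    moreover have "(-1) ^ j * (- ((real j - s) * (- \<xi>) powr (real j - s - 1))) = (real j - s) * sing_power s (j - 1) \<xi>"
    proof -
      have "real j - s - 1 = real (j - 1) - s" using assms by simp
      moreover have "(-1::real) ^ j = - ((-1) ^ (j - 1))" using assms by (cases j) auto
      ultimately show ?thesis using 3
        by (simp only: powr_diff powr_realpow) (simp add: sing_power_def powr_minus divide_inverse flip: power_mult_distrib)
    qed
    ultimately show ?thesis by (simp add: DERIV_cong_ev[OF refl, of "\<lambda>y. (-1) ^ j * (- y) powr (real j - s)"])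
  qed
qed

definition gauss_sing :: "real \<Rightarrow> nat \<Rightarrow> real \<Rightarrow> complex" where
  "gauss_sing s j \<xi> = of_real (sing_power s j \<xi> * exp (- \<xi>\<^sup>2))"

text \<open>Differentiation lowers the power \<open>j\<close> by one and multiplication by \<open>\<xi>\<close> raises it, so the family is closed under
differentiation as long as \<open>j > 1\<close>.\<close>

lemma decaying_gauss_sing:
  assumes s: "0 < s" "s < 1"
  shows "n < j \<Longrightarrow> decaying n (gauss_sing s j)"
proof (induction n arbitrary: j)
  have q: "quadratic_decay (gauss_sing s j)" if "0 < j" for j
    unfolding gauss_sing_def[abs_def]
  proof (rule gaussian_quadratic_decay)
    show "continuous_on UNIV (sing_power s j)" using sing_power_isCont[OF s that] by (simp add: continuous_at_imp_continuous_on)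
    fix \<xi> :: real
    have "\<bar>sing_power s j \<xi>\<bar> \<le> 1 + \<bar>\<xi>\<bar> ^ j"
    proof (cases "\<bar>\<xi>\<bar> \<le> 1")
      case True
      have "\<bar>\<xi>\<bar> powr (real j - s) \<le> 1" using True that s by (intro powr_le1) auto
      moreover have "\<bar>sing_power s j \<xi>\<bar> = \<bar>\<xi>\<bar> powr (real j - s)" using that by (intro abs_sing_power) simp
      ultimately show ?thesis using zero_le_power[OF abs_ge_zero, of \<xi> j] by linarith
    next
      case False
      then have "\<bar>\<xi>\<bar> powr (- s) \<le> 1" using s powr_mono[of "- s" 0 "\<bar>\<xi>\<bar>"] by (simp split: if_splits)
      then have "\<bar>\<xi>\<bar> ^ j * \<bar>\<xi>\<bar> powr (- s) \<le> \<bar>\<xi>\<bar> ^ j" by (intro mult_left_le) auto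
      then show ?thesis by (simp add: sing_power_def abs_mult power_abs)
    qed
    then show "\<bar>sing_power s j \<xi>\<bar> \<le> 2 + \<xi> ^ (2 * j)" using abs_power_le[of \<xi> j] by linarith
  qed
  { case 0 then show ?case using q by simp }
  case (Suc n)
  have "(gauss_sing s j has_vector_derivative of_real (real j - s) * gauss_sing s (j - 1) \<xi> + of_real (-2) * gauss_sing s (j + 1) \<xi>) (at \<xi>)" for \<xi>
  proof -
    have j: "1 < j" using Suc.prems by simp
    have "((real j - s) * sing_power s (j - 1) \<xi> - 2 * \<xi> * sing_power s j \<xi>) * exp (- \<xi>\<^sup>2)
       = (real j - s) * (sing_power s (j - 1) \<xi> * exp (- \<xi>\<^sup>2)) + (-2) * (sing_power s (j + 1) \<xi> * exp (- \<xi>\<^sup>2))"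
      by (simp add: sing_power_def algebra_simps)
    then have eq: "complex_of_real (((real j - s) * sing_power s (j - 1) \<xi> - 2 * \<xi> * sing_power s j \<xi>) * exp (- \<xi>\<^sup>2))
       = of_real (real j - s) * of_real (sing_power s (j - 1) \<xi> * exp (- \<xi>\<^sup>2)) + of_real (-2) * of_real (sing_power s (j + 1) \<xi> * exp (- \<xi>\<^sup>2))"
      by (simp only: of_real_add of_real_mult)
    show ?thesis
      using gaussian_mult_deriv[OF sing_power_deriv[OF s j, of \<xi>]] unfolding eq gauss_sing_def[abs_def] .
  qed
  moreover have "decaying n (\<lambda>\<xi>. of_real (real j - s) * gauss_sing s (j - 1) \<xi> + of_real (-2) * gauss_sing s (j + 1) \<xi>)"
    using Suc.prems by (intro decaying_add decaying_cmult Suc.IH) auto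
  ultimately show ?case using q[of j] Suc.prems unfolding decaying.simps by (intro conjI exI allI) auto
qed

section \<open>Recovering differences from the fractional derivative\<close>

text \<open>\<open>(1 + R + R\<^sup>2 / 2) exp (- R)\<close> with \<open>R = \<xi>\<^sup>2\<close>. The polynomial is the Taylor polynomial of \<open>exp R\<close>, which makes
\<open>1 - low_symbol\<close> vanish to the sixth order at 0. After division by \<open>|\<xi>|\<^sup>s\<close> with \<open>s < 1\<close> the quotient
still has the four derivatives that make its kernel decay like \<open>(1 + z\<^sup>2)\<^bsup>-2\<^esup>\<close>.\<close>

definition low_symbol :: "real \<Rightarrow> complex" where
  "low_symbol \<xi> = gauss_power 0 \<xi> + gauss_power 2 \<xi> + of_real (1 / 2) * gauss_power 4 \<xi>"

lemma decaying_low_symbol: "decaying n low_symbol" "decaying n (\<lambda>\<xi>. \<i> * of_real \<xi> * low_symbol \<xi>)"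
proof -
  show "decaying n low_symbol" unfolding low_symbol_def[abs_def]
    by (intro decaying_add decaying_cmult decaying_gauss_power)
  have "decaying n (\<lambda>\<xi>. \<i> * (gauss_power 1 \<xi> + gauss_power 3 \<xi> + of_real (1 / 2) * gauss_power 5 \<xi>))"
    by (intro decaying_cmult decaying_add decaying_cmult decaying_gauss_power)
  also have "(\<lambda>\<xi>. \<i> * (gauss_power 1 \<xi> + gauss_power 3 \<xi> + of_real (1 / 2) * gauss_power 5 \<xi>)) = (\<lambda>\<xi>. \<i> * of_real \<xi> * low_symbol \<xi>)"
    by (rule ext) (simp add: low_symbol_def gauss_power_def distrib_left mult_ac eval_nat_numeral)
  finally show "decaying n (\<lambda>\<xi>. \<i> * of_real \<xi> * low_symbol \<xi>)" .
qed

abbreviation high_symbol :: "real \<Rightarrow> real \<Rightarrow> complex" where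
  "high_symbol s \<equiv> gauss_sing s 6"

lemma decaying_high_symbol:
  assumes "0 < s" "s < 1"
  shows "decaying 4 (high_symbol s)" "decaying 4 (\<lambda>\<xi>. \<i> * of_real \<xi> * high_symbol s \<xi>)"
proof -
  show "decaying 4 (high_symbol s)" using decaying_gauss_sing[OF assms, of 4 6] by simp
  have "decaying 4 (\<lambda>\<xi>. \<i> * gauss_sing s 7 \<xi>)"
    using decaying_gauss_sing[OF assms, of 4 7] by (intro decaying_cmult) simp
  also have "(\<lambda>\<xi>. \<i> * gauss_sing s 7 \<xi>) = (\<lambda>\<xi>. \<i> * of_real \<xi> * high_symbol s \<xi>)"
    by (rule ext) (simp add: gauss_sing_def sing_power_def mult_ac eval_nat_numeral)
  finally show "decaying 4 (\<lambda>\<xi>. \<i> * of_real \<xi> * high_symbol s \<xi>)" .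
qed

definition scale_density :: "real \<Rightarrow> real \<Rightarrow> real" where
  "scale_density s \<rho> = indicator {0<..1} \<rho> * \<rho> powr (s - 1)"

lemma scale_density_simps [simp]: "0 \<le> scale_density s \<rho>" "\<rho> \<le> 0 \<Longrightarrow> scale_density s \<rho> = 0"
  by (auto simp: scale_density_def)

lemma scale_density_measurable [measurable]: "scale_density s \<in> borel_measurable borel"
  unfolding scale_density_def[abs_def] by measurable

lemma scale_density_nn_integral: "s > 0 \<Longrightarrow> (\<integral>\<^sup>+\<rho>. ennreal (scale_density s \<rho>)) < \<infinity>"
  by (rule order.strict_trans1[OF _ near_kernel_integral[of "1 - s"]])
     (auto intro!: nn_integral_mono simp: scale_density_def near_kernel_def split: split_indicator)

lemma scale_density_integrable: "s > 0 \<Longrightarrow> integrable lborel (scale_density s)"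
  using scale_density_nn_integral[of s] by (simp add: integrable_iff_bounded)

text \<open>The derivative of \<open>low_symbol (\<rho> \<xi>)\<close> with respect to \<open>\<rho>\<close> is \<open>- \<rho>\<^sup>5 \<xi>\<^sup>6 exp (- (\<rho> \<xi>)\<^sup>2)\<close>. Factoring out \<open>|\<xi>|\<^sup>s\<close>
leaves the high-frequency symbol at scale \<open>\<rho>\<close> with the density \<open>\<rho>\<^bsup>s-1\<^esup>\<close>.\<close>

lemma low_high_decomposition:
  assumes s: "0 < s" "s < 1"
  shows "1 - low_symbol \<xi> = (LBINT \<rho>. of_real (scale_density s \<rho>) * (high_symbol s (\<rho> * \<xi>) * of_real (\<bar>\<xi>\<bar> powr s)))"
proof -
  let ?F = "\<lambda>\<rho>. - (1 + (\<rho> * \<xi>)\<^sup>2 + (\<rho> * \<xi>) ^ 4 / 2) * exp (- (\<rho> * \<xi>)\<^sup>2)"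
  let ?f = "\<lambda>\<rho>. \<rho> ^ 5 * \<xi> ^ 6 * exp (- (\<rho> * \<xi>)\<^sup>2)"
  have "(LBINT \<rho>. indicator {0..1} \<rho> *\<^sub>R ?f \<rho>) = ?F 1 - ?F 0"
  proof (rule integral_FTC_atLeastAtMost)
    fix \<rho>
    have "(?F has_real_derivative ?f \<rho>) (at \<rho>)"
      by (rule derivative_eq_intros refl | simp)+ (simp add: algebra_simps eval_nat_numeral)
    then show "(?F has_vector_derivative ?f \<rho>) (at \<rho> within {0..1})"
      by (simp add: has_real_derivative_iff_has_vector_derivative has_vector_derivative_at_within)
  qed (auto intro!: continuous_intros)
  also have "\<dots> = 1 - (1 + \<xi>\<^sup>2 + \<xi> ^ 4 / 2) * exp (- \<xi>\<^sup>2)" by (simp add: algebra_simps)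
  finally have I: "(LBINT \<rho>. indicator {0..1} \<rho> *\<^sub>R ?f \<rho>) = 1 - (1 + \<xi>\<^sup>2 + \<xi> ^ 4 / 2) * exp (- \<xi>\<^sup>2)" .
  have "low_symbol \<xi> = complex_of_real ((1 + \<xi>\<^sup>2 + \<xi> ^ 4 / 2) * exp (- \<xi>\<^sup>2))"
    by (simp add: low_symbol_def gauss_power_def algebra_simps)
  then have "complex_of_real (LBINT \<rho>. indicator {0..1} \<rho> *\<^sub>R ?f \<rho>) = 1 - low_symbol \<xi>"
    unfolding I by (simp only: of_real_diff of_real_1)
  then have "1 - low_symbol \<xi> = (LBINT \<rho>. complex_of_real (indicator {0..1} \<rho> *\<^sub>R ?f \<rho>))"
    by (simp only: integral_complex_of_real)
  also have "\<dots> = (LBINT \<rho>. of_real (scale_density s \<rho>) * (high_symbol s (\<rho> * \<xi>) * of_real (\<bar>\<xi>\<bar> powr s)))"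
  proof (rule Bochner_Integration.integral_cong[OF refl])
    fix \<rho>
    show "complex_of_real (indicator {0..1} \<rho> *\<^sub>R ?f \<rho>) = of_real (scale_density s \<rho>) * (high_symbol s (\<rho> * \<xi>) * of_real (\<bar>\<xi>\<bar> powr s))"
    proof (cases "0 < \<rho> \<and> \<rho> \<le> 1 \<and> \<xi> \<noteq> 0")
      case True
      have "\<rho> powr (s - 1) * (\<bar>\<rho> * \<xi>\<bar> powr (- s) * \<bar>\<xi>\<bar> powr s) = (\<rho> powr (s - 1) * \<rho> powr (- s)) * (\<bar>\<xi>\<bar> powr (- s) * \<bar>\<xi>\<bar> powr s)"
        using True by (simp add: abs_mult powr_mult mult_ac)
      also have "\<rho> powr (s - 1) * \<rho> powr (- s) = inverse \<rho>" using True powr_add[of \<rho> "s - 1" "- s"] by (simp add: powr_minus)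
      also have "\<bar>\<xi>\<bar> powr (- s) * \<bar>\<xi>\<bar> powr s = 1" using True by (simp flip: powr_add)
      finally have "\<rho> powr (s - 1) * (\<bar>\<rho> * \<xi>\<bar> powr (- s) * \<bar>\<xi>\<bar> powr s) = inverse \<rho>" by simp
      note eq = this
      have "\<rho> powr (s - 1) * ((\<rho> * \<xi>) ^ 6 * \<bar>\<rho> * \<xi>\<bar> powr (- s) * exp (- (\<rho> * \<xi>)\<^sup>2) * \<bar>\<xi>\<bar> powr s)
        = \<rho> powr (s - 1) * (\<bar>\<rho> * \<xi>\<bar> powr (- s) * \<bar>\<xi>\<bar> powr s) * ((\<rho> * \<xi>) ^ 6 * exp (- (\<rho> * \<xi>)\<^sup>2))"
        by (simp only: mult_ac)
      also have "\<dots> = inverse \<rho> * ((\<rho> * \<xi>) ^ 6 * exp (- (\<rho> * \<xi>)\<^sup>2))" unfolding eq ..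
      also have "\<dots> = ?f \<rho>" using True by (simp add: power_mult_distrib eval_nat_numeral)
      finally have "?f \<rho> = \<rho> powr (s - 1) * ((\<rho> * \<xi>) ^ 6 * \<bar>\<rho> * \<xi>\<bar> powr (- s) * exp (- (\<rho> * \<xi>)\<^sup>2) * \<bar>\<xi>\<bar> powr s)" ..
      then show ?thesis using True
        by (simp add: scale_density_def gauss_sing_def sing_power_def mult.assoc flip: of_real_mult)
    next
      case False
      then show ?thesis by (auto simp: scale_density_def gauss_sing_def sing_power_def split: split_indicator)
    qed
  qed
  finally show ?thesis .
qed

lemma gauss_sing_measurable [measurable]: "gauss_sing s j \<in> borel_measurable borel"
  unfolding gauss_sing_def[abs_def] sing_power_def by measurable

lemma low_symbol_measurable [measurable]: "low_symbol \<in> borel_measurable borel"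
  unfolding low_symbol_def[abs_def] gauss_power_def by measurable

lemma abs_D_symbol_integrable:
  assumes f: "decaying 4 f" and s: "0 < s" "s < 1"
  shows "integrable lborel (\<lambda>\<xi>. of_real (\<bar>\<xi>\<bar> powr s) * fourier_transform f \<xi>)"
proof (rule Bochner_Integration.integrable_bound[OF decaying_fourier_integrable[OF f]])
  have [measurable]: "fourier_transform f \<in> borel_measurable borel"
    using decaying_inversion(2)[OF f] by auto
  show "(\<lambda>\<xi>. of_real (\<bar>\<xi>\<bar> powr s) * fourier_transform f \<xi>) \<in> borel_measurable lborel" by measurable
  show "AE \<xi> in lborel. norm (of_real (\<bar>\<xi>\<bar> powr s) * fourier_transform f \<xi>) \<le> norm ((1 + \<xi>\<^sup>2) *\<^sub>R fourier_transform f \<xi>)"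
  proof (rule AE_I2)
    fix \<xi> :: real
    have "\<bar>\<xi>\<bar> powr s \<le> (1 + \<xi>\<^sup>2) powr s" using abs_le_one_plus_square s by (intro powr_mono2) auto
    also have "\<dots> \<le> (1 + \<xi>\<^sup>2) powr 1" using s by (intro powr_mono) auto
    finally show "norm (of_real (\<bar>\<xi>\<bar> powr s) * fourier_transform f \<xi>) \<le> norm ((1 + \<xi>\<^sup>2) *\<^sub>R fourier_transform f \<xi>)"
      by (simp add: norm_mult mult_right_mono)
  qed
qed

lemma abs_D_eq_kernel: "abs_D s f = kernel (\<lambda>\<xi>. of_real (\<bar>\<xi>\<bar> powr s) * fourier_transform f \<xi>)"
  by (simp add: abs_D_def fourier_multiplier_def)

text \<open>Multiply \<open>low_high_decomposition\<close> by the transform of \<open>f\<close> and invert. The function \<open>V\<close> is the transform of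
\<open>|D|\<^sup>s f\<close>.\<close>

lemma reproducing_formula:
  assumes f: "decaying 4 f" and s: "0 < s" "s < 1"
  defines "V \<equiv> \<lambda>\<xi>. of_real (\<bar>\<xi>\<bar> powr s) * fourier_transform f \<xi>"
  shows "f x = kernel (\<lambda>\<xi>. low_symbol \<xi> * fourier_transform f \<xi>) x
      + (LBINT \<rho>. of_real (scale_density s \<rho>) * kernel (\<lambda>\<xi>. high_symbol s (\<rho> * \<xi>) * V \<xi>) x)" (is ?A)
    and "integrable lborel (\<lambda>\<rho>. of_real (scale_density s \<rho>) * kernel (\<lambda>\<xi>. high_symbol s (\<rho> * \<xi>) * V \<xi>) x)" (is ?B)
proof -
  let ?F = "fourier_transform f" and ?p = "of_real (1 / (2 * pi)) :: complex"
  have Fi: "integrable lborel ?F" by (rule decaying_inversion(2)[OF f])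
  have Vi: "integrable lborel V" unfolding V_def by (rule abs_D_symbol_integrable[OF f s])
  have [measurable]: "?F \<in> borel_measurable borel" "V \<in> borel_measurable borel" using Fi Vi by auto
  have q: "quadratic_decay (high_symbol s)" "quadratic_decay low_symbol"
    using decaying_high_symbol(1)[OF s] decaying_low_symbol(1)[of 0] decaying_imp_quadratic_decay by blast+
  obtain B where B: "\<And>\<xi>. norm (high_symbol s \<xi>) \<le> B" using quadratic_decay_bound[OF q(1)] by blast
  obtain L where L: "\<And>\<xi>. norm (low_symbol \<xi>) \<le> L" using quadratic_decay_bound[OF q(2)] by blast
  have Li: "integrable lborel (\<lambda>\<xi>. low_symbol \<xi> * ?F \<xi>)"
  proof (rule Bochner_Integration.integrable_bound)
    show "integrable lborel (\<lambda>\<xi>. L * norm (?F \<xi>))" using Fi by simp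
    show "AE \<xi> in lborel. norm (low_symbol \<xi> * ?F \<xi>) \<le> norm (L * norm (?F \<xi>))"
      using mult_right_mono[OF order_trans[OF L abs_ge_self]] by (auto simp: norm_mult abs_mult intro!: AE_I2)
  qed measurable
  let ?H = "\<lambda>\<rho> \<xi>. of_real (scale_density s \<rho>) * (cis (x * \<xi>) * (high_symbol s (\<rho> * \<xi>) * V \<xi>))"
  note fub = fubini_product_bound[of ?H "\<lambda>\<rho>. B * scale_density s \<rho>" "\<lambda>\<xi>. norm (V \<xi>)"]
  have Hm: "case_prod ?H \<in> borel_measurable (borel \<Otimes>\<^sub>M borel)" by measurable
  have Hg: "integrable lborel (\<lambda>\<rho>. B * scale_density s \<rho>)" using scale_density_integrable[OF s(1)] by simp
  have Hle: "norm (?H \<rho> \<xi>) \<le> B * scale_density s \<rho> * norm (V \<xi>)" for \<rho> \<xi>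
  proof -
    have "scale_density s \<rho> * (norm (high_symbol s (\<rho> * \<xi>)) * norm (V \<xi>)) \<le> scale_density s \<rho> * (B * norm (V \<xi>))"
      by (intro mult_left_mono mult_right_mono B) auto
    then show ?thesis by (simp add: norm_mult mult_ac)
  qed
  note fub = fub[OF Hm Hg integrable_norm[OF Vi] Hle]
  have inner: "of_real (scale_density s \<rho>) * kernel (\<lambda>\<xi>. high_symbol s (\<rho> * \<xi>) * V \<xi>) x = ?p * (LBINT \<xi>. ?H \<rho> \<xi>)" for \<rho>
    unfolding inverse_fourier_transform_cis by (simp only: integral_mult_right_zero mult.left_commute[of ?p])
  show ?B unfolding inner by (rule integrable_mult_right[OF fub(3)])
  have "f x = ?p * (LBINT \<xi>. cis (x * \<xi>) * ?F \<xi>)" by (rule decaying_inversion(1)[OF f])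
  also have "(LBINT \<xi>. cis (x * \<xi>) * ?F \<xi>) = (LBINT \<xi>. cis (x * \<xi>) * (low_symbol \<xi> * ?F \<xi>) + (LBINT \<rho>. ?H \<rho> \<xi>))"
  proof (rule Bochner_Integration.integral_cong[OF refl])
    fix \<xi>
    have "(LBINT \<rho>. ?H \<rho> \<xi>) = (LBINT \<rho>. of_real (scale_density s \<rho>) * (high_symbol s (\<rho> * \<xi>) * of_real (\<bar>\<xi>\<bar> powr s)) * (cis (x * \<xi>) * ?F \<xi>))"
      unfolding V_def by (simp only: mult_ac)
    also have "\<dots> = (1 - low_symbol \<xi>) * (cis (x * \<xi>) * ?F \<xi>)"
      unfolding low_high_decomposition[OF s, of \<xi>] by (rule integral_mult_left_zero)
    finally show "cis (x * \<xi>) * ?F \<xi> = cis (x * \<xi>) * (low_symbol \<xi> * ?F \<xi>) + (LBINT \<rho>. ?H \<rho> \<xi>)"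
      by (simp add: algebra_simps)
  qed
  also have "\<dots> = (LBINT \<xi>. cis (x * \<xi>) * (low_symbol \<xi> * ?F \<xi>)) + (LBINT \<xi>. LBINT \<rho>. ?H \<rho> \<xi>)"
    by (intro Bochner_Integration.integral_add integrable_cis_mult Li fub(4)) simp
  also have "(LBINT \<xi>. LBINT \<rho>. ?H \<rho> \<xi>) = (LBINT \<rho>. LBINT \<xi>. ?H \<rho> \<xi>)" by (rule fub(2)[symmetric])
  finally show ?A
    unfolding inner integral_mult_right_zero distrib_left inverse_fourier_transform_cis[of "\<lambda>\<xi>. low_symbol \<xi> * ?F \<xi>"] .
qed

definition kernel_difference :: "(real \<Rightarrow> complex) \<Rightarrow> real \<Rightarrow> real \<Rightarrow> complex" where
  "kernel_difference G t z = kernel G (z + t) - kernel G (z - t)"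

lemma kernel_difference_measurable [measurable (raw)]:
  assumes [measurable]: "(\<lambda>p. G (fst p) (snd p)) \<in> borel_measurable (M \<Otimes>\<^sub>M borel)" "f \<in> borel_measurable M" "g \<in> borel_measurable M"
  shows "(\<lambda>x. kernel_difference (G x) (f x) (g x)) \<in> borel_measurable M"
  unfolding kernel_difference_def by measurable

text \<open>The right-hand side contains \<open>f\<close> and \<open>|D|\<^sup>s f\<close> only through absolute values, so the weight can be brought in
afterwards.\<close>

lemma difference_kernel_estimate:
  assumes f: "decaying 4 f" and s: "0 < s" "s < 1"
  shows "ennreal (norm (f (x + t) - f (x - t))) \<le>
      (\<integral>\<^sup>+z. ennreal (norm (kernel_difference low_symbol t z)) * ennreal (norm (f (x - z))))
    + (\<integral>\<^sup>+\<rho>. ennreal (scale_density s \<rho>) * (\<integral>\<^sup>+z. ennreal (norm (kernel_difference (\<lambda>\<xi>. high_symbol s (\<rho> * \<xi>)) t z)) * ennreal (norm (abs_D s f (x - z)))))"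
proof -
  let ?F = "fourier_transform f"
  let ?V = "\<lambda>\<xi>. of_real (\<bar>\<xi>\<bar> powr s) * ?F \<xi>"
  let ?L = "\<lambda>x. kernel (\<lambda>\<xi>. low_symbol \<xi> * ?F \<xi>) x" and ?H = "\<lambda>\<rho> x. kernel (\<lambda>\<xi>. high_symbol s (\<rho> * \<xi>) * ?V \<xi>) x"
  note r = reproducing_formula[OF f s]
  have Fi: "integrable lborel ?F" by (rule decaying_inversion(2)[OF f])
  have Vi: "integrable lborel ?V" by (rule abs_D_symbol_integrable[OF f s])
  have kF: "kernel ?F y = f y" for y using decaying_inversion(1)[OF f, of y] by (simp add: inverse_fourier_transform_cis)
  have "f (x + t) - f (x - t) = (?L (x + t) - ?L (x - t)) + ((LBINT \<rho>. of_real (scale_density s \<rho>) * ?H \<rho> (x + t)) - (LBINT \<rho>. of_real (scale_density s \<rho>) * ?H \<rho> (x - t)))"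
    using r(1)[of "x + t"] r(1)[of "x - t"] by simp
  also have "(LBINT \<rho>. of_real (scale_density s \<rho>) * ?H \<rho> (x + t)) - (LBINT \<rho>. of_real (scale_density s \<rho>) * ?H \<rho> (x - t))
     = (LBINT \<rho>. of_real (scale_density s \<rho>) * (?H \<rho> (x + t) - ?H \<rho> (x - t)))"
    unfolding right_diff_distrib by (rule Bochner_Integration.integral_diff[symmetric]) (rule r(2))+
  finally have "ennreal (norm (f (x + t) - f (x - t))) \<le> ennreal (norm (?L (x + t) - ?L (x - t)) + norm (LBINT \<rho>. of_real (scale_density s \<rho>) * (?H \<rho> (x + t) - ?H \<rho> (x - t))))"
    by (simp only:) (intro ennreal_leI norm_triangle_ineq)
  also have "\<dots> = ennreal (norm (?L (x + t) - ?L (x - t))) + ennreal (norm (LBINT \<rho>. of_real (scale_density s \<rho>) * (?H \<rho> (x + t) - ?H \<rho> (x - t))))"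
    by (rule ennreal_plus) auto
  also have "\<dots> \<le> (\<integral>\<^sup>+z. ennreal (norm (kernel_difference low_symbol t z)) * ennreal (norm (f (x - z))))
    + (\<integral>\<^sup>+\<rho>. ennreal (scale_density s \<rho>) * (\<integral>\<^sup>+z. ennreal (norm (kernel_difference (\<lambda>\<xi>. high_symbol s (\<rho> * \<xi>)) t z)) * ennreal (norm (abs_D s f (x - z)))))"
  proof (rule add_mono)
    show "ennreal (norm (?L (x + t) - ?L (x - t))) \<le> (\<integral>\<^sup>+z. ennreal (norm (kernel_difference low_symbol t z)) * ennreal (norm (f (x - z))))"
      unfolding kernel_convolution_difference[OF decaying_low_symbol(1) Fi] kF
      by (rule order_trans[OF ennreal_norm_integral_le]) (simp add: norm_mult ennreal_mult kernel_difference_def)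
    have "ennreal (norm (?H \<rho> (x + t) - ?H \<rho> (x - t))) \<le> (\<integral>\<^sup>+z. ennreal (norm (kernel_difference (\<lambda>\<xi>. high_symbol s (\<rho> * \<xi>)) t z)) * ennreal (norm (abs_D s f (x - z))))" if \<rho>: "\<rho> > 0" for \<rho>
      unfolding kernel_convolution_difference[OF decaying_dilation[OF \<rho> decaying_high_symbol(1)[OF s]] Vi] abs_D_eq_kernel
      by (rule order_trans[OF ennreal_norm_integral_le]) (simp add: norm_mult ennreal_mult kernel_difference_def)
    then have "ennreal (norm (of_real (scale_density s \<rho>) * (?H \<rho> (x + t) - ?H \<rho> (x - t)))) \<le> ennreal (scale_density s \<rho>) * (\<integral>\<^sup>+z. ennreal (norm (kernel_difference (\<lambda>\<xi>. high_symbol s (\<rho> * \<xi>)) t z)) * ennreal (norm (abs_D s f (x - z))))" for \<rho>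
      by (cases "\<rho> > 0") (auto simp: norm_mult ennreal_mult intro!: mult_left_mono)
    then show "ennreal (norm (LBINT \<rho>. of_real (scale_density s \<rho>) * (?H \<rho> (x + t) - ?H \<rho> (x - t))))
       \<le> (\<integral>\<^sup>+\<rho>. ennreal (scale_density s \<rho>) * (\<integral>\<^sup>+z. ennreal (norm (kernel_difference (\<lambda>\<xi>. high_symbol s (\<rho> * \<xi>)) t z)) * ennreal (norm (abs_D s f (x - z)))))"
      by (intro order_trans[OF ennreal_norm_integral_le] nn_integral_mono)
  qed
  finally show ?thesis .
qed

text \<open>The density \<open>t\<^bsup>-\<alpha>\<^esup>\<close> in \<open>localized_difference\<close>.\<close>

definition step_density :: "real \<Rightarrow> real \<Rightarrow> real" where
  "step_density \<alpha> t = indicator {0<..1} t * t powr (- \<alpha>)"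

lemma step_density_nonneg [simp]: "0 \<le> step_density \<alpha> t" by (simp add: step_density_def)

lemma step_density_measurable [measurable]: "step_density \<alpha> \<in> borel_measurable borel"
  unfolding step_density_def[abs_def] by measurable

definition low_kernel :: "real \<Rightarrow> real \<Rightarrow> ennreal" where
  "low_kernel \<alpha> z = (\<integral>\<^sup>+t. ennreal (step_density \<alpha> t) * ennreal (norm (kernel_difference low_symbol t z)))"

text \<open>The differences of step \<open>t\<close> of the kernels at all scales, superposed.\<close>

definition high_kernel_at :: "real \<Rightarrow> real \<Rightarrow> real \<Rightarrow> ennreal" where
  "high_kernel_at s t z = (\<integral>\<^sup>+\<rho>. ennreal (scale_density s \<rho>) * ennreal (norm (kernel_difference (\<lambda>\<xi>. high_symbol s (\<rho> * \<xi>)) t z)))"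

definition high_kernel :: "real \<Rightarrow> real \<Rightarrow> real \<Rightarrow> ennreal" where
  "high_kernel \<alpha> s z = (\<integral>\<^sup>+t. ennreal (step_density \<alpha> t) * high_kernel_at s t z)"

lemma high_kernel_at_measurable [measurable]: "(\<lambda>(t, z). high_kernel_at s t z) \<in> borel_measurable (borel \<Otimes>\<^sub>M borel)"
  unfolding high_kernel_at_def by measurable

lemma low_high_kernel_measurable [measurable]:
  "low_kernel \<alpha> \<in> borel_measurable borel" "high_kernel \<alpha> s \<in> borel_measurable borel"
  unfolding low_kernel_def[abs_def] high_kernel_def[abs_def] by measurable

text \<open>Tonelli's theorem collects the kernels of all steps and scales into one for \<open>f\<close> and one for
\<open>|D|\<^sup>s f\<close>. Taking absolute values for each \<open>t\<close> loses nothing essential, because \<open>T\<close> has lower order than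
\<open>|D|\<^sup>s\<close>.\<close>

lemma localized_difference_kernel_estimate:
  assumes f: "decaying 4 f" and s: "0 < s" "s < 1"
  shows "ennreal (norm (localized_difference \<alpha> f x)) \<le>
      (\<integral>\<^sup>+z. low_kernel \<alpha> z * ennreal (norm (f (x - z))))
    + (\<integral>\<^sup>+z. high_kernel \<alpha> s z * ennreal (norm (abs_D s f (x - z))))"
proof -
  have [measurable]: "f \<in> borel_measurable borel"
    using f decaying_imp_quadratic_decay quadratic_decay_measurable by blast
  let ?A = "\<lambda>t. \<integral>\<^sup>+z. ennreal (norm (kernel_difference low_symbol t z)) * ennreal (norm (f (x - z)))"
  let ?B = "\<lambda>t. \<integral>\<^sup>+\<rho>. ennreal (scale_density s \<rho>) * (\<integral>\<^sup>+z. ennreal (norm (kernel_difference (\<lambda>\<xi>. high_symbol s (\<rho> * \<xi>)) t z)) * ennreal (norm (abs_D s f (x - z))))"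
  have "ennreal (norm (localized_difference \<alpha> f x)) \<le> (\<integral>\<^sup>+t. ennreal (norm (of_real (step_density \<alpha> t) * (f (x + t) - f (x - t)))))"
    unfolding localized_difference_def step_density_def by (rule ennreal_norm_integral_le)
  also have "\<dots> \<le> (\<integral>\<^sup>+t. ennreal (step_density \<alpha> t) * ?A t + ennreal (step_density \<alpha> t) * ?B t)"
    unfolding distrib_left[symmetric]
    using difference_kernel_estimate[OF f s, of x] by (intro nn_integral_mono) (simp add: norm_mult ennreal_mult mult_left_mono)
  also have "\<dots> = (\<integral>\<^sup>+t. ennreal (step_density \<alpha> t) * ?A t) + (\<integral>\<^sup>+t. ennreal (step_density \<alpha> t) * ?B t)"
    by (rule nn_integral_add) measurable
  also have "(\<integral>\<^sup>+t. ennreal (step_density \<alpha> t) * ?A t) = (\<integral>\<^sup>+z. low_kernel \<alpha> z * ennreal (norm (f (x - z))))"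
    unfolding low_kernel_def by (rule tonelli_kernel) measurable
  also have "?B = (\<lambda>t. \<integral>\<^sup>+z. high_kernel_at s t z * ennreal (norm (abs_D s f (x - z))))"
    unfolding high_kernel_at_def by (rule ext, rule tonelli_kernel) measurable
  also have "(\<integral>\<^sup>+t. ennreal (step_density \<alpha> t) * (\<integral>\<^sup>+z. high_kernel_at s t z * ennreal (norm (abs_D s f (x - z)))))
      = (\<integral>\<^sup>+z. high_kernel \<alpha> s z * ennreal (norm (abs_D s f (x - z))))"
    unfolding high_kernel_def by (rule tonelli_kernel) measurable
  finally show ?thesis .
qed

section \<open>The commutator estimate at unit scale\<close>

lemma low_kernel_weighted_finite:
  assumes "\<alpha> < 2" and \<beta>: "0 \<le> \<beta>" "\<beta> \<le> 2"
  shows "moment \<beta> (low_kernel \<alpha>) < \<infinity>"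
proof -
  obtain C where C: "0 \<le> C" "\<And>\<rho> t. 0 < \<rho> \<Longrightarrow> \<rho> \<le> 1 \<Longrightarrow> 0 < t \<Longrightarrow> t \<le> 1 \<Longrightarrow>
     (moment \<beta> (\<lambda>z. ennreal (norm (kernel (\<lambda>\<xi>. low_symbol (\<rho> * \<xi>)) (z + t) - kernel (\<lambda>\<xi>. low_symbol (\<rho> * \<xi>)) (z - t)))))
       \<le> ennreal (C * min 1 (t / \<rho>))"
    using difference_kernel_bound[OF decaying_low_symbol refl \<beta>] by blast
  have le: "ennreal (step_density \<alpha> t) * moment \<beta> (\<lambda>z. ennreal (norm (kernel_difference low_symbol t z))) \<le> ennreal C * ennreal (near_kernel (\<alpha> - 1) t)" for t
  proof (cases "0 < t \<and> t \<le> 1")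
    case True
    have "moment \<beta> (\<lambda>z. ennreal (norm (kernel_difference low_symbol t z))) \<le> ennreal (C * t)"
    proof -
      have "min 1 (t / 1) = t" using True by simp
      then show ?thesis using C(2)[of 1 t] True by (simp add: kernel_difference_def)
    qed
    then have "ennreal (step_density \<alpha> t) * moment \<beta> (\<lambda>z. ennreal (norm (kernel_difference low_symbol t z))) \<le> ennreal (step_density \<alpha> t) * ennreal (C * t)"
      by (rule mult_left_mono) simp
    also have "\<dots> = ennreal (t powr (- \<alpha>) * (C * t))" using True C(1) by (simp add: step_density_def ennreal_mult)
    also have "t powr (- \<alpha>) * (C * t) = C * near_kernel (\<alpha> - 1) t"
      using True powr_add[of t "- \<alpha>" 1] by (simp add: near_kernel_def)
    finally show ?thesis using C(1) by (simp add: ennreal_mult)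
  qed (auto simp: step_density_def)
  have "moment \<beta> (low_kernel \<alpha>)
     = (\<integral>\<^sup>+t. ennreal (step_density \<alpha> t) * moment \<beta> (\<lambda>z. ennreal (norm (kernel_difference low_symbol t z))))"
    unfolding low_kernel_def by (rule tonelli_kernel[symmetric]) measurable
  also have "\<dots> \<le> (\<integral>\<^sup>+t. ennreal C * ennreal (near_kernel (\<alpha> - 1) t))"
    by (intro nn_integral_mono le)
  also have "\<dots> = ennreal C * (\<integral>\<^sup>+t. ennreal (near_kernel (\<alpha> - 1) t))"
    by (rule nn_integral_cmult) measurable
  also have "\<dots> < \<infinity>" using near_kernel_integral[of "\<alpha> - 1"] assms(1) by (simp add: ennreal_mult_less_top)
  finally show ?thesis .
qed

text \<open>With \<open>min 1 (t / \<rho>) \<le> (t / \<rho>)\<^sup>\<theta>\<close> the double integral factors into those of \<open>t\<^bsup>\<theta>-\<alpha>\<^esup>\<close> and of \<open>\<rho>\<^bsup>s-1-\<theta>\<^esup>\<close>, which are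
finite for \<open>\<alpha> - 1 < \<theta> < s\<close>.\<close>

lemma high_kernel_weighted_finite:
  assumes s: "0 < s" "s < 1" "\<alpha> - 1 < s" and \<beta>: "0 \<le> \<beta>" "\<beta> \<le> 2"
  shows "moment \<beta> (high_kernel \<alpha> s) < \<infinity>"
proof -
  obtain C where C: "0 \<le> C" "\<And>\<rho> t. 0 < \<rho> \<Longrightarrow> \<rho> \<le> 1 \<Longrightarrow> 0 < t \<Longrightarrow> t \<le> 1 \<Longrightarrow>
     (moment \<beta> (\<lambda>z. ennreal (norm (kernel (\<lambda>\<xi>. high_symbol s (\<rho> * \<xi>)) (z + t) - kernel (\<lambda>\<xi>. high_symbol s (\<rho> * \<xi>)) (z - t)))))
       \<le> ennreal (C * min 1 (t / \<rho>))"
    using difference_kernel_bound[OF decaying_high_symbol[OF s(1,2)] refl \<beta>] by blast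
  \<comment> \<open>The maximum keeps \<open>\<theta>\<close> positive when \<open>\<alpha> \<le> 1\<close>.\<close>
  define \<theta> where "\<theta> = (max 0 (\<alpha> - 1) + s) / 2"
  have \<theta>: "0 < \<theta>" "\<theta> < s" "\<alpha> - 1 < \<theta>" "\<theta> < 1" using s by (auto simp: \<theta>_def max_def)
  let ?W = "\<lambda>\<rho> t. \<integral>\<^sup>+z. ennreal (norm (kernel_difference (\<lambda>\<xi>. high_symbol s (\<rho> * \<xi>)) t z)) * ennreal (japanese \<beta> z)"
  define R where "R = (\<integral>\<^sup>+\<rho>. ennreal (near_kernel (1 - s + \<theta>) \<rho>))"
  have R: "R < \<infinity>" unfolding R_def using \<theta> by (intro near_kernel_integral) simp
  have W: "ennreal (scale_density s \<rho>) * ?W \<rho> t \<le> ennreal (C * t powr \<theta>) * ennreal (near_kernel (1 - s + \<theta>) \<rho>)" if t: "0 < t" "t \<le> 1" for \<rho> t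
  proof (cases "0 < \<rho> \<and> \<rho> \<le> 1")
    case True
    have "min 1 (t / \<rho>) \<le> (t / \<rho>) powr \<theta>"
    proof (cases "t / \<rho> \<le> 1")
      case le: True
      have "(t / \<rho>) powr 1 \<le> (t / \<rho>) powr \<theta>" using le t True \<theta> by (intro powr_mono') auto
      then show ?thesis using t True by simp
    next
      case False
      then have "1 \<le> (t / \<rho>) powr \<theta>" using \<theta> by (intro ge_one_powr_ge_zero) auto
      then show ?thesis by simp
    qed
    then have "?W \<rho> t \<le> ennreal (C * (t / \<rho>) powr \<theta>)"
      using C True t unfolding kernel_difference_def by (intro order_trans[OF C(2)] ennreal_leI mult_left_mono) auto
    then have "ennreal (scale_density s \<rho>) * ?W \<rho> t \<le> ennreal (scale_density s \<rho>) * ennreal (C * (t / \<rho>) powr \<theta>)"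
      by (rule mult_left_mono) simp
    also have "\<dots> = ennreal (\<rho> powr (s - 1) * (C * (t / \<rho>) powr \<theta>))"
      using True C(1) by (simp add: scale_density_def ennreal_mult)
    also have "\<rho> powr (s - 1) * (C * (t / \<rho>) powr \<theta>) = C * t powr \<theta> * (\<rho> powr (s - 1) * \<rho> powr (- \<theta>))"
    proof -
      have "(t / \<rho>) powr \<theta> = t powr \<theta> / \<rho> powr \<theta>" by (rule powr_divide)
      then show ?thesis by (simp add: powr_minus divide_inverse)
    qed
    also have "\<rho> powr (s - 1) * \<rho> powr (- \<theta>) = near_kernel (1 - s + \<theta>) \<rho>"
      unfolding powr_add[symmetric] using True by (simp add: near_kernel_def)
    finally show ?thesis using C(1) by (simp add: ennreal_mult)
  qed (auto simp: scale_density_def)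
  have le: "ennreal (step_density \<alpha> t) * moment \<beta> (high_kernel_at s t) \<le> ennreal C * R * ennreal (near_kernel (\<alpha> - \<theta>) t)" for t
  proof (cases "0 < t \<and> t \<le> 1")
    case True
    have "moment \<beta> (high_kernel_at s t) = (\<integral>\<^sup>+\<rho>. ennreal (scale_density s \<rho>) * ?W \<rho> t)"
      unfolding high_kernel_at_def by (rule tonelli_kernel[symmetric]) measurable
    also have "\<dots> \<le> (\<integral>\<^sup>+\<rho>. ennreal (C * t powr \<theta>) * ennreal (near_kernel (1 - s + \<theta>) \<rho>))"
      using True by (intro nn_integral_mono W) auto
    also have "\<dots> = ennreal (C * t powr \<theta>) * R" unfolding R_def by (rule nn_integral_cmult) measurable
    finally have "ennreal (step_density \<alpha> t) * moment \<beta> (high_kernel_at s t) \<le> ennreal (step_density \<alpha> t) * (ennreal (C * t powr \<theta>) * R)"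
      by (rule mult_left_mono) simp
    also have "\<dots> = ennreal (t powr (- \<alpha>) * (C * t powr \<theta>)) * R" using True C(1) by (simp add: step_density_def ennreal_mult mult.assoc)
    also have "t powr (- \<alpha>) * (C * t powr \<theta>) = C * (t powr (- \<alpha>) * t powr \<theta>)" by simp
    also have "t powr (- \<alpha>) * t powr \<theta> = near_kernel (\<alpha> - \<theta>) t"
      unfolding powr_add[symmetric] using True by (simp add: near_kernel_def)
    finally show ?thesis using C(1) by (simp add: ennreal_mult mult_ac)
  qed (auto simp: step_density_def)
  have "moment \<beta> (high_kernel \<alpha> s)
     = (\<integral>\<^sup>+t. ennreal (step_density \<alpha> t) * moment \<beta> (high_kernel_at s t))"
    unfolding high_kernel_def by (rule tonelli_kernel[symmetric]) measurable
  also have "\<dots> \<le> (\<integral>\<^sup>+t. ennreal C * R * ennreal (near_kernel (\<alpha> - \<theta>) t))"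
    by (intro nn_integral_mono le)
  also have "\<dots> = ennreal C * R * (\<integral>\<^sup>+t. ennreal (near_kernel (\<alpha> - \<theta>) t))"
    by (rule nn_integral_cmult) measurable
  also have "\<dots> < \<infinity>" using near_kernel_integral[of "\<alpha> - \<theta>"] R \<theta> by (simp add: ennreal_mult_less_top)
  finally show ?thesis .
qed

context weighted_setting
begin

lemma weighted_localized_difference_L2:
  assumes s: "0 < s" "s < 1"
  shows "(\<integral>\<^sup>+x. (ennreal (weight \<beta> x * norm (localized_difference \<alpha> u x)))\<^sup>2)
    \<le> 2 * ((ennreal (2 powr (\<beta> / 2)) * moment \<beta> (low_kernel \<alpha>))\<^sup>2 * F2)
      + 2 * ((ennreal (2 powr (\<beta> / 2)) * moment \<beta> (high_kernel \<alpha> s))\<^sup>2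
          * (\<integral>\<^sup>+x. (ennreal (weight \<beta> x * norm (abs_D s u x)))\<^sup>2))"
proof -
  let ?N = "\<lambda>x. \<integral>\<^sup>+z. low_kernel \<alpha> z * ennreal (norm (u (x - z)))"
  let ?M = "\<lambda>x. \<integral>\<^sup>+z. high_kernel \<alpha> s z * ennreal (norm (abs_D s u (x - z)))"
  have "(\<integral>\<^sup>+x. (ennreal (weight \<beta> x * norm (localized_difference \<alpha> u x)))\<^sup>2)
     \<le> (\<integral>\<^sup>+x. (ennreal (weight \<beta> x) * ?N x + ennreal (weight \<beta> x) * ?M x)\<^sup>2)"
    unfolding distrib_left[symmetric] using localized_difference_kernel_estimate[OF u s, of \<alpha>]
    by (intro nn_integral_mono power_mono) (simp_all add: ennreal_mult mult_left_mono)
  also have "\<dots> \<le> 2 * (\<integral>\<^sup>+x. (ennreal (weight \<beta> x) * ?N x)\<^sup>2) + 2 * (\<integral>\<^sup>+x. (ennreal (weight \<beta> x) * ?M x)\<^sup>2)"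
    by (rule nn_integral_square_add) measurable
  also have "\<dots> \<le> 2 * ((ennreal (2 powr (\<beta> / 2)) * moment \<beta> (low_kernel \<alpha>))\<^sup>2 * (\<integral>\<^sup>+x. (ennreal (weight \<beta> x * norm (u x)))\<^sup>2))
      + 2 * ((ennreal (2 powr (\<beta> / 2)) * moment \<beta> (high_kernel \<alpha> s))\<^sup>2
          * (\<integral>\<^sup>+x. (ennreal (weight \<beta> x * norm (abs_D s u x)))\<^sup>2))"
    using \<beta>_nonneg by (intro add_mono mult_left_mono weighted_young) auto
  finally show ?thesis by (simp add: F_def)
qed

lemma commutator_L2_subcritical:
  "(ennreal (abs_D_const \<alpha>))\<^sup>2 * L2_norm_squared (commutator (abs_D \<alpha>) (weight \<beta>) u)
    \<le> (2 * ((ennreal (\<beta> * 2 powr \<beta>))\<^sup>2 * (\<integral>\<^sup>+z. ennreal (near_kernel \<alpha> z))\<^sup>2) + 2 * far_const \<alpha> \<beta>) * F2"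
  using order_trans[OF commutator_L2 add_right_mono[OF mult_left_mono[OF near_L2_subcritical, of 2]]]
  by (simp add: distrib_right mult.assoc)

text \<open>Stated with an arbitrary bound \<open>Y\<close>, which is the integral of \<open>F\<^sup>2\<close> for \<open>\<alpha> = 1\<close> and also contains \<open>|D|\<^bsup>\<alpha>/2\<^esup>u\<close> for
\<open>\<alpha> > 1\<close>.\<close>

lemma commutator_L2_principal:
  assumes T: "(\<integral>\<^sup>+x. (ennreal (weight \<beta> x * norm (localized_difference \<alpha> u x)))\<^sup>2) \<le> K * Y" and Y: "F2 \<le> Y"
  shows "(ennreal (abs_D_const \<alpha>))\<^sup>2 * L2_norm_squared (commutator (abs_D \<alpha>) (weight \<beta>) u)
    \<le> (2 * (2 * ((ennreal \<beta>)\<^sup>2 * K)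
      + 2 * ((ennreal (\<beta> * (\<beta> + 3) * 2 powr \<beta>))\<^sup>2 * (\<integral>\<^sup>+z. ennreal (near_kernel (\<alpha> - 1) z))\<^sup>2)) + 2 * far_const \<alpha> \<beta>) * Y"
    (is "_ \<le> (2 * (2 * (?b * K) + 2 * ?c) + 2 * ?f) * Y")
proof -
  have "2 * ((ennreal \<beta>)\<^sup>2 * (\<integral>\<^sup>+x. (ennreal (weight \<beta> x * norm (localized_difference \<alpha> u x)))\<^sup>2)) + 2 * (?c * F2)
     \<le> 2 * (?b * (K * Y)) + 2 * (?c * Y)"
    by (intro add_mono mult_left_mono T Y) auto
  from order_trans[OF near_L2_principal this]
  have "2 * (\<integral>\<^sup>+x. (ennreal (norm (part {0<..1} x)))\<^sup>2)
      + 2 * (?f * F2) \<le> 2 * (2 * (?b * (K * Y)) + 2 * (?c * Y)) + 2 * (?f * Y)"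
    by (intro add_mono mult_left_mono Y) auto
  from order_trans[OF commutator_L2 this] show ?thesis by (simp add: distrib_right distrib_left mult.assoc)
qed

end

text \<open>Division by the constant of the singular integral, and passage from an extended to a real constant.\<close>

lemma finite_ennreal_constant:
  assumes "K < (\<infinity>::ennreal)" "0 < c"
  shows "\<exists>C>0. \<forall>X Y. (ennreal c)\<^sup>2 * X \<le> K * Y \<longrightarrow> X \<le> ennreal C * Y"
proof -
  define C where "C = inverse (c\<^sup>2) * enn2real K + 1"
  have "X \<le> ennreal C * Y" if "(ennreal c)\<^sup>2 * X \<le> K * Y" for X Y
  proof -
    have "ennreal (inverse (c\<^sup>2)) * ((ennreal c)\<^sup>2 * X) = (ennreal (inverse (c\<^sup>2)) * ennreal (c\<^sup>2)) * X"
      using assms(2) by (simp add: ennreal_power mult.assoc)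
    also have "ennreal (inverse (c\<^sup>2)) * ennreal (c\<^sup>2) = 1"
      using assms(2) by (simp flip: ennreal_mult)
    finally have "X = ennreal (inverse (c\<^sup>2)) * ((ennreal c)\<^sup>2 * X)" by simp
    also have "\<dots> \<le> ennreal (inverse (c\<^sup>2)) * (K * Y)" by (intro mult_left_mono that) simp
    also have "\<dots> = (ennreal (inverse (c\<^sup>2)) * ennreal (enn2real K)) * Y" using assms(1) by (simp add: mult.assoc)
    also have "ennreal (inverse (c\<^sup>2)) * ennreal (enn2real K) = ennreal (inverse (c\<^sup>2) * enn2real K)" by (rule ennreal_mult[symmetric]) auto
    also have "ennreal (inverse (c\<^sup>2) * enn2real K) * Y \<le> ennreal C * Y" unfolding C_def by (intro mult_right_mono ennreal_leI) auto
    finally show ?thesis .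
  qed
  moreover have "C > 0" unfolding C_def by (intro add_nonneg_pos) auto
  ultimately show ?thesis by blast
qed

theorem weighted_commutator_estimate:
  assumes \<alpha>: "0 < \<alpha>" "\<alpha> < 2" and \<beta>: "\<beta> = (1 + \<alpha>) / 2"
  shows "\<exists>C>0. \<forall>u. decaying 4 u \<longrightarrow> L2_norm_squared (commutator (abs_D \<alpha>) (weight \<beta>) u)
    \<le> ennreal C * (if \<alpha> \<le> 1 then \<integral>\<^sup>+x. ennreal ((norm (u x))\<^sup>2 * (weight \<beta> x)\<^sup>2)
        else \<integral>\<^sup>+x. ennreal (((norm (u x))\<^sup>2 + (norm (abs_D (\<alpha> / 2) u x))\<^sup>2) * (weight \<beta> x)\<^sup>2))"
proof -
  have F2: "(\<integral>\<^sup>+x. (ennreal (weighted_setting.F \<beta> u x))\<^sup>2) = (\<integral>\<^sup>+x. ennreal ((norm (u x))\<^sup>2 * (weight \<beta> x)\<^sup>2))"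
    if "weighted_setting \<alpha> \<beta> u" for u
    using weighted_setting.F_def[OF that] by (intro nn_integral_cong) (simp add: ennreal_power power_mult_distrib mult.commute)
  have setting: "weighted_setting \<alpha> \<beta> u" if "decaying 4 u" for u using assms that by unfold_locales
  have far: "far_const \<alpha> \<beta> < \<infinity>" by (rule far_const_finite[OF \<alpha>(1) \<beta>])
  have near: "(\<integral>\<^sup>+z. ennreal (near_kernel (\<alpha> - 1) z)) < \<infinity>" using \<alpha> by (intro near_kernel_integral) simp
  consider "\<alpha> < 1" | "\<alpha> = 1" | "1 < \<alpha>" by linarith
  then show ?thesis
  proof cases
    case 1
    let ?K = "2 * ((ennreal (\<beta> * 2 powr \<beta>))\<^sup>2 * (\<integral>\<^sup>+z. ennreal (near_kernel \<alpha> z))\<^sup>2) + 2 * far_const \<alpha> \<beta>"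
    have "?K < \<infinity>" using far near_kernel_integral[OF 1] by (simp add: ennreal_mult_less_top power_less_top_ennreal)
    from finite_ennreal_constant[OF this abs_D_const_pos[OF \<alpha>]] obtain C where C: "C > 0"
      "\<And>X Y. (ennreal (abs_D_const \<alpha>))\<^sup>2 * X \<le> ?K * Y \<Longrightarrow> X \<le> ennreal C * Y" by blast
    have "L2_norm_squared (commutator (abs_D \<alpha>) (weight \<beta>) u) \<le> ennreal C * (\<integral>\<^sup>+x. ennreal ((norm (u x))\<^sup>2 * (weight \<beta> x)\<^sup>2))"
      if "decaying 4 u" for u
      using C(2)[OF weighted_setting.commutator_L2_subcritical[OF setting[OF that]]] unfolding F2[OF setting[OF that]] .
    with C(1) 1 show ?thesis by auto
  next
    case 2
    obtain B where B: "B \<ge> 0" "\<And>f. decaying 4 f \<Longrightarrow>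
      (\<integral>\<^sup>+x. (ennreal (norm (localized_difference 1 f x)))\<^sup>2) \<le> ennreal B * (\<integral>\<^sup>+x. (ennreal (norm (f x)))\<^sup>2)"
      using localized_difference_1_L2 by blast
    let ?T = "2 * ennreal B + 2 * ((ennreal (\<beta> * 2 powr \<beta>))\<^sup>2 * (\<integral>\<^sup>+z. ennreal (near_kernel 0 z))\<^sup>2)"
    let ?K = "2 * (2 * ((ennreal \<beta>)\<^sup>2 * ?T)
      + 2 * ((ennreal (\<beta> * (\<beta> + 3) * 2 powr \<beta>))\<^sup>2 * (\<integral>\<^sup>+z. ennreal (near_kernel (\<alpha> - 1) z))\<^sup>2)) + 2 * far_const \<alpha> \<beta>"
    have "?K < \<infinity>" using far near near_kernel_integral[of 0] by (simp add: ennreal_mult_less_top power_less_top_ennreal)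
    from finite_ennreal_constant[OF this abs_D_const_pos[OF \<alpha>]] obtain C where C: "C > 0"
      "\<And>X Y. (ennreal (abs_D_const \<alpha>))\<^sup>2 * X \<le> ?K * Y \<Longrightarrow> X \<le> ennreal C * Y" by blast
    have "L2_norm_squared (commutator (abs_D \<alpha>) (weight \<beta>) u) \<le> ennreal C * (\<integral>\<^sup>+x. ennreal ((norm (u x))\<^sup>2 * (weight \<beta> x)\<^sup>2))"
      if u: "decaying 4 u" for u
      using C(2)[OF weighted_setting.commutator_L2_principal[OF setting[OF u] weighted_setting.weighted_localized_difference_1_L2[OF setting[OF u] B(2), folded 2] order_refl]]
      unfolding F2[OF setting[OF u]] .
    with C(1) 2 show ?thesis by auto
  next
    case 3
    define s where "s = \<alpha> / 2"
    have s: "0 < s" "s < 1" "\<alpha> - 1 < s" using \<alpha> by (auto simp: s_def)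
    \<comment> \<open>\<open>\<beta> < 3/2\<close>, within the range of the moment bounds.\<close>
    have \<beta>2: "0 \<le> \<beta>" "\<beta> \<le> 2" using \<alpha> \<beta> by auto
    let ?N = "(ennreal (2 powr (\<beta> / 2)) * moment \<beta> (low_kernel \<alpha>))\<^sup>2"
    let ?M = "(ennreal (2 powr (\<beta> / 2)) * moment \<beta> (high_kernel \<alpha> s))\<^sup>2"
    let ?T = "2 * ?N + 2 * ?M"
    let ?K = "2 * (2 * ((ennreal \<beta>)\<^sup>2 * ?T)
      + 2 * ((ennreal (\<beta> * (\<beta> + 3) * 2 powr \<beta>))\<^sup>2 * (\<integral>\<^sup>+z. ennreal (near_kernel (\<alpha> - 1) z))\<^sup>2)) + 2 * far_const \<alpha> \<beta>"
    have "?K < \<infinity>" using far near low_kernel_weighted_finite[OF \<alpha>(2) \<beta>2] high_kernel_weighted_finite[OF s \<beta>2]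
      by (simp add: ennreal_mult_less_top power_less_top_ennreal)
    from finite_ennreal_constant[OF this abs_D_const_pos[OF \<alpha>]] obtain C where C: "C > 0"
      "\<And>X Y. (ennreal (abs_D_const \<alpha>))\<^sup>2 * X \<le> ?K * Y \<Longrightarrow> X \<le> ennreal C * Y" by blast
    have "L2_norm_squared (commutator (abs_D \<alpha>) (weight \<beta>) u)
        \<le> ennreal C * (\<integral>\<^sup>+x. ennreal (((norm (u x))\<^sup>2 + (norm (abs_D s u x))\<^sup>2) * (weight \<beta> x)\<^sup>2))"
      if u: "decaying 4 u" for u
    proof -
      interpret weighted_setting \<alpha> \<beta> u by (rule setting[OF u])
      let ?Y = "\<integral>\<^sup>+x. ennreal (((norm (u x))\<^sup>2 + (norm (abs_D s u x))\<^sup>2) * (weight \<beta> x)\<^sup>2)"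
      have F: "F2 \<le> ?Y" unfolding F2[OF setting[OF u]]
        by (intro nn_integral_mono ennreal_leI mult_right_mono) auto
      have V: "(\<integral>\<^sup>+x. (ennreal (weight \<beta> x * norm (abs_D s u x)))\<^sup>2) \<le> ?Y"
        by (intro nn_integral_mono) (simp add: ennreal_power power_mult_distrib mult.commute[of "(weight \<beta> _)\<^sup>2"] ennreal_leI mult_right_mono)
      have "(\<integral>\<^sup>+x. (ennreal (weight \<beta> x * norm (localized_difference \<alpha> u x)))\<^sup>2) \<le> 2 * (?N * ?Y) + 2 * (?M * ?Y)"
        by (rule order_trans[OF weighted_localized_difference_L2[OF s(1,2)]]) (intro add_mono mult_left_mono F V; simp)
      also have "\<dots> = ?T * ?Y" by (simp only: distrib_right mult.assoc)
      finally show ?thesis by (intro C(2) commutator_L2_principal F)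
    qed
    with C(1) 3 show ?thesis unfolding s_def by auto
  qed
qed

section \<open>Scaling and the functions \<open>\<Phi>\<^sub>j\<close>\<close>

lemma weight_integrable:
  assumes "1 < \<gamma>" shows "integrable lborel (weight \<gamma>)"
proof -
  have "(\<integral>\<^sup>+x. ennreal (weight \<gamma> x)) < \<infinity>"
    using weight_square_integral[of "\<gamma> / 2"] assms by (simp add: ennreal_power weight_square)
  then show ?thesis by (simp add: integrable_iff_bounded)
qed

text \<open>Near \<open>y\<close> the tail integral differs by a constant from minus the integral from \<open>y - 1\<close>.\<close>

lemma weight_tail_deriv:
  assumes "1 < \<gamma>"
  shows "((\<lambda>y. LINT s:{y..}|lborel. weight \<gamma> s) has_real_derivative - weight \<gamma> y) (at y)"
proof -
  have int: "set_integrable lborel S (weight \<gamma>)" if "S \<in> sets lborel" for S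
    using integrable_mult_indicator[OF that weight_integrable[OF assms]] by (simp add: set_integrable_def)
  have cont: "continuous_on S (weight \<gamma>)" for S
    using weight_deriv DERIV_isCont by (blast intro: continuous_at_imp_continuous_on)
  define a where "a = y - 1"
  define c where "c = (LINT s:{a..}|lborel. weight \<gamma> s)"
  have split: "(LINT s:{z..}|lborel. weight \<gamma> s) = c - (LBINT s=a..z. weight \<gamma> s)" if "a < z" for z
  proof -
    have "c = (LINT s:{a..<z} \<union> {z..}|lborel. weight \<gamma> s)"
      using that unfolding c_def by (intro arg_cong[where f = "\<lambda>S. LINT s:S|lborel. weight \<gamma> s"]) auto
    also have "\<dots> = (LINT s:{a..<z}|lborel. weight \<gamma> s) + (LINT s:{z..}|lborel. weight \<gamma> s)"
      by (intro set_integral_Un int) auto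
    also have "(LINT s:{a..<z}|lborel. weight \<gamma> s) = (LBINT s=a..z. weight \<gamma> s)"
      using that by (simp add: interval_integral_Ico)
    finally show ?thesis by simp
  qed
  have "((\<lambda>z. LBINT s=a..z. weight \<gamma> s) has_vector_derivative weight \<gamma> y) (at y within {a..y + 1})"
    by (rule interval_integral_FTC2) (auto simp: a_def cont)
  then have "((\<lambda>z. LBINT s=a..z. weight \<gamma> s) has_real_derivative weight \<gamma> y) (at y within {a..y + 1})"
    by (simp add: has_real_derivative_iff_has_vector_derivative)
  moreover have "at y within {a..y + 1} = at y" by (rule at_within_Icc_at) (auto simp: a_def)
  ultimately have "((\<lambda>z. LBINT s=a..z. weight \<gamma> s) has_real_derivative weight \<gamma> y) (at y)" by simp
  then have "((\<lambda>z. c - (LBINT s=a..z. weight \<gamma> s)) has_real_derivative - weight \<gamma> y) (at y)"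
    by (auto intro!: derivative_eq_intros)
  moreover have "\<forall>\<^sub>F z in nhds y. c - (LBINT s=a..z. weight \<gamma> s) = (LINT s:{z..}|lborel. weight \<gamma> s)"
    using eventually_nhds_in_open[of "{a<..}" y] split by (auto elim!: eventually_mono simp: a_def)
  ultimately show ?thesis by (simp add: DERIV_cong_ev[OF refl _ refl, of "\<lambda>z. c - (LBINT s=a..z. weight \<gamma> s)"])
qed

lemma inverse_bracket_powr: "1 / bracket s powr (1 + \<alpha>) = weight (1 + \<alpha>) s"
  unfolding bracket_def weight_def powr_powr by (simp add: powr_minus_divide)

lemma phi_deriv:
  assumes "0 < \<alpha>"
  shows "(phi \<alpha> has_real_derivative - inverse (LBINT s. weight (1 + \<alpha>) s) * weight (1 + \<alpha>) y) (at y)"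
  unfolding phi_def[abs_def] inverse_bracket_powr
  by (rule DERIV_cong[OF DERIV_cmult[OF weight_tail_deriv]]) (use assms in simp_all)

text \<open>\<open>\<phi>\<^sub>1\<close> and \<open>\<phi>\<^sub>2\<close> are affine functions of \<open>\<phi>\<close>, and \<open>\<phi>'\<close> is a multiple of \<open>w\<^sup>2\<close>. The slope depends on \<open>\<mu>\<^sub>1\<close> and
\<open>\<mu>\<^sub>2\<close> and may be 0.\<close>

lemma Phi_eq_weight:
  assumes \<alpha>: "0 < \<alpha>" and j: "j \<in> {1, 2}"
  shows "\<exists>c\<ge>0. \<forall>y. Phi j \<alpha> \<mu>1 \<mu>2 y = c * weight ((1 + \<alpha>) / 2) y"
proof -
  let ?I = "inverse (LBINT s. weight (1 + \<alpha>) s)" and ?W = "weight (1 + \<alpha>)"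
  define \<kappa> where "\<kappa> = (if j = 1 then 1 / (1 + \<mu>2)\<^sup>2 - 1 / (1 + \<mu>1)\<^sup>2 else \<mu>2 / (1 + \<mu>2)\<^sup>2 - \<mu>1 / (1 + \<mu>1)\<^sup>2)"
  have "((if j = 1 then phi1 \<alpha> \<mu>1 \<mu>2 else phi2 \<alpha> \<mu>1 \<mu>2) has_real_derivative \<kappa> * (- ?I * ?W y)) (at y)" for y
  proof (cases "j = 1")
    case True
    have "phi1 \<alpha> \<mu>1 \<mu>2 = (\<lambda>y. 1 / (1 + \<mu>1)\<^sup>2 + \<kappa> * phi \<alpha> y)"
      using True by (auto simp: phi1_def \<kappa>_def fun_eq_iff diff_divide_distrib algebra_simps)
    then show ?thesis using True phi_deriv[OF \<alpha>, of y] by (auto intro!: derivative_eq_intros)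
  next
    case False
    have "phi2 \<alpha> \<mu>1 \<mu>2 = (\<lambda>y. \<mu>1 / (1 + \<mu>1)\<^sup>2 + \<kappa> * phi \<alpha> y)"
    proof
      have "m * (1 - p) + n * p = m + (n - m) * p" for m n p :: real by (simp add: algebra_simps)
      then show "phi2 \<alpha> \<mu>1 \<mu>2 y = \<mu>1 / (1 + \<mu>1)\<^sup>2 + \<kappa> * phi \<alpha> y" for y
        using False by (simp only: phi2_def \<kappa>_def if_False)
    qed
    then show ?thesis using False phi_deriv[OF \<alpha>, of y] by (auto intro!: derivative_eq_intros)
  qed
  then have d: "deriv (if j = 1 then phi1 \<alpha> \<mu>1 \<mu>2 else phi2 \<alpha> \<mu>1 \<mu>2) y = \<kappa> * (- ?I * ?W y)" for y
    by (rule DERIV_imp_deriv)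
  have "Phi j \<alpha> \<mu>1 \<mu>2 y = sqrt (\<bar>\<kappa> * ?I\<bar> * (weight ((1 + \<alpha>) / 2) y)\<^sup>2)" for y
  proof -
    have "2 * ((1 + \<alpha>) / 2) = 1 + \<alpha>" by simp
    then have "(weight ((1 + \<alpha>) / 2) y)\<^sup>2 = ?W y" by (simp only: weight_square)
    then show ?thesis unfolding Phi_def d by (simp add: abs_mult mult.assoc)
  qed
  then have "Phi j \<alpha> \<mu>1 \<mu>2 y = sqrt \<bar>\<kappa> * ?I\<bar> * weight ((1 + \<alpha>) / 2) y" for y
    by (simp add: real_sqrt_mult)
  then show ?thesis by (intro exI[of _ "sqrt \<bar>\<kappa> * ?I\<bar>"]) auto
qed

lemma fourier_transform_dilation:
  assumes "A > 0"
  shows "fourier_transform (\<lambda>x. f (x / A)) \<xi> = of_real A * fourier_transform f (A * \<xi>)"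
proof -
  have "fourier_transform (\<lambda>x. f (x / A)) \<xi> = \<bar>A\<bar> *\<^sub>R (LBINT x. cis (- ((0 + A * x) * \<xi>)) * f ((0 + A * x) / A))"
    unfolding fourier_transform_cis by (rule lborel_integral_real_affine) (use assms in simp)
  then show ?thesis using assms by (simp add: fourier_transform_cis scaleR_conv_of_real mult_ac)
qed

lemma abs_D_dilation:
  assumes A: "A > 0"
  shows "abs_D s (\<lambda>x. f (x / A)) (A * y) = of_real (A powr (- s)) * abs_D s f y"
proof -
  let ?F = "fourier_transform f"
  have "(LBINT \<xi>. cis (y * \<xi>) * (of_real (\<bar>\<xi>\<bar> powr s) * ?F \<xi>))
     = \<bar>A\<bar> *\<^sub>R (LBINT \<xi>. cis (y * (0 + A * \<xi>)) * (of_real (\<bar>0 + A * \<xi>\<bar> powr s) * ?F (0 + A * \<xi>)))"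
    by (rule lborel_integral_real_affine) (use A in simp)
  also have "\<dots> = (LBINT \<xi>. of_real (A powr s) * (cis (A * y * \<xi>) * (of_real (\<bar>\<xi>\<bar> powr s) * (of_real A * ?F (A * \<xi>)))))"
    using A by (simp add: scaleR_conv_of_real abs_mult powr_mult mult_ac flip: integral_mult_right_zero)
  also have "\<dots> = of_real (A powr s) * (LBINT \<xi>. cis (A * y * \<xi>) * (of_real (\<bar>\<xi>\<bar> powr s) * (of_real A * ?F (A * \<xi>))))"
    by (rule integral_mult_right_zero)
  finally have "abs_D s f y = of_real (A powr s) * abs_D s (\<lambda>x. f (x / A)) (A * y)"
    unfolding abs_D_eq_kernel inverse_fourier_transform_cis fourier_transform_dilation[OF A] by (simp only: mult.left_commute)
  moreover have "complex_of_real (A powr (- s)) * of_real (A powr s) = 1"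
    using A by (simp flip: of_real_mult powr_add)
  ultimately show ?thesis by (simp flip: mult.assoc)
qed

lemma abs_D_cmult: "abs_D s (\<lambda>y. c * f y) x = c * abs_D s f x"
proof -
  have "fourier_transform (\<lambda>y. c * f y) \<xi> = c * fourier_transform f \<xi>" for \<xi>
    unfolding fourier_transform_cis by (simp only: mult.left_commute[of _ c] integral_mult_right_zero)
  then show ?thesis unfolding abs_D_eq_kernel by (simp only: mult.left_commute[of _ c] kernel_cmult)
qed

lemma commutator_dilation:
  assumes A: "A > 0" and g: "\<And>x. g x = c * w (x / A)"
  shows "commutator (abs_D \<alpha>) g (\<lambda>x. f (x / A)) (A * y) = of_real (c * A powr (- \<alpha>)) * commutator (abs_D \<alpha>) w f y"
proof -
  have "(\<lambda>y. of_real (g y) * f (y / A)) = (\<lambda>y. of_real c * (\<lambda>x. of_real (w x) * f x) (y / A))"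
    by (simp add: g fun_eq_iff)
  then have "abs_D \<alpha> (\<lambda>y. of_real (g y) * f (y / A)) (A * y) = of_real c * (of_real (A powr (- \<alpha>)) * abs_D \<alpha> (\<lambda>x. of_real (w x) * f x) y)"
    by (simp only: abs_D_cmult abs_D_dilation[OF A, where f = "\<lambda>x. of_real (w x) * f x"])
  then show ?thesis
    unfolding commutator_def abs_D_dilation[OF A, where f = f] using A by (simp add: g algebra_simps)
qed

lemma nn_integral_dilation:
  assumes "A > 0" and [measurable]: "h \<in> borel_measurable borel"
  shows "(\<integral>\<^sup>+x. h x) = ennreal A * (\<integral>\<^sup>+y. h (A * y))"
  using nn_integral_real_affine[of h A 0] assms by simp

theorem lemma26:
  fixes \<alpha> :: real
  assumes "0 < \<alpha>" and "\<alpha> < 2"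
  shows "\<exists>C::real. C > 0 \<and>
    (\<forall>j\<in>{1, 2}. \<forall>\<mu>1 > -1. \<forall>\<mu>2 > -1. \<forall>u :: real \<Rightarrow> real. schwartz u \<longrightarrow> (\<forall>A > 1.
       L2_norm_squared
         (commutator (abs_D \<alpha>) (Phi_scaled j \<alpha> \<mu>1 \<mu>2 A) (\<lambda>x. complex_of_real (u x)))
       \<le> (if \<alpha> \<le> 1
          then ennreal (C / A powr (2 * \<alpha>)) *
            (\<integral>\<^sup>+x. ennreal ((u x)\<^sup>2 * (Phi_scaled j \<alpha> \<mu>1 \<mu>2 A x)\<^sup>2) \<partial>lborel)
          else ennreal (C / A powr \<alpha>) *
            (\<integral>\<^sup>+x. ennreal (((u x)\<^sup>2 + (cmod (abs_D (\<alpha> / 2) (\<lambda>y. complex_of_real (u y)) x))\<^sup>2)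
                * (Phi_scaled j \<alpha> \<mu>1 \<mu>2 A x)\<^sup>2) \<partial>lborel))))"
proof -
  let ?\<beta> = "(1 + \<alpha>) / 2"
  let ?w = "weight ?\<beta>"
  define R where "R f = (if \<alpha> \<le> 1 then \<integral>\<^sup>+x. ennreal ((norm (f x))\<^sup>2 * (?w x)\<^sup>2)
        else \<integral>\<^sup>+x. ennreal (((norm (f x))\<^sup>2 + (norm (abs_D (\<alpha> / 2) f x))\<^sup>2) * (?w x)\<^sup>2))" for f
  obtain C where C: "C > 0" "\<And>f. decaying 4 f \<Longrightarrow> L2_norm_squared (commutator (abs_D \<alpha>) ?w f) \<le> ennreal C * R f"
    using weighted_commutator_estimate[OF assms refl] unfolding R_def by blast
  have "L2_norm_squared (commutator (abs_D \<alpha>) (Phi_scaled j \<alpha> \<mu>1 \<mu>2 A) (\<lambda>x. complex_of_real (u x)))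
       \<le> (if \<alpha> \<le> 1
          then ennreal (C / A powr (2 * \<alpha>)) *
            (\<integral>\<^sup>+x. ennreal ((u x)\<^sup>2 * (Phi_scaled j \<alpha> \<mu>1 \<mu>2 A x)\<^sup>2))
          else ennreal (C / A powr \<alpha>) *
            (\<integral>\<^sup>+x. ennreal (((u x)\<^sup>2 + (cmod (abs_D (\<alpha> / 2) (\<lambda>y. complex_of_real (u y)) x))\<^sup>2)
                * (Phi_scaled j \<alpha> \<mu>1 \<mu>2 A x)\<^sup>2)))"
    if j: "j \<in> {1, 2}" and u: "schwartz u" and A: "A > 1" for j \<mu>1 \<mu>2 u A
  proof -
    have A0: "A > 0" using A by simp
    obtain c where c: "0 \<le> c" "\<And>y. Phi j \<alpha> \<mu>1 \<mu>2 y = c * ?w y" using Phi_eq_weight[OF assms(1) j] by blast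
    let ?U = "\<lambda>x. complex_of_real (u x)" and ?g = "Phi_scaled j \<alpha> \<mu>1 \<mu>2 A"
    \<comment> \<open>The function at unit scale: \<open>u(x) = f(x / A)\<close>.\<close>
    define f where "f x = complex_of_real (u (A * x))" for x
    have g: "?g x = c * ?w (x / A)" for x by (simp add: Phi_scaled_def c)
    have gA: "?g (A * y) = c * ?w y" for y using A by (simp add: g)
    have U: "?U = (\<lambda>x. f (x / A))" using A by (simp add: f_def)
    have Ud: "decaying 4 ?U" using schwartz_imp_decaying[OF u, of 4 0] by simp
    have fd: "decaying 4 f" using decaying_dilation[OF A0 Ud] by (simp add: f_def[abs_def])
    have Um [measurable]: "?U \<in> borel_measurable borel" "f \<in> borel_measurable borel"
      using Ud fd decaying_imp_quadratic_decay quadratic_decay_measurable by blast+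
    have [measurable]: "u \<in> borel_measurable borel" using measurable_compose[OF Um(1) borel_measurable_Re] by simp
    have [measurable]: "?g \<in> borel_measurable borel" unfolding g[abs_def] by measurable
    have [measurable]: "commutator (abs_D \<alpha>) ?g ?U \<in> borel_measurable borel" "commutator (abs_D \<alpha>) ?w f \<in> borel_measurable borel"
      unfolding commutator_def by measurable
    let ?q = "c\<^sup>2 * A powr (- 2 * \<alpha>)"
    have "L2_norm_squared (commutator (abs_D \<alpha>) ?g ?U) = ennreal A * (\<integral>\<^sup>+y. ennreal ((norm (commutator (abs_D \<alpha>) ?g ?U (A * y)))\<^sup>2))"
      unfolding L2_norm_squared_def by (rule nn_integral_dilation[OF A0]) measurable
    also have "(\<integral>\<^sup>+y. ennreal ((norm (commutator (abs_D \<alpha>) ?g ?U (A * y)))\<^sup>2))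
       = (\<integral>\<^sup>+y. ennreal ?q * ennreal ((norm (commutator (abs_D \<alpha>) ?w f y))\<^sup>2))"
    proof (rule nn_integral_cong)
      fix y
      have "(A powr (- \<alpha>))\<^sup>2 = A powr (- 2 * \<alpha>)" by (simp add: power2_eq_square flip: powr_add)
      then have "(norm (commutator (abs_D \<alpha>) ?g ?U (A * y)))\<^sup>2 = ?q * (norm (commutator (abs_D \<alpha>) ?w f y))\<^sup>2"
        unfolding U commutator_dilation[where w = ?w, OF A0 g] norm_mult norm_of_real power_mult_distrib power2_abs by simp
      then show "ennreal ((norm (commutator (abs_D \<alpha>) ?g ?U (A * y)))\<^sup>2) = ennreal ?q * ennreal ((norm (commutator (abs_D \<alpha>) ?w f y))\<^sup>2)"
        by (simp add: ennreal_mult)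
    qed
    also have "\<dots> = ennreal ?q * L2_norm_squared (commutator (abs_D \<alpha>) ?w f)"
      unfolding L2_norm_squared_def by (rule nn_integral_cmult) measurable
    also have "ennreal A * \<dots> \<le> ennreal A * (ennreal ?q * (ennreal C * R f))"
      by (intro mult_left_mono C(2) fd) auto
    finally have main: "L2_norm_squared (commutator (abs_D \<alpha>) ?g ?U) \<le> ennreal A * (ennreal ?q * (ennreal C * R f))" .
    show ?thesis
    proof (cases "\<alpha> \<le> 1")
      case True
      have "(\<integral>\<^sup>+x. ennreal ((u x)\<^sup>2 * (?g x)\<^sup>2)) = ennreal A * (\<integral>\<^sup>+y. ennreal ((u (A * y))\<^sup>2 * (?g (A * y))\<^sup>2))"
        by (rule nn_integral_dilation[OF A0]) measurable
      also have "(\<integral>\<^sup>+y. ennreal ((u (A * y))\<^sup>2 * (?g (A * y))\<^sup>2)) = (\<integral>\<^sup>+y. ennreal (c\<^sup>2) * ennreal ((norm (f y))\<^sup>2 * (?w y)\<^sup>2))"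
        unfolding gA by (intro nn_integral_cong) (simp add: f_def power_mult_distrib mult_ac flip: ennreal_mult)
      also have "\<dots> = ennreal (c\<^sup>2) * R f" using True unfolding R_def by (simp add: nn_integral_cmult)
      finally have "ennreal (C / A powr (2 * \<alpha>)) * (\<integral>\<^sup>+x. ennreal ((u x)\<^sup>2 * (?g x)\<^sup>2))
         = ennreal A * ((ennreal (C / A powr (2 * \<alpha>)) * ennreal (c\<^sup>2)) * R f)" by (simp only: mult_ac)
      also have "ennreal (C / A powr (2 * \<alpha>)) * ennreal (c\<^sup>2) = ennreal ?q * ennreal C"
        using C(1) by (simp add: powr_minus divide_inverse mult_ac flip: ennreal_mult)
      finally show ?thesis using main True by (simp add: mult.assoc)
    next
      case False
      let ?v = "abs_D (\<alpha> / 2) f" and ?V = "abs_D (\<alpha> / 2) ?U"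
      have V: "(norm (?V (A * y)))\<^sup>2 = A powr (- \<alpha>) * (norm (?v y))\<^sup>2" for y
      proof -
        have "(A powr (- (\<alpha> / 2)))\<^sup>2 = A powr (- \<alpha>)" by (simp add: power2_eq_square flip: powr_add)
        then show ?thesis unfolding U abs_D_dilation[OF A0] norm_mult norm_of_real power_mult_distrib power2_abs by simp
      qed
      have "(\<integral>\<^sup>+x. ennreal (((u x)\<^sup>2 + (norm (?V x))\<^sup>2) * (?g x)\<^sup>2))
          = ennreal A * (\<integral>\<^sup>+y. ennreal (((u (A * y))\<^sup>2 + (norm (?V (A * y)))\<^sup>2) * (?g (A * y))\<^sup>2))"
        by (rule nn_integral_dilation[OF A0]) measurable
      also have "\<dots> = ennreal A * (\<integral>\<^sup>+y. ennreal (((norm (f y))\<^sup>2 + A powr (- \<alpha>) * (norm (?v y))\<^sup>2) * (c * ?w y)\<^sup>2))"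
        unfolding gA V by (simp add: f_def)
      finally have I: "(\<integral>\<^sup>+x. ennreal (((u x)\<^sup>2 + (norm (?V x))\<^sup>2) * (?g x)\<^sup>2))
          = ennreal A * (\<integral>\<^sup>+y. ennreal (((norm (f y))\<^sup>2 + A powr (- \<alpha>) * (norm (?v y))\<^sup>2) * (c * ?w y)\<^sup>2))" .
      have "ennreal ?q * R f = (\<integral>\<^sup>+y. ennreal ?q * ennreal (((norm (f y))\<^sup>2 + (norm (?v y))\<^sup>2) * (?w y)\<^sup>2))"
        using False unfolding R_def by (simp add: nn_integral_cmult)
      also have "\<dots> \<le> (\<integral>\<^sup>+y. ennreal (A powr (- \<alpha>)) * ennreal (((norm (f y))\<^sup>2 + A powr (- \<alpha>) * (norm (?v y))\<^sup>2) * (c * ?w y)\<^sup>2))"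
      proof (rule nn_integral_mono)
        fix y
        have p: "A powr (- 2 * \<alpha>) = A powr (- \<alpha>) * A powr (- \<alpha>)" by (simp flip: powr_add)
        \<comment> \<open>\<open>A\<^bsup>-2\<alpha>\<^esup> (a + b) \<le> A\<^bsup>-\<alpha>\<^esup> (a + A\<^bsup>-\<alpha>\<^esup> b)\<close> for \<open>A > 1\<close>.\<close>
        have "A powr (- \<alpha>) \<le> 1" using A assms(1) powr_mono[of "- \<alpha>" 0 A] by simp
        then have "A powr (- \<alpha>) * (norm (f y))\<^sup>2 \<le> 1 * (norm (f y))\<^sup>2" by (rule mult_right_mono) simp
        then have "A powr (- \<alpha>) * ((norm (f y))\<^sup>2 + (norm (?v y))\<^sup>2) \<le> (norm (f y))\<^sup>2 + A powr (- \<alpha>) * (norm (?v y))\<^sup>2"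
          by (simp add: distrib_left)
        then have "(A powr (- \<alpha>) * (c * ?w y)\<^sup>2) * (A powr (- \<alpha>) * ((norm (f y))\<^sup>2 + (norm (?v y))\<^sup>2)) \<le> (A powr (- \<alpha>) * (c * ?w y)\<^sup>2) * ((norm (f y))\<^sup>2 + A powr (- \<alpha>) * (norm (?v y))\<^sup>2)"
          by (rule mult_left_mono) simp
        moreover have "(A powr (- \<alpha>) * (c * ?w y)\<^sup>2) * (A powr (- \<alpha>) * ((norm (f y))\<^sup>2 + (norm (?v y))\<^sup>2)) = ?q * (((norm (f y))\<^sup>2 + (norm (?v y))\<^sup>2) * (?w y)\<^sup>2)"
          unfolding p power_mult_distrib by (simp only: mult_ac)
        ultimately have "?q * (((norm (f y))\<^sup>2 + (norm (?v y))\<^sup>2) * (?w y)\<^sup>2) \<le> A powr (- \<alpha>) * (((norm (f y))\<^sup>2 + A powr (- \<alpha>) * (norm (?v y))\<^sup>2) * (c * ?w y)\<^sup>2)"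
          by (simp only: mult_ac)
        then show "ennreal ?q * ennreal (((norm (f y))\<^sup>2 + (norm (?v y))\<^sup>2) * (?w y)\<^sup>2) \<le> ennreal (A powr (- \<alpha>)) * ennreal (((norm (f y))\<^sup>2 + A powr (- \<alpha>) * (norm (?v y))\<^sup>2) * (c * ?w y)\<^sup>2)"
          by (simp flip: ennreal_mult add: ennreal_leI)
      qed
      also have "\<dots> = ennreal (A powr (- \<alpha>)) * (\<integral>\<^sup>+y. ennreal (((norm (f y))\<^sup>2 + A powr (- \<alpha>) * (norm (?v y))\<^sup>2) * (c * ?w y)\<^sup>2))"
        by (rule nn_integral_cmult) measurable
      finally have "ennreal A * (ennreal C * (ennreal ?q * R f)) \<le> ennreal A * (ennreal C * (ennreal (A powr (- \<alpha>)) * (\<integral>\<^sup>+y. ennreal (((norm (f y))\<^sup>2 + A powr (- \<alpha>) * (norm (?v y))\<^sup>2) * (c * ?w y)\<^sup>2))))"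
        by (intro mult_left_mono) auto
      also have "\<dots> = (ennreal C * ennreal (A powr (- \<alpha>))) * (ennreal A * (\<integral>\<^sup>+y. ennreal (((norm (f y))\<^sup>2 + A powr (- \<alpha>) * (norm (?v y))\<^sup>2) * (c * ?w y)\<^sup>2)))"
        by (simp only: mult_ac)
      also have "ennreal C * ennreal (A powr (- \<alpha>)) = ennreal (C / A powr \<alpha>)"
        using C(1) by (simp add: powr_minus divide_inverse flip: ennreal_mult)
      finally have "ennreal A * (ennreal ?q * (ennreal C * R f)) \<le> ennreal (C / A powr \<alpha>) * (\<integral>\<^sup>+x. ennreal (((u x)\<^sup>2 + (norm (?V x))\<^sup>2) * (?g x)\<^sup>2))"
        unfolding I by (simp only: mult.left_commute[of "ennreal C"])
      with main False show ?thesis by simp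
    qed
  qed
  with C(1) show ?thesis by blast
qed

end
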